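(* Let $\nu$ be a radial weight and let $\omega\in\widehat{\mathcal{D}}$. Then the following conditions are equivalent: (i) $P_\omega: L^\infty_{\widehat{\nu}}\to \mathcal{B}^\infty_{\widehat{\nu}}$ is bounded; (ii) $\displaystyle \sup_{x\ge 0}\frac{\nu_x}{\omega_{2x}}\left(\frac{\omega}{\widehat{\nu}}\right)_x<\infty$; (iii) $\displaystyle \sup_{0\le r<1}\frac{\widehat{\nu}(r)}{\widehat{\omega}(r)}\int_r^1\frac{\omega(s)}{\widehat{\nu}(s)}\,ds<\infty$.
   Context: Let $\mathbb{D}$ be the open unit disc of $\mathbb{C}$, $\mathcal{H}(\mathbb{D})$ the space of analytic functions in $\mathbb{D}$, and $dA(z)=\frac{dx\,dy}{\pi}$ the normalized area measure. A radial weight is a nonnegative function $\omega\in L^1([0,1))$, extended to $\mathbb{D}$ by $\omega(z)=\omega(|z|)$. Write $\widehat{\omega}(z)=\widehat{\omega}(|z|)=\int_{|z|}^1\omega(s)\,ds$; it is assumed throughout that $\widehat{\omega}(z)>0$ for all $z\in\mathbb{D}$. The moments of a nonnegative function $\omega$ on $[0,1)$ are $\omega_x=\int_0^1 r^x\omega(r)\,dr$, $x\ge0$; in particular $\left(\frac{\omega}{\widehat{\nu}}\right)_x=\int_0^1 r^x\frac{\omega(r)}{\widehat{\nu}(r)}\,dr$. A radial weight $\omega$ belongs to $\widehat{\mathcal{D}}$ if there is $C>0$ such that $\widehat{\omega}(r)\le C\,\widehat{\omega}\left(\frac{1+r}{2}\right)$ as $r\to1^-$ (i.e. for all $r<1$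 close enough to $1$). For a radial weight $\omega$, the Bergman projection is $$P_\omega(f)(z)=\int_{\mathbb{D}}f(\zeta)\,\overline{B^\omega_z(\zeta)}\,\omega(\zeta)\,dA(\zeta),\qquad B^\omega_z(\zeta)=\sum_{n=0}^\infty\frac{(\overline{z}\zeta)^n}{2\omega_{2n+1}},$$ where $B^\omega_z$ is the reproducing kernel of the Bergman space $A^2_\omega=L^2(\mathbb{D},\omega\,dA)\cap\mathcal{H}(\mathbb{D})$. For a radial weight $\nu$, $L^\infty_{\widehat{\nu}}$ is the space of measurable $f:\mathbb{D}\to\mathbb{C}$ with $\|f\|_{\infty,\widehat{\nu}}=\operatorname{ess\,sup}_{z\in\mathbb{D}}|f(z)|\widehat{\nu}(z)<\infty$, and the Bloch type space is $\mathcal{B}^\infty_{\widehat{\nu}}=\{f\in\mathcal{H}(\mathbb{D}):\|f\|_{\mathcal{B}^\infty_{\widehat{\nu}}}=\sup_{z\in\mathbb{D}}(1-|z|)\widehat{\nu}(z)|f'(z)|<\infty\}$. Boundedness of $P_\omega:X\to Y$ means that for every $f\in X$ the integral $\int_{\mathbb{D}}f(\zeta)\,\overline{B^\omega_z(\zeta)}\,\omega(\zeta)\,dA(\zeta)$, as a function of $z\in\mathbb{D}$, defines an element of $Y$, and $\|P_\omega f\|_Y\le C\|f\|_X$ with $C$ independent of $f$. *)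

theory Defs
  imports "HOL-Complex_Analysis.Complex_Analysis" "HOL-Probability.Essential_Supremum"
begin

abbreviation unit_disc :: "complex set"
  where "unit_disc \<equiv> ball 0 1"

text \<open>The normalized area measure \<open>dx dy / \<pi>\<close>.\<close>

definition disc_area :: "complex measure"
  where "disc_area = scale_measure (ennreal (1 / pi)) (lebesgue_on unit_disc)"

text \<open>
  A radial weight is represented by its radial profile on \<open>[0,1)\<close>, so that its value at a point
  \<open>z\<close> of the disc is \<open>\<omega> (cmod z)\<close>. Values of the profile outside \<open>[0,1)\<close> are never used.
\<close>

definition tail :: "(real \<Rightarrow> real) \<Rightarrow> real \<Rightarrow> real"
  where "tail \<omega> r = (LINT s:{r..<1}|lebesgue. \<omega> s)"

definition radial_weight :: "(real \<Rightarrow> real) \<Rightarrow> bool"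
  where "radial_weight \<omega> \<longleftrightarrow>
    (\<forall>r\<in>{0..<1}. 0 \<le> \<omega> r) \<and> set_integrable lebesgue {0..<1} \<omega> \<and> (\<forall>r\<in>{0..<1}. 0 < tail \<omega> r)"

definition doubling_weight :: "(real \<Rightarrow> real) \<Rightarrow> bool"
  where "doubling_weight \<omega> \<longleftrightarrow>
    radial_weight \<omega> \<and> (\<exists>C>0. \<forall>\<^sub>F r in at_left 1. tail \<omega> r \<le> C * tail \<omega> ((1 + r) / 2))"

text \<open>
  Moments are extended nonnegative reals, because they are also taken of functions such as
  \<open>\<lambda>r. \<omega> r / tail \<nu> r\<close> that need not be integrable. The convention \<open>0 powr 0 = 0\<close> only
  affects the integrand at the single point \<open>r = 0\<close>.
\<close>

definition moment :: "(real \<Rightarrow> real) \<Rightarrow> real \<Rightarrow> ennreal"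
  where "moment \<omega> x = (\<integral>\<^sup>+r\<in>{0..<1}. ennreal (r powr x * \<omega> r) \<partial>lebesgue)"

definition bergman_kernel :: "(real \<Rightarrow> real) \<Rightarrow> complex \<Rightarrow> complex \<Rightarrow> complex"
  where "bergman_kernel \<omega> z \<zeta> =
    (\<Sum>n. (cnj z * \<zeta>) ^ n / complex_of_real (2 * enn2real (moment \<omega> (2 * real n + 1))))"

definition bergman_integrand ::
  "(real \<Rightarrow> real) \<Rightarrow> (complex \<Rightarrow> complex) \<Rightarrow> complex \<Rightarrow> complex \<Rightarrow> complex"
  where "bergman_integrand \<omega> f z \<zeta> =
    f \<zeta> * cnj (bergman_kernel \<omega> z \<zeta>) * complex_of_real (\<omega> (cmod \<zeta>))"

definition bergman_projection ::
  "(real \<Rightarrow> real) \<Rightarrow> (complex \<Rightarrow> complex) \<Rightarrow> complex \<Rightarrow> complex"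
  where "bergman_projection \<omega> f z = (LINT \<zeta>|disc_area. bergman_integrand \<omega> f z \<zeta>)"

definition Linf_norm :: "(real \<Rightarrow> real) \<Rightarrow> (complex \<Rightarrow> complex) \<Rightarrow> ennreal"
  where "Linf_norm \<nu> f = esssup disc_area (\<lambda>z. ennreal (cmod (f z) * tail \<nu> (cmod z)))"

definition Linf :: "(real \<Rightarrow> real) \<Rightarrow> (complex \<Rightarrow> complex) set"
  where "Linf \<nu> = {f \<in> borel_measurable disc_area. Linf_norm \<nu> f < \<infinity>}"

definition bloch_norm :: "(real \<Rightarrow> real) \<Rightarrow> (complex \<Rightarrow> complex) \<Rightarrow> ennreal"
  where "bloch_norm \<nu> f =
    (SUP z\<in>unit_disc. ennreal ((1 - cmod z) * tail \<nu> (cmod z) * cmod (deriv f z)))"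

definition bloch :: "(real \<Rightarrow> real) \<Rightarrow> (complex \<Rightarrow> complex) set"
  where "bloch \<nu> = {f. f holomorphic_on unit_disc \<and> bloch_norm \<nu> f < \<infinity>}"

text \<open>
  Integrability is required explicitly, since the Bochner integral of a non-integrable function
  is \<open>0\<close> by convention.
\<close>

definition bergman_projection_bounded :: "(real \<Rightarrow> real) \<Rightarrow> (real \<Rightarrow> real) \<Rightarrow> bool"
  where "bergman_projection_bounded \<omega> \<nu> \<longleftrightarrow>
    (\<forall>f\<in>Linf \<nu>. (\<forall>z\<in>unit_disc. integrable disc_area (bergman_integrand \<omega> f z)) \<and>
      bergman_projection \<omega> f \<in> bloch \<nu>) \<and>
    (\<exists>C::real. \<forall>f\<in>Linf \<nu>. bloch_norm \<nu> (bergman_projection \<omega> f) \<le> ennreal C * Linf_norm \<nu> f)"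

end

theory Submission
  imports Defs
begin

text \<open>
  Write \<open>\<sigma> = \<omega> / tail \<nu>\<close>. For a doubling weight the moment of order \<open>x\<close> is comparable with the tail at
  \<open>x / (x + 1)\<close>. Condition (iii) says that \<open>tail \<sigma>\<close> is comparable with \<open>tail \<omega> / tail \<nu>\<close>; it forces \<open>\<nu>\<close> and
  \<open>\<sigma>\<close> to be doubling, so that (ii) is (iii) written in terms of moments.

  Boundedness of the projection implies (iii) by testing on \<open>sgn z ^ n / tail \<nu> (cmod z)\<close>, whose projection
  is a multiple of \<open>z ^ n\<close>, at points with \<open>cmod z = n / (n + 1)\<close>.

  Conversely, the derivative of the projection is dominated by the integral of
  \<open>\<sigma> (cmod w) * cmod (\<Sum>n. (n + 1) * c\<^sub>n\<^sub>+\<^sub>1 * (z * cnj w) ^ n)\<close>, where \<open>c\<^sub>n = 1 / (2 \<omega>\<^sub>2\<^sub>n\<^sub>+\<^sub>1)\<close>. Two summations by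
  parts turn the series into a combination of the polynomials \<open>v * (\<Sum>j\<le>k. D\<^sub>j D\<^sub>k\<^sub>-\<^sub>j)\<close> in the angular
  variable \<open>v\<close>, where \<open>D\<^sub>j = 1 + v + \<dots> + v ^ (j - 1)\<close>. By Parseval their \<open>L\<^sup>1\<close> norms are at most of order
  \<open>k\<^sup>2\<close>, and the doubling property bounds the second differences of \<open>c\<^sub>n\<close> by a multiple of \<open>c\<^sub>n / n\<^sup>2\<close>.
\<close>

subsection \<open>Rotations and radial functions on the disc\<close>

text \<open>Taking absolute values under the sum is too lossy: termwise, the derivative of the
  kernel is dominated by a series with general term \<open>n * c\<^sub>n\<close>, which leads to
  \<open>1 / (1 - cmod z)\<^sup>2\<close> where the Bloch norm allows only
  \<open>1 / (1 - cmod z)\<close>. One factor n has to come from cancellation in the angle. A single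
  summation by parts leaves Dirichlet-type sums, whose L1 norm carries a logarithm; the second one
  leaves products of two such sums, for which the Cauchy-Schwarz and Parseval bounds lose nothing.
  The radial factor \<open>(cmod z * cmod w) ^ i\<close> is differenced together with the
  coefficients, and a power of about i/2 of it is kept. Its \<open>cmod w\<close> part becomes a
  moment of \<open>\<sigma>\<close>; half of its \<open>cmod z\<close> part pays for replacing a
  moment of \<open>\<nu>\<close> by \<open>tail \<nu> (cmod z)\<close>; the rest is summed as a
  geometric series and yields \<open>1 / (1 - cmod z)\<close>. The exponents \<open>i div 2\<close>
  and \<open>i div 4\<close> come from this budget. Two facts on planar measure suffice, and no
  change to polar coordinates: the image of area under \<open>cmod\<close>, and invariance under
  rotations.\<close>

lemma borel_measurable_Complex:
  "(\<lambda>(x, y). Complex x y) \<in> borel_measurable (borel :: (real \<times> real) measure)"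
  unfolding Complex_eq split_def by (intro borel_measurable_continuous_onI continuous_intros)

text \<open>Both measures agree on boxes. This carries Fubini from pairs of reals to the complex
  variable, where the shears below are treated line by line.\<close>

lemma lborel_complex_eq_distr:
  "(lborel :: complex measure) = distr (lborel :: (real \<times> real) measure) borel (\<lambda>(x, y). Complex x y)"
proof (rule lborel_eqI)
  fix l u :: complex
  assume "\<And>b. b \<in> Basis \<Longrightarrow> l \<bullet> b \<le> u \<bullet> b"
  then have le: "Re l \<le> Re u" "Im l \<le> Im u"
    by (force simp: Basis_complex_def)+
  have "(\<lambda>(x, y). Complex x y) -` box l u \<inter> space lborel = box (Re l) (Re u) \<times> box (Im l) (Im u)"
    by (auto simp: box_def Basis_complex_def)
  with le show "emeasure (distr lborel borel (\<lambda>(x, y). Complex x y)) (box l u) = (\<Prod>b\<in>Basis. (u - l) \<bullet> b)"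
    using borel_measurable_Complex
    by (subst emeasure_distr, simp, simp)
      (simp add: lborel_prod[symmetric] lborel.emeasure_pair_measure_Times Basis_complex_def ennreal_mult)
qed simp

lemma nn_integral_lborel_complex:
  fixes f :: "complex \<Rightarrow> ennreal"
  assumes "f \<in> borel_measurable borel"
  shows "(\<integral>\<^sup>+z. f z \<partial>lborel) = (\<integral>\<^sup>+y. \<integral>\<^sup>+x. f (Complex x y) \<partial>lborel \<partial>lborel)"
    and "(\<integral>\<^sup>+z. f z \<partial>lborel) = (\<integral>\<^sup>+x. \<integral>\<^sup>+y. f (Complex x y) \<partial>lborel \<partial>lborel)"
proof -
  note m = borel_measurable_Complex
  have m'[measurable]: "(\<lambda>p. f (Complex (fst p) (snd p))) \<in> borel_measurable (lborel \<Otimes>\<^sub>M lborel)"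
    using measurable_compose[OF m assms] by (simp add: lborel_prod split_def)
  have eq: "(\<integral>\<^sup>+z. f z \<partial>lborel) = (\<integral>\<^sup>+p. f (Complex (fst p) (snd p)) \<partial>(lborel \<Otimes>\<^sub>M lborel))"
    unfolding lborel_complex_eq_distr using assms m
    by (subst nn_integral_distr) (auto simp: lborel_prod split_def)
  show "(\<integral>\<^sup>+z. f z \<partial>lborel) = (\<integral>\<^sup>+y. \<integral>\<^sup>+x. f (Complex x y) \<partial>lborel \<partial>lborel)"
    unfolding eq using lborel_pair.nn_integral_snd[of "\<lambda>p. f (Complex (fst p) (snd p))"] m'
    by (simp add: split_def)
  show "(\<integral>\<^sup>+z. f z \<partial>lborel) = (\<integral>\<^sup>+x. \<integral>\<^sup>+y. f (Complex x y) \<partial>lborel \<partial>lborel)"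
    unfolding eq using lborel.nn_integral_fst[of "\<lambda>p. f (Complex (fst p) (snd p))" lborel] m'
    by (simp add: split_def)
qed

text \<open>On each horizontal (respectively vertical) line a shear is a translation, so Fubini
  reduces the claim to translation invariance in one real variable.\<close>

lemma nn_integral_lborel_shear:
  fixes f :: "complex \<Rightarrow> ennreal"
  assumes [measurable]: "f \<in> borel_measurable borel"
  shows "(\<integral>\<^sup>+z. f (z + of_real (t * Im z)) \<partial>lborel) = (\<integral>\<^sup>+z. f z \<partial>lborel)"
    and "(\<integral>\<^sup>+z. f (z + \<i> * of_real (t * Re z)) \<partial>lborel) = (\<integral>\<^sup>+z. f z \<partial>lborel)"
proof -
  have cm: "(\<lambda>x. Complex x y) \<in> borel_measurable borel" "(\<lambda>y. Complex x y) \<in> borel_measurable borel" for x y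
    unfolding Complex_eq by measurable
  have fm [measurable]: "(\<lambda>x. f (Complex x y)) \<in> borel_measurable borel"
      "(\<lambda>y. f (Complex x y)) \<in> borel_measurable borel" for x y
    using measurable_compose[OF cm(1) assms] measurable_compose[OF cm(2) assms] by auto
  have tr: "(\<integral>\<^sup>+x. g (c + x) \<partial>lborel) = (\<integral>\<^sup>+x. g x \<partial>lborel)"
    if [measurable]: "g \<in> borel_measurable borel" for g :: "real \<Rightarrow> ennreal" and c
    by (subst lborel_distr_plus[of c, symmetric], subst nn_integral_distr) auto
  show "(\<integral>\<^sup>+z. f (z + of_real (t * Im z)) \<partial>lborel) = (\<integral>\<^sup>+z. f z \<partial>lborel)"
  proof -
    have "(\<integral>\<^sup>+z. f (z + of_real (t * Im z)) \<partial>lborel)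
        = (\<integral>\<^sup>+y. \<integral>\<^sup>+x. f (Complex x y + of_real (t * y)) \<partial>lborel \<partial>lborel)"
      by (subst nn_integral_lborel_complex(1)) auto
    also have "\<dots> = (\<integral>\<^sup>+y. \<integral>\<^sup>+x. f (Complex (t * y + x) y) \<partial>lborel \<partial>lborel)"
      by (intro nn_integral_cong arg_cong[where f = f]) (auto simp: complex_eq_iff)
    also have "\<dots> = (\<integral>\<^sup>+y. \<integral>\<^sup>+x. f (Complex x y) \<partial>lborel \<partial>lborel)"
      by (intro nn_integral_cong tr) auto
    finally show ?thesis by (simp add: nn_integral_lborel_complex(1)[OF assms])
  qed
  show "(\<integral>\<^sup>+z. f (z + \<i> * of_real (t * Re z)) \<partial>lborel) = (\<integral>\<^sup>+z. f z \<partial>lborel)"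
  proof -
    have "(\<integral>\<^sup>+z. f (z + \<i> * of_real (t * Re z)) \<partial>lborel)
        = (\<integral>\<^sup>+x. \<integral>\<^sup>+y. f (Complex x y + \<i> * of_real (t * x)) \<partial>lborel \<partial>lborel)"
      by (subst nn_integral_lborel_complex(2)) auto
    also have "\<dots> = (\<integral>\<^sup>+x. \<integral>\<^sup>+y. f (Complex x (t * x + y)) \<partial>lborel \<partial>lborel)"
      by (intro nn_integral_cong arg_cong[where f = f]) (auto simp: complex_eq_iff)
    also have "\<dots> = (\<integral>\<^sup>+x. \<integral>\<^sup>+y. f (Complex x y) \<partial>lborel \<partial>lborel)"
      by (intro nn_integral_cong tr) auto
    finally show ?thesis by (simp add: nn_integral_lborel_complex(2)[OF assms])
  qed
qed

text \<open>A rotation by an angle other than \<open>\<pi>\<close> is a composition of three shears.\<close>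
lemma nn_integral_lborel_rotate:
  fixes f :: "complex \<Rightarrow> ennreal" and c :: complex
  assumes [measurable]: "f \<in> borel_measurable borel" and c: "cmod c = 1" "c \<noteq> -1"
  shows "(\<integral>\<^sup>+z. f (c * z) \<partial>lborel) = (\<integral>\<^sup>+z. f z \<partial>lborel)"
proof -
  define a b where "a = Re c" and "b = Im c"
  have ab: "a\<^sup>2 + b\<^sup>2 = 1" using c by (simp add: a_def b_def cmod_def)
  have a: "1 + a \<noteq> 0"
  proof
    assume "1 + a = 0"
    then have "a = -1" by simp
    with ab have "b = 0" by simp
    with \<open>a = -1\<close> c show False by (auto simp: complex_eq_iff a_def b_def)
  qed
  \<comment> \<open>For \<open>c = cis \<theta>\<close> this is \<open>- tan (\<theta> / 2)\<close>,
    and b is \<open>sin \<theta>\<close>: the classical factorization of a rotation into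
    shears.\<close>
  define t where "t = - b / (1 + a)"
  have tb: "1 + t * b = a" "2 * t + t * t * b = - b"
  proof -
    have b2: "b * b = (1 - a) * (1 + a)" using ab by (simp add: algebra_simps power2_eq_square)
    have "t * b = - (b * b) / (1 + a)" by (simp add: t_def)
    also have "\<dots> = a - 1" using a unfolding b2 by (simp add: field_simps)
    finally show *: "1 + t * b = a" by simp
    have "2 * t + t * t * b = t * (1 + (1 + t * b))" by (simp add: algebra_simps)
    also have "\<dots> = - b" using a unfolding * by (simp add: t_def)
    finally show "2 * t + t * t * b = - b" .
  qed
  define X where "X = (\<lambda>z. z + of_real (t * Im z))"
  define Y where "Y = (\<lambda>z. z + \<i> * of_real (b * Re z))"
  have [measurable]: "X \<in> borel_measurable borel" "Y \<in> borel_measurable borel"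
    unfolding X_def Y_def by measurable
  have "c * z = X (Y (X z))" for z
  proof -
    define x y where "x = Re z" and "y = Im z"
    have "Re (X (Y (X z))) = x * (1 + t * b) + y * (2 * t + t * t * b)"
      "Im (X (Y (X z))) = y * (1 + t * b) + b * x"
      by (simp_all add: X_def Y_def x_def y_def algebra_simps)
    then show ?thesis
      unfolding tb by (simp add: complex_eq_iff x_def y_def a_def b_def algebra_simps)
  qed
  then have "(\<integral>\<^sup>+z. f (c * z) \<partial>lborel) = (\<integral>\<^sup>+z. f (X (Y (X z))) \<partial>lborel)" by simp
  also have "\<dots> = (\<integral>\<^sup>+z. f (X (Y z)) \<partial>lborel)"
    using nn_integral_lborel_shear(1)[of "\<lambda>z. f (X (Y z))" t] by (simp add: X_def)
  also have "\<dots> = (\<integral>\<^sup>+z. f (X z) \<partial>lborel)"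
    using nn_integral_lborel_shear(2)[of "\<lambda>z. f (X z)" b] by (simp add: Y_def)
  also have "\<dots> = (\<integral>\<^sup>+z. f z \<partial>lborel)"
    using nn_integral_lborel_shear(1)[of f t] by (simp add: X_def)
  finally show ?thesis .
qed


text \<open>The image of area under the modulus is identified without a Jacobian: a finite measure
  on the line is determined by its values on half-lines, and here these are differences of areas of
  concentric discs, matching the integral of \<open>2 * pi * r\<close>.\<close>

lemma emeasure_vimage_cmod_borel:
  assumes "A \<in> sets borel"
  shows "emeasure lborel (cmod -` A \<inter> ball 0 1)
    = (\<integral>\<^sup>+r. ennreal (2 * pi * r) * indicator {0..<1} r * indicator A r \<partial>lborel)"
proof -
  define M where "M = distr (restrict_space lborel (ball 0 1)) borel cmod"
  define N where "N = density lborel (\<lambda>r. ennreal (2 * pi * r) * indicator {0..<1::real} r)"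
  have cm: "cmod \<in> borel_measurable (restrict_space lborel (ball 0 1))"
    by (intro measurable_restrict_space1) measurable
  have eM: "emeasure M B = emeasure lborel (cmod -` B \<inter> ball 0 1)" if "B \<in> sets borel" for B
    using that cm unfolding M_def
    by (subst emeasure_distr) (auto simp: emeasure_restrict_space space_restrict_space Int_commute)
  have area: "emeasure lborel (ball (0::complex) r) = ennreal (pi * r\<^sup>2)"
    "emeasure lborel (cball (0::complex) r) = ennreal (pi * r\<^sup>2)" if "0 \<le> r" for r
    using that by (simp_all add: emeasure_ball emeasure_cball unit_ball_vol_2)
  have gt: "emeasure M {x<..} = ennreal (pi * (1 - (min 1 (max 0 x))\<^sup>2))" for x
  proof -
    consider "x < 0" | "0 \<le> x" "x < 1" | "1 \<le> x" by linarith
    then show ?thesis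
    proof cases
      case 1
      then have "cmod -` {x<..} \<inter> ball 0 1 = ball 0 1"
        by (auto intro: less_le_trans[OF _ norm_ge_zero])
      with 1 show ?thesis using area(1)[of 1] by (simp add: eM)
    next
      case 2
      have "cmod -` {x<..} \<inter> ball 0 1 = ball 0 1 - cball 0 x"
        by auto
      moreover have "emeasure lborel (ball (0::complex) 1 - cball 0 x)
          = emeasure lborel (ball (0::complex) 1) - emeasure lborel (cball (0::complex) x)"
        using 2 by (intro emeasure_Diff) (auto simp: area)
      ultimately show ?thesis
        using 2 area(1)[of 1] area(2)[of x]
        by (simp add: eM ennreal_minus right_diff_distrib)
    next
      case 3
      then have "cmod -` {x<..} \<inter> ball 0 1 = {}" by auto
      with 3 show ?thesis by (simp add: eM)
    qed
  qed
  have "M = N"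
  proof (rule measure_eqI_lessThan)
    show "sets M = sets borel" "sets N = sets borel" by (simp_all add: M_def N_def)
    fix x
    show "emeasure M {x<..} < \<infinity>" by (simp add: gt)
    \<comment> \<open>Clamping to [0,1] merges the three positions of x relative to the unit
      interval; the endpoints y and 1 are null and may be included freely.\<close>
    define y where "y = min 1 (max 0 x)"
    have y: "0 \<le> y" "y \<le> 1" by (auto simp: y_def)
    have "emeasure N {x<..} = (\<integral>\<^sup>+r. ennreal (2 * pi * r) * indicator {y..1} r \<partial>lborel)"
      unfolding N_def
    proof (subst emeasure_density, simp, simp, rule nn_integral_cong_AE)
      have "AE r in lborel. r \<noteq> y \<and> r \<noteq> 1" by (simp add: AE_lborel_singleton)
      then show "AE r in lborel. ennreal (2 * pi * r) * indicator {0..<1} r * indicator {x<..} r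
          = ennreal (2 * pi * r) * indicator {y..1} r"
        by eventually_elim (auto simp: y_def indicator_def)
    qed
    also have "\<dots> = ennreal (pi * 1\<^sup>2 - pi * y\<^sup>2)"
      by (rule nn_integral_FTC_Icc) (use y in \<open>auto intro!: derivative_eq_intros\<close>)
    finally show "emeasure M {x<..} = emeasure N {x<..}"
      by (simp add: gt y_def right_diff_distrib)
  qed
  then show ?thesis
    using assms by (simp add: eM[symmetric] N_def emeasure_density)
qed

text \<open>Radial profiles are only Lebesgue measurable, so the Borel formula must pass to the
  completion. The point is that the preimage under \<open>cmod\<close> of a null set is null, which
  the Borel formula itself provides.\<close>

lemma vimage_cmod_lebesgue:
  assumes "A \<in> sets lebesgue"
  shows "cmod -` A \<inter> ball 0 1 \<in> sets lebesgue"
    and "emeasure lebesgue (cmod -` A \<inter> ball 0 1)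
      = (\<integral>\<^sup>+r. ennreal (2 * pi * r) * indicator {0..<1} r * indicator A r \<partial>lebesgue)"
proof -
  obtain S N N' where A: "A = S \<union> N" and N: "N \<subseteq> N'" "N' \<in> null_sets lborel" and S: "S \<in> sets lborel"
    using assms by (rule sets_completionE)
  have N'b: "N' \<in> sets borel" using N by auto
  have bm: "cmod -` B \<inter> ball 0 1 \<in> sets borel" if "B \<in> sets borel" for B
  proof -
    have "cmod -` B \<inter> space borel \<in> sets borel"
      using that by (intro measurable_sets[of _ _ borel]) auto
    then show ?thesis by (auto intro: sets.Int)
  qed
  have AE: "AE r in lborel. r \<notin> N'" using N by (simp add: AE_not_in)
  have "emeasure lborel (cmod -` N' \<inter> ball 0 1) = 0"
    unfolding emeasure_vimage_cmod_borel[OF N'b]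
    by (rule trans[OF nn_integral_cong_AE[where v = "\<lambda>_. 0"]], use AE in eventually_elim) auto
  then have null: "cmod -` N' \<inter> ball 0 1 \<in> null_sets lborel"
    using bm[OF N'b] by auto
  have split: "cmod -` A \<inter> ball 0 1 = (cmod -` S \<inter> ball 0 1) \<union> (cmod -` N \<inter> ball 0 1)"
    using A by auto
  have sub: "cmod -` N \<inter> ball 0 1 \<subseteq> cmod -` N' \<inter> ball 0 1"
    using N by auto
  have nullN: "cmod -` N \<inter> ball 0 1 \<in> null_sets lebesgue"
    using null sub null_sets_completion_iff2 by blast
  show "cmod -` A \<inter> ball 0 1 \<in> sets lebesgue"
    using nullN bm[of S] S unfolding split by (intro sets.Un) auto
  have "emeasure lebesgue (cmod -` A \<inter> ball 0 1) = emeasure lebesgue (cmod -` S \<inter> ball 0 1)"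
    unfolding split using nullN bm[of S] S by (intro emeasure_Un_null_set) auto
  also have "\<dots> = emeasure lborel (cmod -` S \<inter> ball 0 1)"
    using bm[of S] S by simp
  also have "\<dots> = (\<integral>\<^sup>+r. ennreal (2 * pi * r) * indicator {0..<1} r * indicator S r \<partial>lborel)"
    using S by (intro emeasure_vimage_cmod_borel) auto
  also have "\<dots> = (\<integral>\<^sup>+r. ennreal (2 * pi * r) * indicator {0..<1} r * indicator A r \<partial>lborel)"
    by (rule nn_integral_cong_AE, use AE in eventually_elim) (use A N in \<open>auto simp: indicator_def\<close>)
  finally show "emeasure lebesgue (cmod -` A \<inter> ball 0 1)
      = (\<integral>\<^sup>+r. ennreal (2 * pi * r) * indicator {0..<1} r * indicator A r \<partial>lebesgue)"
    by (simp add: nn_integral_completion)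
qed

section \<open>Integration against the normalized area measure of the disc\<close>

lemma space_disc_area [simp]: "space disc_area = ball 0 1"
  by (simp add: disc_area_def space_scale_measure space_restrict_space)

lemma sets_disc_area [measurable_cong]: "sets disc_area = sets (lebesgue_on (ball 0 1))"
  by (simp add: disc_area_def)

lemma nn_integral_disc_area:
  assumes "f \<in> borel_measurable disc_area"
  shows "(\<integral>\<^sup>+z. f z \<partial>disc_area) = ennreal (1 / pi) * (\<integral>\<^sup>+z. f z \<partial>lebesgue_on (ball 0 1))"
  using assms unfolding disc_area_def by (intro nn_integral_scale_measure) (simp cong: measurable_cong_sets)

lemma distr_cmod_lebesgue:
  shows "cmod \<in> measurable (lebesgue_on (ball 0 1)) lebesgue"
    and "distr (lebesgue_on (ball 0 1)) lebesgue cmod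
      = density lebesgue (\<lambda>r. ennreal (2 * pi * r) * indicator {0..<1} r)"
proof -
  show m: "cmod \<in> measurable (lebesgue_on (ball 0 1)) lebesgue"
    using vimage_cmod_lebesgue(1)
    by (auto simp: measurable_def space_restrict_space sets_restrict_space_iff)
  show "distr (lebesgue_on (ball 0 1)) lebesgue cmod
      = density lebesgue (\<lambda>r. ennreal (2 * pi * r) * indicator {0..<1} r)"
  proof (rule measure_eqI)
    fix A assume "A \<in> sets (distr (lebesgue_on (ball 0 1)) lebesgue cmod)"
    then have A: "A \<in> sets lebesgue" by simp
    have "(\<lambda>r. ennreal (2 * pi * r) * indicator {0..<1} r) \<in> borel_measurable lebesgue"
      by (intro measurable_completion) measurable
    with A show "emeasure (distr (lebesgue_on (ball 0 1)) lebesgue cmod) A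
        = emeasure (density lebesgue (\<lambda>r. ennreal (2 * pi * r) * indicator {0..<1} r)) A"
      using vimage_cmod_lebesgue[OF A] m
      by (simp add: emeasure_distr emeasure_density emeasure_restrict_space space_restrict_space)
  qed simp
qed

text \<open>Weights are unconstrained outside [0,1), hence measurability is asked only of the
  profile cut off there.\<close>

lemma measurable_cmod_disc_area:
  assumes "(\<lambda>r. g r * indicator {0..<1} r :: 'a :: {second_countable_topology, real_normed_algebra_1}) \<in> borel_measurable lebesgue"
  shows "(\<lambda>z. g (cmod z)) \<in> borel_measurable disc_area"
proof -
  have "(\<lambda>z. g (cmod z) * indicator {0..<1} (cmod z)) \<in> borel_measurable (lebesgue_on (ball 0 1))"
    using measurable_compose[OF distr_cmod_lebesgue(1) assms] .
  then have "(\<lambda>z. g (cmod z)) \<in> borel_measurable (lebesgue_on (ball 0 1))"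
    by (rule measurable_cong[THEN iffD1, rotated]) (auto simp: space_restrict_space)
  then show ?thesis by (simp cong: measurable_cong_sets add: sets_disc_area)
qed

lemma nn_integral_radial_disc_area:
  fixes g :: "real \<Rightarrow> real"
  assumes g: "(\<lambda>r. g r * indicator {0..<1} r) \<in> borel_measurable lebesgue"
  shows "(\<integral>\<^sup>+z. ennreal (g (cmod z)) \<partial>disc_area) = (\<integral>\<^sup>+r\<in>{0..<1}. ennreal (2 * r * g r) \<partial>lebesgue)"
proof -
  define h where "h = (\<lambda>r. ennreal (g r * indicator {0..<1} r))"
  have h: "h \<in> borel_measurable lebesgue" unfolding h_def using g by measurable
  have w: "(\<lambda>r. ennreal (2 * pi * r) * indicator {0..<1} r) \<in> borel_measurable lebesgue"
    by (intro measurable_completion) measurable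
  have "(\<integral>\<^sup>+z. ennreal (g (cmod z)) \<partial>disc_area)
      = ennreal (1 / pi) * (\<integral>\<^sup>+z. ennreal (g (cmod z)) \<partial>lebesgue_on (ball 0 1))"
    using measurable_cmod_disc_area[OF g]
    by (intro nn_integral_disc_area measurable_compose[OF _ measurable_ennreal])
  also have "(\<integral>\<^sup>+z. ennreal (g (cmod z)) \<partial>lebesgue_on (ball 0 1)) = (\<integral>\<^sup>+z. h (cmod z) \<partial>lebesgue_on (ball 0 1))"
    by (rule nn_integral_cong) (auto simp: h_def space_restrict_space)
  also have "\<dots> = (\<integral>\<^sup>+r. h r \<partial>distr (lebesgue_on (ball 0 1)) lebesgue cmod)"
    using h distr_cmod_lebesgue(1) by (subst nn_integral_distr) auto
  also have "\<dots> = (\<integral>\<^sup>+r. ennreal (2 * pi * r) * indicator {0..<1} r * h r \<partial>lebesgue)"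
    unfolding distr_cmod_lebesgue(2) using h w by (subst nn_integral_density) auto
  also have "ennreal (1 / pi) * \<dots> = (\<integral>\<^sup>+r. ennreal (1 / pi) * (ennreal (2 * pi * r) * indicator {0..<1} r * h r) \<partial>lebesgue)"
    using h w by (subst nn_integral_cmult) auto
  also have "\<dots> = (\<integral>\<^sup>+r\<in>{0..<1}. ennreal (2 * r * g r) \<partial>lebesgue)"
  proof (rule nn_integral_cong)
    fix r :: real
    show "ennreal (1 / pi) * (ennreal (2 * pi * r) * indicator {0..<1} r * h r)
        = ennreal (2 * r * g r) * indicator {0..<1} r"
    proof (cases "r \<in> {0..<1}")
      case True
      then have "ennreal (1 / pi) * (ennreal (2 * pi * r) * ennreal (g r)) = ennreal (1 / pi * (2 * pi * r) * g r)"
        using ennreal_mult'[of "2 * pi * r" "g r"] ennreal_mult'[of "1 / pi" "2 * pi * r * g r"]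
        by (simp add: mult.assoc)
      with True show ?thesis by (simp add: h_def)
    qed simp
  qed
  finally show ?thesis .
qed

text \<open>Rotation invariance of \<open>lborel\<close> is lifted to the completion through
  preimages of null sets, then restricted to the disc, which rotations preserve. The exception at -1
  is inherited from the factorization into shears; orthogonality below uses rotations by at most a
  right angle.\<close>

lemma distr_rotate_disc_area:
  assumes c: "cmod c = 1" "c \<noteq> -1"
  shows "(\<lambda>z. c * z) \<in> measurable disc_area disc_area"
    and "distr disc_area disc_area (\<lambda>z. c * z) = disc_area"
proof -
  have c0: "c \<noteq> 0" using c by auto
  have borel: "emeasure lborel ((\<lambda>z. c * z) -` S) = emeasure lborel S" and
    bm: "(\<lambda>z. c * z) -` S \<in> sets borel" if S: "S \<in> sets borel" for S
  proof -
    show m: "(\<lambda>z. c * z) -` S \<in> sets borel"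
      using measurable_sets[of "\<lambda>z. c * z" borel borel S] S by simp
    have "emeasure lborel ((\<lambda>z. c * z) -` S) = (\<integral>\<^sup>+z. indicator ((\<lambda>z. c * z) -` S) z \<partial>lborel)"
      using m by (intro nn_integral_indicator[symmetric]) simp
    also have "\<dots> = (\<integral>\<^sup>+z. indicator S (c * z) \<partial>lborel)"
      by (auto intro!: nn_integral_cong split: split_indicator)
    also have "\<dots> = (\<integral>\<^sup>+z. indicator S z \<partial>lborel)"
      using S c by (intro nn_integral_lborel_rotate) auto
    finally show "emeasure lborel ((\<lambda>z. c * z) -` S) = emeasure lborel S" using S by simp
  qed
  have leb: "(\<lambda>z. c * z) -` A \<in> sets lebesgue \<and> emeasure lebesgue ((\<lambda>z. c * z) -` A) = emeasure lebesgue A"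
    if A: "A \<in> sets lebesgue" for A
  proof -
    obtain S N N' where A: "A = S \<union> N" and N: "N \<subseteq> N'" "N' \<in> null_sets lborel" and S: "S \<in> sets lborel"
      using A by (rule sets_completionE)
    have null: "(\<lambda>z. c * z) -` N' \<in> null_sets lborel"
      using borel[of N'] bm[of N'] N by (auto simp: null_sets_def)
    have n1: "(\<lambda>z. c * z) -` N \<in> null_sets lebesgue"
      using null N null_sets_completion_iff2[of "(\<lambda>z. c * z) -` N" lborel] by blast
    have n2: "N \<in> null_sets lebesgue"
      using N null_sets_completion_iff2 by blast
    have s: "(\<lambda>z. c * z) -` S \<in> sets lebesgue" using bm[of S] S by auto
    have "emeasure lebesgue ((\<lambda>z. c * z) -` A) = emeasure lebesgue ((\<lambda>z. c * z) -` S)"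
      unfolding A vimage_Un using s n1 by (intro emeasure_Un_null_set) auto
    also have "\<dots> = emeasure lborel S" using borel[of S] bm[of S] S by simp
    also have "\<dots> = emeasure lebesgue A"
      unfolding A using S n2 by (subst emeasure_Un_null_set) auto
    finally show ?thesis unfolding A vimage_Un using s n1 by (auto intro: sets.Un)
  qed
  have ball: "(\<lambda>z. c * z) -` A \<inter> ball 0 1 = (\<lambda>z. c * z) -` (A \<inter> ball 0 1)" for A
    using c by (auto simp: norm_mult)
  have iff: "A \<in> sets disc_area \<longleftrightarrow> A \<subseteq> ball 0 1 \<and> A \<in> sets lebesgue" for A
    by (simp add: sets_disc_area sets_restrict_space_iff conj_commute)
  have em: "emeasure disc_area A = ennreal (1 / pi) * emeasure lebesgue A" if "A \<in> sets disc_area" for A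
    using that iff[of A] by (simp add: disc_area_def emeasure_restrict_space)
  have pre: "(\<lambda>z. c * z) -` A \<inter> space disc_area \<in> sets disc_area" if "A \<in> sets disc_area" for A
    using that iff[of A] leb[of A] unfolding iff by (simp add: ball inf.absorb1) (auto simp: norm_mult c)
  show m: "(\<lambda>z. c * z) \<in> measurable disc_area disc_area"
    using pre by (auto simp: measurable_def norm_mult c)
  show "distr disc_area disc_area (\<lambda>z. c * z) = disc_area"
  proof (rule measure_eqI)
    fix A assume "A \<in> sets (distr disc_area disc_area (\<lambda>z. c * z))"
    then have A: "A \<in> sets disc_area" by simp
    with iff[of A] have "A \<subseteq> ball 0 1" "A \<in> sets lebesgue" by auto
    with A m pre[OF A] show "emeasure (distr disc_area disc_area (\<lambda>z. c * z)) A = emeasure disc_area A"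
      using leb[of A] by (simp add: emeasure_distr em ball inf.absorb1)
  qed simp
qed

subsection \<open>Tails and moments of radial weights\<close>

lemma radial_weight_nonneg: "radial_weight \<eta> \<Longrightarrow> 0 \<le> r \<Longrightarrow> r < 1 \<Longrightarrow> 0 \<le> \<eta> r"
  and radial_weight_tail_pos: "radial_weight \<eta> \<Longrightarrow> 0 \<le> r \<Longrightarrow> r < 1 \<Longrightarrow> 0 < tail \<eta> r"
  by (auto simp: radial_weight_def)

lemma radial_weight_measurable:
  "radial_weight \<eta> \<Longrightarrow> (\<lambda>r. \<eta> r * indicator {0..<1} r) \<in> borel_measurable lebesgue"
  using borel_measurable_integrable[of lebesgue "\<lambda>r. indicator {0..<1} r *\<^sub>R \<eta> r"]
  by (simp add: radial_weight_def set_integrable_def mult.commute)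

lemma ennreal_tail:
  assumes \<eta>: "radial_weight \<eta>" and r: "0 \<le> r"
  shows "ennreal (tail \<eta> r) = (\<integral>\<^sup>+s\<in>{r..<1}. ennreal (\<eta> s) \<partial>lebesgue)"
proof -
  have "set_integrable lebesgue {r..<1} \<eta>"
    by (rule set_integrable_subset[where A = "{0..<1}"]) (use \<eta> r in \<open>auto simp: radial_weight_def\<close>)
  moreover have "0 \<le> indicator {r..<1} s *\<^sub>R \<eta> s" for s
    using r radial_weight_nonneg[OF \<eta>, of s] by (auto split: split_indicator)
  ultimately have "(\<integral>\<^sup>+s. ennreal (indicator {r..<1} s *\<^sub>R \<eta> s) \<partial>lebesgue) = ennreal (tail \<eta> r)"
    unfolding tail_def set_lebesgue_integral_def set_integrable_def by (intro nn_integral_eq_integral) auto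
  moreover have "(\<integral>\<^sup>+s. ennreal (indicator {r..<1} s *\<^sub>R \<eta> s) \<partial>lebesgue) = (\<integral>\<^sup>+s\<in>{r..<1}. ennreal (\<eta> s) \<partial>lebesgue)"
    by (intro nn_integral_cong) (auto split: split_indicator)
  ultimately show ?thesis by simp
qed

lemma tail_nonneg:
  assumes "radial_weight \<eta>" "0 \<le> r"
  shows "0 \<le> tail \<eta> r"
  using assms radial_weight_tail_pos[of \<eta> r] by (cases "r < 1") (auto simp: tail_def set_lebesgue_integral_def)

lemma tail_antimono:
  assumes "radial_weight \<eta>" "0 \<le> r" "r \<le> s"
  shows "tail \<eta> s \<le> tail \<eta> r"
proof -
  have "ennreal (tail \<eta> s) \<le> ennreal (tail \<eta> r)"
    using assms by (auto simp: ennreal_tail intro!: nn_integral_mono split: split_indicator)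
  then show ?thesis
    using assms tail_nonneg by simp
qed

lemma tail_measurable:
  assumes "radial_weight \<eta>"
  shows "(\<lambda>r. tail \<eta> r * indicator {0..<1} r) \<in> borel_measurable borel"
proof -
  have "mono_on {0..<1} (\<lambda>r. - tail \<eta> r)"
    using tail_antimono[OF assms] by (auto simp: mono_on_def)
  then have "(\<lambda>r. - tail \<eta> r) \<in> borel_measurable (restrict_space borel {0..<1})"
    by (intro borel_measurable_mono_on_fnc) auto
  from borel_measurable_uminus[OF this] have "tail \<eta> \<in> borel_measurable (restrict_space borel {0..<1})"
    by simp
  then show ?thesis
    by (simp add: borel_measurable_restrict_space_iff mult.commute)
qed

lemma measurable_radial_indicator:
  fixes g :: "real \<Rightarrow> real"
  assumes g: "(\<lambda>r. g r * indicator {0..<1} r) \<in> borel_measurable lebesgue"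
    and A: "A \<in> sets lebesgue" "A \<subseteq> {0..<1}"
  shows "(\<lambda>r. ennreal (g r) * indicator A r) \<in> borel_measurable lebesgue"
proof -
  have "(\<lambda>r. ennreal (g r * indicator {0..<1} r) * indicator A r) \<in> borel_measurable lebesgue"
    by (intro borel_measurable_times_ennreal borel_measurable_indicator A
        measurable_compose[OF g measurable_ennreal])
  also have "(\<lambda>r. ennreal (g r * indicator {0..<1} r) * indicator A r) = (\<lambda>r. ennreal (g r) * indicator A r)"
  proof
    fix r
    show "ennreal (g r * indicator {0..<1} r) * indicator A r = ennreal (g r) * indicator A r"
      using A(2) by (cases "r \<in> A") auto
  qed
  finally show ?thesis .
qed

lemma measurable_radial_power:
  fixes g :: "real \<Rightarrow> real"
  assumes g: "(\<lambda>r. g r * indicator {0..<1} r) \<in> borel_measurable lebesgue"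
  shows "(\<lambda>r. (g r * r ^ n) * indicator {0..<1} r) \<in> borel_measurable lebesgue"
proof -
  have "(\<lambda>r::real. r ^ n) \<in> borel_measurable lebesgue" by (rule measurable_completion) measurable
  from borel_measurable_times[OF g this] show ?thesis by (simp add: mult_ac)
qed

lemma measurable_radial_powr:
  fixes g :: "real \<Rightarrow> real"
  assumes g: "(\<lambda>r. g r * indicator {0..<1} r) \<in> borel_measurable lebesgue"
  shows "(\<lambda>r. ennreal (r powr x * g r) * indicator {0..<1} r) \<in> borel_measurable lebesgue"
proof -
  have "(\<lambda>r::real. r powr x) \<in> borel_measurable lborel" by measurable
  then have "(\<lambda>r::real. r powr x) \<in> borel_measurable lebesgue" by (rule measurable_completion)
  from measurable_compose[OF borel_measurable_times[OF this g] measurable_ennreal]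
  show ?thesis by (rule measurable_cong[THEN iffD1, rotated]) (auto split: split_indicator)
qed

section \<open>Growth of the tail of a doubling weight\<close>

lemma doubling_weight_radial: "doubling_weight \<eta> \<Longrightarrow> radial_weight \<eta>"
  by (simp add: doubling_weight_def)

lemma doubling_weight_global:
  assumes "doubling_weight \<eta>"
  shows "\<exists>C\<ge>1. \<forall>r\<in>{0..<1}. tail \<eta> r \<le> C * tail \<eta> ((1 + r) / 2)"
proof -
  have \<eta>: "radial_weight \<eta>" using assms by (rule doubling_weight_radial)
  obtain C b where C: "C > 0" and b: "b < 1" and le: "\<And>r. b < r \<Longrightarrow> r < 1 \<Longrightarrow> tail \<eta> r \<le> C * tail \<eta> ((1 + r) / 2)"
    using assms unfolding doubling_weight_def eventually_at_left[OF zero_less_one] by blast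
  define r0 where "r0 = max b 0"
  \<comment> \<open>Away from 1 no doubling is given: for \<open>r \<le> r0\<close> the quotient of
    tails is bounded by the largest possible numerator over the smallest possible
    denominator.\<close>
  define K where "K = tail \<eta> 0 / tail \<eta> ((1 + r0) / 2)"
  have pos: "0 < tail \<eta> ((1 + r0) / 2)" "0 < tail \<eta> 0"
    using b by (auto simp: r0_def intro!: radial_weight_tail_pos[OF \<eta>])
  show ?thesis
  proof (intro exI conjI ballI)
    show "1 \<le> max 1 (max C K)" by simp
    fix r :: real assume r: "r \<in> {0..<1}"
    have p: "0 \<le> tail \<eta> ((1 + r) / 2)" using r by (intro tail_nonneg[OF \<eta>]) auto
    show "tail \<eta> r \<le> max 1 (max C K) * tail \<eta> ((1 + r) / 2)"
    proof (cases "b < r")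
      case True
      then have "tail \<eta> r \<le> C * tail \<eta> ((1 + r) / 2)" using r le by auto
      also have "\<dots> \<le> max 1 (max C K) * tail \<eta> ((1 + r) / 2)" using p by (intro mult_right_mono) auto
      finally show ?thesis .
    next
      case False
      have "tail \<eta> r \<le> tail \<eta> 0" using r by (intro tail_antimono[OF \<eta>]) auto
      also have "\<dots> = K * tail \<eta> ((1 + r0) / 2)" using pos by (simp add: K_def)
      also have "\<dots> \<le> K * tail \<eta> ((1 + r) / 2)"
        using False r pos by (intro mult_left_mono tail_antimono[OF \<eta>]) (auto simp: r0_def K_def)
      also have "\<dots> \<le> max 1 (max C K) * tail \<eta> ((1 + r) / 2)" using p by (intro mult_right_mono) auto
      finally show ?thesis .
    qed
  qed
qed

lemma power_two_between:
  fixes q :: real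
  assumes "1 \<le> q"
  shows "\<exists>j::nat. q \<le> 2 ^ j \<and> 2 ^ j \<le> 2 * q"
proof -
  have ex: "\<exists>j::nat. q \<le> 2 ^ j"
    using real_arch_pow[of 2 q] by (auto intro: less_imp_le)
  define j where "j = (LEAST j. q \<le> 2 ^ j)"
  have j: "q \<le> 2 ^ j" unfolding j_def using ex by (rule LeastI_ex)
  have "2 ^ j \<le> 2 * q"
  proof (cases j)
    case 0 with assms show ?thesis by simp
  next
    case (Suc i)
    then have "\<not> q \<le> 2 ^ i" using not_less_Least[of i "\<lambda>j. q \<le> 2 ^ j"] by (simp add: j_def)
    with Suc show ?thesis by simp
  qed
  with j show ?thesis by blast
qed

text \<open>The distance to 1 is halved j times, with \<open>2 ^ j\<close> the first power of two
  above \<open>(1 - r) / (1 - s)\<close>. Writing \<open>C \<le> 2 ^ m\<close> turns the accumulated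
  constant \<open>C ^ j\<close> into the m-th power of that quotient; the factor 2 is the rounding
  of j. Doubling is mostly used in this polynomial form.\<close>

lemma doubling_weight_growth:
  assumes "doubling_weight \<eta>"
  shows "\<exists>m::nat. \<forall>r s. 0 \<le> r \<longrightarrow> r \<le> s \<longrightarrow> s < 1 \<longrightarrow> tail \<eta> r \<le> (2 * (1 - r) / (1 - s)) ^ m * tail \<eta> s"
proof -
  have \<eta>: "radial_weight \<eta>" using assms by (rule doubling_weight_radial)
  obtain C where C: "C \<ge> 1" and le: "\<And>r. r \<in> {0..<1} \<Longrightarrow> tail \<eta> r \<le> C * tail \<eta> ((1 + r) / 2)"
    using doubling_weight_global[OF assms] by blast
  obtain m where m: "C \<le> 2 ^ m" using real_arch_pow[of 2 C] by (auto intro: less_imp_le)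
  have iter: "tail \<eta> r \<le> C ^ j * tail \<eta> (1 - (1 - r) / 2 ^ j)" if r: "r \<in> {0..<1}" for r j
  proof (induction j)
    case (Suc j)
    have "(1 - r) * 1 \<le> 1 * 2 ^ j" using r by (intro mult_mono) auto
    then have "(1 - r) / 2 ^ j \<le> 1" "0 < (1 - r) / 2 ^ j"
      using r by (auto simp: divide_simps)
    then have mem: "1 - (1 - r) / 2 ^ j \<in> {0..<1}" using r by auto
    have "tail \<eta> r \<le> C ^ j * (C * tail \<eta> ((1 + (1 - (1 - r) / 2 ^ j)) / 2))"
      using Suc.IH le[OF mem] C by (meson mult_left_mono order_trans zero_le_power zero_le_one)
    also have "(1 + (1 - (1 - r) / 2 ^ j)) / 2 = 1 - (1 - r) / 2 ^ Suc j" by (simp add: field_simps)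
    finally show ?case by (simp add: mult.assoc mult.left_commute)
  qed auto
  show ?thesis
  proof (intro exI allI impI)
    fix r s :: real assume rs: "0 \<le> r" "r \<le> s" "s < 1"
    define q where "q = (1 - r) / (1 - s)"
    have q: "1 \<le> q" using rs by (simp add: q_def)
    obtain j where j: "q \<le> 2 ^ j" "2 ^ j \<le> 2 * q" using power_two_between[OF q] by blast
    have "(1 - r) / 2 ^ j \<le> 1 - s"
      using j(1) rs unfolding q_def by (simp add: field_simps)
    moreover have "0 \<le> tail \<eta> s" using rs by (intro tail_nonneg[OF \<eta>]) auto
    ultimately have "tail \<eta> (1 - (1 - r) / 2 ^ j) \<le> tail \<eta> s"
      using rs by (intro tail_antimono[OF \<eta>]) auto
    then have "tail \<eta> r \<le> C ^ j * tail \<eta> s"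
      using iter[of r j] rs C by (meson atLeastLessThan_iff le_less_trans mult_left_mono order_trans zero_le_one zero_le_power)
    also have "C ^ j \<le> (2 ^ m) ^ j" using C m by (intro power_mono) auto
    also have "(2 ^ m) ^ j = ((2::real) ^ j) ^ m" by (simp add: mult.commute flip: power_mult)
    also have "\<dots> \<le> (2 * q) ^ m" using j(2) by (intro power_mono) auto
    finally show "tail \<eta> r \<le> (2 * (1 - r) / (1 - s)) ^ m * tail \<eta> s"
      using \<open>0 \<le> tail \<eta> s\<close> by (simp add: q_def mult_right_mono)
  qed
qed

section \<open>Moments compared with tails\<close>

lemma moment_le_tail:
  assumes \<eta>: "radial_weight \<eta>" and x: "0 \<le> x"
  shows "moment \<eta> x \<le> ennreal (tail \<eta> 0)"
  unfolding moment_def ennreal_tail[OF \<eta> order_refl]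
proof (intro nn_integral_mono)
  fix r :: real
  show "ennreal (r powr x * \<eta> r) * indicator {0..<1} r \<le> ennreal (\<eta> r) * indicator {0..<1} r"
    using x powr_mono2[of x r 1] radial_weight_nonneg[OF \<eta>, of r]
    by (auto intro!: ennreal_leI mult_left_le_one_le split: split_indicator)
qed

text \<open>On \<open>[x / (x + 1), 1)\<close> the power \<open>r powr x\<close> is at least 1/e,
  because \<open>(1 + 1 / x) powr x \<le> exp 1\<close>. The statement is for extended integrals of
  a general g, since it is applied to \<open>\<omega> / tail \<nu>\<close> before that quotient is
  known to be integrable.\<close>

lemma moment_ge:
  assumes g: "(\<lambda>r. g r * indicator {0..<1} r) \<in> borel_measurable lebesgue"
    and nonneg: "\<And>r. 0 \<le> r \<Longrightarrow> r < 1 \<Longrightarrow> 0 \<le> g r" and x: "0 \<le> x"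
  shows "(\<integral>\<^sup>+s\<in>{x / (x + 1)..<1}. ennreal (g s) \<partial>lebesgue) \<le> ennreal (exp 1) * moment g x"
proof -
  note m = measurable_radial_powr[OF g, of x]
  have "(\<integral>\<^sup>+s\<in>{x / (x + 1)..<1}. ennreal (g s) \<partial>lebesgue)
    \<le> (\<integral>\<^sup>+r. ennreal (exp 1) * (ennreal (r powr x * g r) * indicator {0..<1} r) \<partial>lebesgue)"
  proof (rule nn_integral_mono_AE)
    have "AE r in lebesgue. r \<noteq> (0::real)" by (intro AE_completion AE_lborel_singleton)
    then show "AE r in lebesgue. ennreal (g r) * indicator {x / (x + 1)..<1} r
        \<le> ennreal (exp 1) * (ennreal (r powr x * g r) * indicator {0..<1} r)"
    proof eventually_elim
      case (elim r)
      show ?case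
      proof (cases "r \<in> {x / (x + 1)..<1}")
        case True
        then have r: "r < 1" "x / (x + 1) \<le> r" by auto
        moreover have "0 \<le> x / (x + 1)" using x by simp
        ultimately have r0: "0 < r" using elim by linarith
        note r = r r0
        have "x * ln (1 / r) \<le> 1"
        proof (cases "x = 0")
          case False
          then have x': "0 < x" using x by simp
          have "1 / r \<le> 1 + 1 / x" using r x' by (simp add: field_simps)
          then have "ln (1 / r) \<le> ln (1 + 1 / x)" using r x' by (subst ln_le_cancel_iff) (auto simp: add_pos_pos)
          also have "\<dots> \<le> 1 / x" using x' by (intro ln_add_one_self_le_self) auto
          finally show ?thesis using x' by (simp add: field_simps)
        qed simp
        then have "1 \<le> exp 1 * r powr x"
          using r by (simp add: powr_def ln_div flip: exp_add)
        then have "1 * g r \<le> (exp 1 * r powr x) * g r"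
          using nonneg[of r] r by (intro mult_right_mono) auto
        then have "ennreal (g r) \<le> ennreal (exp 1 * (r powr x * g r))"
          by (intro ennreal_leI) (simp add: mult.assoc)
        with r True show ?thesis by (simp add: ennreal_mult')
      qed simp
    qed
  qed
  also have "\<dots> = ennreal (exp 1) * moment g x"
    unfolding moment_def using m by (rule nn_integral_cmult)
  finally show ?thesis .
qed

lemma power_le_fact_exp:
  fixes y :: real
  assumes "0 \<le> y"
  shows "y ^ n \<le> fact n * exp y"
proof -
  have "y ^ n /\<^sub>R fact n \<le> exp y"
    using sum_le_suminf[OF summable_exp_generic[of y], of "{n}"] assms
    by (simp add: exp_def)
  then show ?thesis by (simp add: field_simps)
qed

text \<open>From \<open>ln s \<le> s - 1\<close> the power is at most of order
  \<open>exp (- k)\<close>, where k counts the distance of s from 1 in units of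
  \<open>1 / (x + 1)\<close>. Exponential decay is then traded for polynomial decay of any
  prescribed degree M, which is what the growth of tails can be balanced against.\<close>

lemma powr_le_layer:
  fixes s x :: real
  assumes s: "0 \<le> s" "s < 1" and x: "0 \<le> x" and k: "k = nat \<lfloor>(1 - s) * (x + 1)\<rfloor>"
  shows "s powr x \<le> exp 2 * fact M / real (Suc k) ^ M"
proof (cases "s = 0")
  case False
  define y where "y = (1 - s) * (x + 1)"
  have y: "0 \<le> y" using s x by (simp add: y_def)
  have ky: "real k \<le> y" using y unfolding k y_def[symmetric] by simp
  have "x * ln s \<le> x * (s - 1)" using False s x by (intro mult_left_mono ln_le_minus_one) auto
  also have "\<dots> \<le> 1 - y" using s by (simp add: y_def algebra_simps)
  also have "\<dots> \<le> 2 - real (Suc k)" using ky by simp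
  finally have "s powr x \<le> exp (2 - real (Suc k))" using False s by (simp add: powr_def)
  also have "\<dots> = exp 2 / exp (real (Suc k))" by (rule exp_diff)
  also have "\<dots> \<le> exp 2 / (real (Suc k) ^ M / fact M)"
    using power_le_fact_exp[of "real (Suc k)" M] by (intro divide_left_mono) (auto simp: field_simps)
  finally show ?thesis by (simp add: field_simps)
qed simp

text \<open>The power \<open>s powr x\<close> is dominated layer by layer on the sets \<open>1 - s \<le> (k + 1) / (x + 1)\<close>,
  and the polynomial growth of the tail is absorbed by the weights of the layers.\<close>
lemma moment_le_tail_doubling:
  assumes "doubling_weight \<eta>"
  shows "\<exists>C>0. \<forall>x\<ge>0. moment \<eta> x \<le> ennreal (C * tail \<eta> (x / (x + 1)))"
proof -
  have \<eta>: "radial_weight \<eta>" using assms by (rule doubling_weight_radial)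
  obtain m where m: "\<And>r s. 0 \<le> r \<Longrightarrow> r \<le> s \<Longrightarrow> s < 1 \<Longrightarrow> tail \<eta> r \<le> (2 * (1 - r) / (1 - s)) ^ m * tail \<eta> s"
    using doubling_weight_growth[OF assms] by blast
  \<comment> \<open>Of the exponent m + 2, m cancels the growth
    \<open>(2 * real (Suc k)) ^ m\<close> of the tail on layer k, and 2 is left to make the series
    over the layers converge.\<close>
  define c where "c = (\<lambda>k. exp 2 * fact (m + 2) / real (Suc k) ^ (m + 2))"
  have c0: "0 < c k" for k by (simp add: c_def)
  define d where "d = (\<lambda>k. 2 ^ m * (exp 2 * fact (m + 2)) * (1 / real (Suc k) ^ 2))"
  have sd: "summable d"
    unfolding d_def using inverse_power_summable[of 2, where 'a = real]
    by (intro summable_mult) (subst summable_Suc_iff, simp add: inverse_eq_divide)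
  have d0: "0 < d k" for k by (simp add: d_def)
  show ?thesis
  proof (intro exI conjI allI impI)
    show "0 < suminf d" using sd d0 by (intro suminf_pos) auto
    fix x :: real assume x: "0 \<le> x"
    define R where "R = (\<lambda>k::nat. max 0 (1 - real (Suc k) / (x + 1)))"
    have mI: "(\<lambda>r. ennreal (\<eta> r) * indicator {R k..<1} r) \<in> borel_measurable lebesgue" for k
      by (rule measurable_radial_indicator[OF radial_weight_measurable[OF \<eta>]]) (auto simp: R_def)
    have "moment \<eta> x \<le> (\<integral>\<^sup>+r. (\<Sum>k. ennreal (c k) * (ennreal (\<eta> r) * indicator {R k..<1} r)) \<partial>lebesgue)"
      unfolding moment_def
    proof (rule nn_integral_mono)
      fix r :: real
      show "ennreal (r powr x * \<eta> r) * indicator {0..<1} r \<le> (\<Sum>k. ennreal (c k) * (ennreal (\<eta> r) * indicator {R k..<1} r))"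
      proof (cases "r \<in> {0..<1}")
        case True
        define k where "k = nat \<lfloor>(1 - r) * (x + 1)\<rfloor>"
        have "(1 - r) * (x + 1) \<le> real (Suc k)" using True x unfolding k_def by linarith
        then have "1 - r \<le> real (Suc k) / (x + 1)" using x by (simp add: field_simps)
        then have R: "r \<in> {R k..<1}" using True by (auto simp: R_def)
        have "r powr x * \<eta> r \<le> c k * \<eta> r"
          using powr_le_layer[of r x k "m + 2"] True x radial_weight_nonneg[OF \<eta>, of r]
          unfolding c_def k_def by (intro mult_right_mono) auto
        then have "ennreal (r powr x * \<eta> r) * indicator {0..<1} r \<le> ennreal (c k) * (ennreal (\<eta> r) * indicator {R k..<1} r)"
          using True R c0[of k] by (simp add: ennreal_mult'[symmetric] ennreal_leI less_imp_le)
        also have "\<dots> \<le> (\<Sum>k. ennreal (c k) * (ennreal (\<eta> r) * indicator {R k..<1} r))"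
          using sum_le_suminf[of "\<lambda>k. ennreal (c k) * (ennreal (\<eta> r) * indicator {R k..<1} r)" "{k}"] by simp
        finally show ?thesis .
      qed simp
    qed
    also have "\<dots> = (\<Sum>k. ennreal (c k) * ennreal (tail \<eta> (R k)))"
      using mI by (subst nn_integral_suminf)
        (auto simp: nn_integral_cmult ennreal_tail[OF \<eta>] R_def)
    also have "\<dots> \<le> (\<Sum>k. ennreal (d k * tail \<eta> (x / (x + 1))))"
    proof (intro suminf_le)
      fix k :: nat
      have "R k \<le> x / (x + 1)" using x by (auto simp: R_def field_simps)
      moreover have "0 \<le> R k" by (simp add: R_def)
      moreover have "x / (x + 1) < 1" using x by simp
      ultimately have "tail \<eta> (R k) \<le> (2 * (1 - R k) / (1 - x / (x + 1))) ^ m * tail \<eta> (x / (x + 1))"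
        by (intro m)
      also have "\<dots> \<le> (2 * real (Suc k)) ^ m * tail \<eta> (x / (x + 1))"
      proof (intro mult_right_mono power_mono)
        have e: "1 - x / (x + 1) = 1 / (x + 1)" using x by (simp add: field_simps)
        have "1 - R k \<le> real (Suc k) / (x + 1)" by (simp add: R_def)
        then show "2 * (1 - R k) / (1 - x / (x + 1)) \<le> 2 * real (Suc k)"
          unfolding e using x by (simp add: field_simps)
        have "R k \<le> 1" using x by (simp add: R_def)
        then show "0 \<le> 2 * (1 - R k) / (1 - x / (x + 1))" unfolding e using x by simp
      qed (use x tail_nonneg[OF \<eta>, of "x / (x+1)"] in auto)
      finally have "c k * tail \<eta> (R k) \<le> c k * ((2 * real (Suc k)) ^ m * tail \<eta> (x / (x + 1)))"
        using c0[of k] by (intro mult_left_mono) auto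
      also have "c k * ((2 * real (Suc k)) ^ m * tail \<eta> (x / (x + 1))) = (c k * (2 * real (Suc k)) ^ m) * tail \<eta> (x / (x + 1))"
        by simp
      also have "c k * (2 * real (Suc k)) ^ m = d k"
        unfolding c_def d_def power_mult_distrib power_add by (simp add: divide_simps del: of_nat_Suc)
      finally show "ennreal (c k) * ennreal (tail \<eta> (R k)) \<le> ennreal (d k * tail \<eta> (x / (x + 1)))"
        using c0[of k] by (simp add: ennreal_mult'[symmetric] ennreal_leI less_imp_le)
    qed auto
    also have "\<dots> = ennreal (suminf d * tail \<eta> (x / (x + 1)))"
    proof -
      have t: "0 \<le> tail \<eta> (x / (x + 1))" using x by (intro tail_nonneg[OF \<eta>]) auto
      show ?thesis
        using t d0 sd by (subst suminf_ennreal2) (auto simp: less_imp_le suminf_mult2 intro!: summable_mult2)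
    qed
    finally show "moment \<eta> x \<le> ennreal (suminf d * tail \<eta> (x / (x + 1)))" .
  qed
qed

definition rmoment :: "(real \<Rightarrow> real) \<Rightarrow> real \<Rightarrow> real"
  where "rmoment \<eta> x = enn2real (moment \<eta> x)"

lemma ennreal_rmoment:
  assumes "radial_weight \<eta>" "0 \<le> x"
  shows "ennreal (rmoment \<eta> x) = moment \<eta> x"
  using moment_le_tail[OF assms] unfolding rmoment_def
  by (intro ennreal_enn2real) (auto simp: le_less_trans)

lemma rmoment_ge:
  assumes \<eta>: "radial_weight \<eta>" and x: "0 \<le> x"
  shows "tail \<eta> (x / (x + 1)) \<le> exp 1 * rmoment \<eta> x"
proof -
  have "ennreal (tail \<eta> (x / (x + 1))) \<le> ennreal (exp 1) * moment \<eta> x"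
    unfolding ennreal_tail[OF \<eta> divide_nonneg_nonneg[OF x add_nonneg_nonneg[OF x zero_le_one]]]
    by (intro moment_ge radial_weight_measurable[OF \<eta>] radial_weight_nonneg[OF \<eta>] x)
  also have "\<dots> = ennreal (exp 1 * rmoment \<eta> x)"
    by (simp add: ennreal_mult' ennreal_rmoment[OF \<eta> x])
  finally show ?thesis
    by (subst (asm) ennreal_le_iff) (auto simp: rmoment_def)
qed

lemma rmoment_pos:
  assumes \<eta>: "radial_weight \<eta>" and x: "0 \<le> x"
  shows "0 < rmoment \<eta> x"
proof -
  have "0 < tail \<eta> (x / (x + 1))" using x by (intro radial_weight_tail_pos[OF \<eta>]) auto
  also have "\<dots> \<le> exp 1 * rmoment \<eta> x" by (rule rmoment_ge[OF \<eta> x])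
  finally show ?thesis by (simp add: zero_less_mult_iff)
qed

lemma rmoment_le_tail_doubling:
  assumes "doubling_weight \<eta>"
  shows "\<exists>C>0. \<forall>x\<ge>0. rmoment \<eta> x \<le> C * tail \<eta> (x / (x + 1))"
proof -
  note \<eta> = doubling_weight_radial[OF assms]
  obtain C where C: "C > 0" "\<And>x. 0 \<le> x \<Longrightarrow> moment \<eta> x \<le> ennreal (C * tail \<eta> (x / (x + 1)))"
    using moment_le_tail_doubling[OF assms] by blast
  have "rmoment \<eta> x \<le> C * tail \<eta> (x / (x + 1))" if x: "0 \<le> x" for x
  proof -
    have "0 \<le> tail \<eta> (x / (x + 1))" using x by (intro tail_nonneg[OF \<eta>]) auto
    with C(1) C(2)[OF x] show ?thesis by (simp add: ennreal_rmoment[OF \<eta> x, symmetric])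
  qed
  with C(1) show ?thesis by blast
qed

text \<open>The growth lemma lets the order of the moment rise by a bounded factor. The value 8
  covers every pair of orders compared below: 2x with x, 2i + 3 with \<open>i div 2\<close> (ratio
  of shifted orders at most 6), and 2i + 7 with i + 2.\<close>

lemma tail_le_rmoment_doubling:
  assumes "doubling_weight \<eta>"
  shows "\<exists>C>0. \<forall>x y. 0 \<le> x \<longrightarrow> x \<le> y \<longrightarrow> y + 1 \<le> 8 * (x + 1) \<longrightarrow> tail \<eta> (x / (x + 1)) \<le> C * rmoment \<eta> y"
proof -
  note \<eta> = doubling_weight_radial[OF assms]
  obtain m where m: "\<And>r s. 0 \<le> r \<Longrightarrow> r \<le> s \<Longrightarrow> s < 1 \<Longrightarrow> tail \<eta> r \<le> (2 * (1 - r) / (1 - s)) ^ m * tail \<eta> s"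
    using doubling_weight_growth[OF assms] by blast
  show ?thesis
  proof (intro exI conjI allI impI)
    show "0 < 16 ^ m * exp (1::real)" by simp
    fix x y :: real assume xy: "0 \<le> x" "x \<le> y" "y + 1 \<le> 8 * (x + 1)"
    have e: "1 - z / (z + 1) = 1 / (z + 1)" if "0 \<le> z" for z :: real
      using that by (simp add: field_simps)
    have "x / (x + 1) \<le> y / (y + 1)" using xy by (simp add: field_simps)
    then have "tail \<eta> (x / (x + 1)) \<le> (2 * (1 - x / (x + 1)) / (1 - y / (y + 1))) ^ m * tail \<eta> (y / (y + 1))"
      using xy by (intro m) auto
    also have "2 * (1 - x / (x + 1)) / (1 - y / (y + 1)) = 2 * ((y + 1) / (x + 1))"
      using xy by (simp add: e)
    also have "(2 * ((y + 1) / (x + 1))) ^ m \<le> 16 ^ m"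
      using xy by (intro power_mono) (auto simp: divide_simps)
    also have "16 ^ m * tail \<eta> (y / (y + 1)) \<le> 16 ^ m * (exp 1 * rmoment \<eta> y)"
      using xy by (intro mult_left_mono rmoment_ge[OF \<eta>]) auto
    finally show "tail \<eta> (x / (x + 1)) \<le> 16 ^ m * exp 1 * rmoment \<eta> y"
      using xy tail_nonneg[OF \<eta>, of "y / (y + 1)"] by (simp add: mult_right_mono mult.assoc)
  qed
qed

section \<open>The quotient of a weight by the tail of another one\<close>

lemma quotient_measurable:
  assumes \<omega>: "radial_weight \<omega>" and \<nu>: "radial_weight \<nu>"
  shows "(\<lambda>r. \<omega> r / tail \<nu> r * indicator {0..<1} r) \<in> borel_measurable lebesgue"
proof -
  have "(\<lambda>r. tail \<nu> r * indicator {0..<1} r) \<in> borel_measurable lebesgue"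
    by (rule measurable_completion) (simp add: tail_measurable[OF \<nu>])
  then have "(\<lambda>r. (\<omega> r * indicator {0..<1} r) / (tail \<nu> r * indicator {0..<1} r)) \<in> borel_measurable lebesgue"
    by (intro borel_measurable_divide radial_weight_measurable[OF \<omega>])
  also have "(\<lambda>r. (\<omega> r * indicator {0..<1} r) / (tail \<nu> r * indicator {0..<1} r)) = (\<lambda>r. \<omega> r / tail \<nu> r * indicator {0..<1} r)"
    by (auto split: split_indicator)
  finally show ?thesis .
qed

lemma quotient_nonneg:
  assumes "radial_weight \<omega>" "radial_weight \<nu>" "0 \<le> r" "r < 1"
  shows "0 \<le> \<omega> r / tail \<nu> r"
  using assms radial_weight_nonneg[of \<omega> r] tail_nonneg[of \<nu> r] by simp

text \<open>The factor \<open>1 / tail \<nu>\<close> increases, so it can be pulled out of the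
  integral at its left end. This is the half of the comparison between \<open>tail \<sigma>\<close>
  and \<open>tail \<omega> / tail \<nu>\<close> that does not come from condition (iii).\<close>

lemma tail_quotient_ge:
  assumes \<omega>: "radial_weight \<omega>" and \<nu>: "radial_weight \<nu>" and r: "0 \<le> r" "r < 1"
  shows "ennreal (tail \<omega> r / tail \<nu> r) \<le> (\<integral>\<^sup>+s\<in>{r..<1}. ennreal (\<omega> s / tail \<nu> s) \<partial>lebesgue)"
proof -
  have "ennreal (1 / tail \<nu> r) * (ennreal (\<omega> s) * indicator {r..<1} s) \<le> ennreal (\<omega> s / tail \<nu> s) * indicator {r..<1} s" for s
  proof (cases "s \<in> {r..<1}")
    case True
    have "\<omega> s / tail \<nu> r \<le> \<omega> s / tail \<nu> s"
      using True r radial_weight_tail_pos[OF \<nu>, of s] radial_weight_tail_pos[OF \<nu>, of r]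
      by (intro divide_left_mono tail_antimono[OF \<nu>] radial_weight_nonneg[OF \<omega>]) auto
    then show ?thesis
      using True tail_nonneg[OF \<nu> r(1)] by (simp add: ennreal_mult'[symmetric] ennreal_leI)
  qed simp
  note le = this
  have "ennreal (tail \<omega> r / tail \<nu> r) = ennreal (1 / tail \<nu> r) * ennreal (tail \<omega> r)"
    using tail_nonneg[OF \<nu> r(1)] by (simp add: ennreal_mult'[symmetric])
  also have "\<dots> = (\<integral>\<^sup>+s. ennreal (1 / tail \<nu> r) * (ennreal (\<omega> s) * indicator {r..<1} s) \<partial>lebesgue)"
    unfolding ennreal_tail[OF \<omega> r(1)] using r
    by (intro nn_integral_cmult[symmetric] measurable_radial_indicator[OF radial_weight_measurable[OF \<omega>]]) auto
  also have "\<dots> \<le> (\<integral>\<^sup>+s\<in>{r..<1}. ennreal (\<omega> s / tail \<nu> s) \<partial>lebesgue)"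
    using le by (intro nn_integral_mono) auto
  finally show ?thesis .
qed

abbreviation tail_condition :: "(real \<Rightarrow> real) \<Rightarrow> (real \<Rightarrow> real) \<Rightarrow> real \<Rightarrow> bool"
  where "tail_condition \<nu> \<omega> K \<equiv> \<forall>r\<in>{0..<1}. ennreal (tail \<nu> r / tail \<omega> r) *
    (\<integral>\<^sup>+s\<in>{r..<1}. ennreal (\<omega> s / tail \<nu> s) \<partial>lebesgue) \<le> ennreal K"

text \<open>For \<open>\<sigma> = \<omega> / tail \<nu>\<close> the product \<open>tail \<sigma> * tail \<nu>\<close> is comparable with \<open>tail \<omega>\<close>, hence doubling; since
  both factors decrease, each of them is doubling.\<close>
lemma doubling_weight_quotient:
  fixes K :: real
  assumes \<nu>: "radial_weight \<nu>" and \<omega>d: "doubling_weight \<omega>" and K: "0 \<le> K"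
    and bound: "tail_condition \<nu> \<omega> K"
  shows "doubling_weight \<nu>" and "doubling_weight (\<lambda>r. \<omega> r / tail \<nu> r)"
    and "\<And>r. 0 \<le> r \<Longrightarrow> r < 1 \<Longrightarrow> tail (\<lambda>r. \<omega> r / tail \<nu> r) r \<le> K * (tail \<omega> r / tail \<nu> r)"
proof -
  define \<sigma> where "\<sigma> = (\<lambda>r. \<omega> r / tail \<nu> r)"
  note \<omega> = doubling_weight_radial[OF \<omega>d]
  \<comment> \<open>Dividing out the quotient of tails inside the extended reals; at r = 0 this
    already makes \<open>\<sigma>\<close> integrable.\<close>
  have le: "(\<integral>\<^sup>+s\<in>{r..<1}. ennreal (\<sigma> s) \<partial>lebesgue) \<le> ennreal (K * (tail \<omega> r / tail \<nu> r))"
    if r: "0 \<le> r" "r < 1" for r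
  proof -
    have p: "0 < tail \<nu> r" "0 < tail \<omega> r" using r \<nu> \<omega> by (auto intro: radial_weight_tail_pos)
    have "(\<integral>\<^sup>+s\<in>{r..<1}. ennreal (\<sigma> s) \<partial>lebesgue)
        = ennreal (tail \<omega> r / tail \<nu> r) * (ennreal (tail \<nu> r / tail \<omega> r) * (\<integral>\<^sup>+s\<in>{r..<1}. ennreal (\<sigma> s) \<partial>lebesgue))"
      using p by (simp add: ennreal_mult'[symmetric] mult.assoc[symmetric])
    also have "\<dots> \<le> ennreal (tail \<omega> r / tail \<nu> r) * ennreal K"
      using bound r by (intro mult_left_mono) (auto simp: \<sigma>_def)
    finally show ?thesis using p K by (simp add: ennreal_mult'[symmetric] mult.commute)
  qed
  have \<sigma>: "radial_weight \<sigma>"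
  proof -
    have int: "set_integrable lebesgue {0..<1} \<sigma>"
      unfolding set_integrable_def
    proof (rule integrableI_nonneg)
      show "(\<lambda>r. indicator {0..<1} r *\<^sub>R \<sigma> r) \<in> borel_measurable lebesgue"
        using quotient_measurable[OF \<omega> \<nu>] by (simp add: \<sigma>_def mult.commute)
      show "AE r in lebesgue. 0 \<le> indicator {0..<1} r *\<^sub>R \<sigma> r"
        using quotient_nonneg[OF \<omega> \<nu>] by (intro AE_I2) (auto simp: \<sigma>_def split: split_indicator)
      have "(\<integral>\<^sup>+r. ennreal (indicator {0..<1} r *\<^sub>R \<sigma> r) \<partial>lebesgue) = (\<integral>\<^sup>+s\<in>{0..<1}. ennreal (\<sigma> s) \<partial>lebesgue)"
        by (intro nn_integral_cong) (auto split: split_indicator)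
      also have "\<dots> < \<infinity>" using le[of 0] by (simp add: le_less_trans)
      finally show "(\<integral>\<^sup>+r. ennreal (indicator {0..<1} r *\<^sub>R \<sigma> r) \<partial>lebesgue) < \<infinity>" .
    qed
    have "0 < tail \<sigma> r" if r: "0 \<le> r" "r < 1" for r
    proof -
      have p: "0 < tail \<nu> r" "0 < tail \<omega> r" using r \<nu> \<omega> by (auto intro: radial_weight_tail_pos)
      have "set_integrable lebesgue {r..<1} \<sigma>"
        by (rule set_integrable_subset[OF int]) (use r in auto)
      moreover have "0 \<le> indicator {r..<1} s *\<^sub>R \<sigma> s" for s
        using quotient_nonneg[OF \<omega> \<nu>, of s] r by (auto simp: \<sigma>_def split: split_indicator)
      ultimately have "ennreal (tail \<sigma> r) = (\<integral>\<^sup>+s. ennreal (indicator {r..<1} s *\<^sub>R \<sigma> s) \<partial>lebesgue)"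
        unfolding tail_def set_lebesgue_integral_def set_integrable_def
        by (intro nn_integral_eq_integral[symmetric]) auto
      also have "\<dots> = (\<integral>\<^sup>+s\<in>{r..<1}. ennreal (\<sigma> s) \<partial>lebesgue)"
        by (intro nn_integral_cong) (auto split: split_indicator)
      also have "\<dots> \<ge> ennreal (tail \<omega> r / tail \<nu> r)"
        unfolding \<sigma>_def by (rule tail_quotient_ge[OF \<omega> \<nu> r])
      finally have "ennreal (tail \<omega> r / tail \<nu> r) \<le> ennreal (tail \<sigma> r)" .
      moreover have "0 < tail \<omega> r / tail \<nu> r" using p by simp
      ultimately show ?thesis by (metis ennreal_le_iff2 less_le_trans not_less)
    qed
    with int quotient_nonneg[OF \<omega> \<nu>] show ?thesis
      by (auto simp: radial_weight_def \<sigma>_def)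
  qed
  have upper: "tail \<sigma> r \<le> K * (tail \<omega> r / tail \<nu> r)" if r: "0 \<le> r" "r < 1" for r
    using le[OF r] r K tail_nonneg[OF \<nu> r(1)] tail_nonneg[OF \<omega> r(1)]
    by (simp add: ennreal_tail[OF \<sigma> r(1), symmetric])
  have lower: "tail \<omega> r / tail \<nu> r \<le> tail \<sigma> r" if r: "0 \<le> r" "r < 1" for r
  proof -
    have "ennreal (tail \<omega> r / tail \<nu> r) \<le> ennreal (tail \<sigma> r)"
      unfolding ennreal_tail[OF \<sigma> r(1)] unfolding \<sigma>_def by (rule tail_quotient_ge[OF \<omega> \<nu> r])
    with tail_nonneg[OF \<sigma> r(1)] show ?thesis by simp
  qed
  obtain C where C: "C \<ge> 1" "\<And>r. r \<in> {0..<1} \<Longrightarrow> tail \<omega> r \<le> C * tail \<omega> ((1 + r) / 2)"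
    using doubling_weight_global[OF \<omega>d] by blast
  have main: "tail \<sigma> r * tail \<nu> r \<le> K * C * (tail \<sigma> ((1 + r) / 2) * tail \<nu> ((1 + r) / 2))"
    if r: "0 \<le> r" "r < 1" for r
  proof -
    have "tail \<sigma> r * tail \<nu> r \<le> K * tail \<omega> r"
      using upper[OF r] radial_weight_tail_pos[OF \<nu> r] by (simp add: field_simps)
    also have "\<dots> \<le> K * (C * tail \<omega> ((1 + r) / 2))"
      using C(2)[of r] r K by (intro mult_left_mono) auto
    also have "\<dots> \<le> K * (C * (tail \<sigma> ((1 + r) / 2) * tail \<nu> ((1 + r) / 2)))"
      using lower[of "(1 + r) / 2"] r K C(1) radial_weight_tail_pos[OF \<nu>, of "(1 + r) / 2"]
      by (intro mult_left_mono) (auto simp: field_simps)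
    finally show ?thesis by (simp add: mult.assoc)
  qed
  have KC: "K * C + 1 > 0" using K C(1) by (simp add: add_nonneg_pos)
  have doublingI: "doubling_weight \<eta>" if \<eta>: "radial_weight \<eta>"
    and *: "\<And>r. 0 \<le> r \<Longrightarrow> r < 1 \<Longrightarrow> tail \<eta> r \<le> K * C * tail \<eta> ((1 + r) / 2)" for \<eta>
    unfolding doubling_weight_def
  proof (intro conjI exI[of _ "K * C + 1"] \<eta> KC)
    have "\<forall>\<^sub>F r in at_left 1. r \<in> {0<..<1::real}"
      by (intro eventually_at_leftI[of 0]) auto
    then show "\<forall>\<^sub>F r in at_left 1. tail \<eta> r \<le> (K * C + 1) * tail \<eta> ((1 + r) / 2)"
    proof eventually_elim
      case (elim r)
      then show ?case using *[of r] tail_nonneg[OF \<eta>, of "(1 + r) / 2"] by (simp add: algebra_simps)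
    qed
  qed
  show "doubling_weight \<nu>"
  proof (rule doublingI[OF \<nu>])
    fix r :: real assume r: "0 \<le> r" "r < 1"
    have p: "0 < tail \<sigma> ((1 + r) / 2)" "0 < tail \<nu> r"
      using r by (auto intro!: radial_weight_tail_pos \<sigma> \<nu>)
    \<comment> \<open>Replacing \<open>tail \<sigma> r\<close> by its smaller value at the midpoint
      makes that factor common to both sides of \<open>main\<close>, so it cancels and leaves
      doubling of \<open>\<nu>\<close>. The roles are exchanged for \<open>\<sigma>\<close>
      below.\<close>
    have "tail \<sigma> ((1 + r) / 2) * tail \<nu> r \<le> tail \<sigma> r * tail \<nu> r"
      using r p by (intro mult_right_mono tail_antimono[OF \<sigma>]) auto
    also note main[OF r]
    finally have "tail \<sigma> ((1 + r) / 2) * tail \<nu> r \<le> tail \<sigma> ((1 + r) / 2) * (K * C * tail \<nu> ((1 + r) / 2))"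
      by (simp add: mult_ac)
    with p show "tail \<nu> r \<le> K * C * tail \<nu> ((1 + r) / 2)" by simp
  qed
  have "doubling_weight \<sigma>"
  proof (rule doublingI[OF \<sigma>])
    fix r :: real assume r: "0 \<le> r" "r < 1"
    have p: "0 < tail \<nu> ((1 + r) / 2)" "0 < tail \<sigma> r"
      using r by (auto intro!: radial_weight_tail_pos \<sigma> \<nu>)
    have "tail \<nu> ((1 + r) / 2) * tail \<sigma> r \<le> tail \<nu> r * tail \<sigma> r"
      using r p by (intro mult_right_mono tail_antimono[OF \<nu>]) auto
    also have "\<dots> = tail \<sigma> r * tail \<nu> r" by simp
    also note main[OF r]
    finally have "tail \<nu> ((1 + r) / 2) * tail \<sigma> r \<le> tail \<nu> ((1 + r) / 2) * (K * C * tail \<sigma> ((1 + r) / 2))"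
      by (simp add: mult_ac)
    with p show "tail \<sigma> r \<le> K * C * tail \<sigma> ((1 + r) / 2)" by simp
  qed
  then show "doubling_weight (\<lambda>r. \<omega> r / tail \<nu> r)" by (simp add: \<sigma>_def)
  show "tail (\<lambda>r. \<omega> r / tail \<nu> r) r \<le> K * (tail \<omega> r / tail \<nu> r)" if "0 \<le> r" "r < 1" for r
    using upper[OF that] by (simp add: \<sigma>_def)
qed

section \<open>Equivalence of the moment condition and the tail condition\<close>

lemma SUP_ennreal_less_top_iff:
  fixes f :: "'a \<Rightarrow> ennreal"
  shows "(SUP x\<in>A. f x) < \<infinity> \<longleftrightarrow> (\<exists>K\<ge>0. \<forall>x\<in>A. f x \<le> ennreal K)"
proof
  assume "(SUP x\<in>A. f x) < \<infinity>"
  then have "(SUP x\<in>A. f x) = ennreal (enn2real (SUP x\<in>A. f x))" by simp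
  then show "\<exists>K\<ge>0. \<forall>x\<in>A. f x \<le> ennreal K"
    by (metis SUP_upper enn2real_nonneg)
next
  assume "\<exists>K\<ge>0. \<forall>x\<in>A. f x \<le> ennreal K"
  then obtain K where "\<forall>x\<in>A. f x \<le> ennreal K" by blast
  then have "(SUP x\<in>A. f x) \<le> ennreal K" by (intro SUP_least) auto
  then show "(SUP x\<in>A. f x) < \<infinity>" by (simp add: le_less_trans)
qed

lemma moment_divide:
  assumes "radial_weight \<nu>" "radial_weight \<omega>" "0 \<le> x" "0 \<le> y"
  shows "moment \<nu> x / moment \<omega> y = ennreal (rmoment \<nu> x / rmoment \<omega> y)"
  using assms by (simp add: ennreal_rmoment[symmetric] divide_ennreal rmoment_pos less_imp_le)

text \<open>The moments of \<open>\<nu>\<close> and of the quotient stand in the numerator and are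
  bounded below by tails for any weight. Only the moment of \<open>\<omega>\<close> must be bounded
  above by a tail, which is where doubling of \<open>\<omega>\<close> enters.\<close>

lemma moment_condition_imp_tail_condition:
  assumes \<nu>: "radial_weight \<nu>" and \<omega>d: "doubling_weight \<omega>" and K: "0 \<le> K"
    and bound: "\<forall>x\<in>{0..}.
      moment \<nu> x / moment \<omega> (2 * x) * moment (\<lambda>r. \<omega> r / tail \<nu> r) x \<le> ennreal K"
  shows "\<exists>K'\<ge>0. tail_condition \<nu> \<omega> K'"
proof -
  note \<omega> = doubling_weight_radial[OF \<omega>d]
  obtain C where C: "C > 0" "\<And>x. 0 \<le> x \<Longrightarrow> rmoment \<omega> x \<le> C * tail \<omega> (x / (x + 1))"
    using rmoment_le_tail_doubling[OF \<omega>d] by blast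
  show ?thesis
  proof (intro exI conjI ballI)
    show "0 \<le> exp 1 * C * exp 1 * K" using C K by simp
    fix r :: real assume r: "r \<in> {0..<1}"
    \<comment> \<open>The order whose comparison point \<open>x / (x + 1)\<close> is exactly
      r.\<close>
    define x where "x = r / (1 - r)"
    have x: "0 \<le> x" using r by (simp add: x_def)
    have rx: "x / (x + 1) = r" using r by (simp add: x_def field_simps)
    have "rmoment \<omega> (2 * x) \<le> C * tail \<omega> (2 * x / (2 * x + 1))" using C(2)[of "2 * x"] x by simp
    also have "\<dots> \<le> C * tail \<omega> (x / (x + 1))"
      using x C(1) by (intro mult_left_mono tail_antimono[OF \<omega>]) (auto simp: field_simps)
    finally have w: "rmoment \<omega> (2 * x) \<le> C * tail \<omega> r" by (simp add: rx)
    have v: "tail \<nu> r \<le> exp 1 * rmoment \<nu> x" using rmoment_ge[OF \<nu> x] by (simp add: rx)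
    have p: "0 < rmoment \<omega> (2 * x)" "0 < tail \<omega> r" "0 < rmoment \<nu> x"
      using x r by (auto intro!: rmoment_pos[OF \<omega>] rmoment_pos[OF \<nu>] radial_weight_tail_pos[OF \<omega>])
    have "tail \<nu> r / tail \<omega> r \<le> exp 1 * rmoment \<nu> x / (rmoment \<omega> (2 * x) / C)"
      using v w p C(1) by (intro frac_le) (auto simp: field_simps)
    then have q: "tail \<nu> r / tail \<omega> r \<le> exp 1 * C * (rmoment \<nu> x / rmoment \<omega> (2 * x))"
      by (simp add: field_simps)
    have s: "(\<integral>\<^sup>+s\<in>{r..<1}. ennreal (\<omega> s / tail \<nu> s) \<partial>lebesgue) \<le> ennreal (exp 1) * moment (\<lambda>r. \<omega> r / tail \<nu> r) x"
      using moment_ge[OF quotient_measurable[OF \<omega> \<nu>] quotient_nonneg[OF \<omega> \<nu>] x] by (simp add: rx)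
    have "ennreal (tail \<nu> r / tail \<omega> r) * (\<integral>\<^sup>+s\<in>{r..<1}. ennreal (\<omega> s / tail \<nu> s) \<partial>lebesgue)
      \<le> ennreal (exp 1 * C * (rmoment \<nu> x / rmoment \<omega> (2 * x))) * (ennreal (exp 1) * moment (\<lambda>r. \<omega> r / tail \<nu> r) x)"
      by (intro mult_mono s ennreal_leI q) auto
    also have "\<dots> = ennreal (exp 1 * C * exp 1) * (moment \<nu> x / moment \<omega> (2 * x) * moment (\<lambda>r. \<omega> r / tail \<nu> r) x)"
      using C(1) x ennreal_mult'[of "exp 1 * C" "rmoment \<nu> x / rmoment \<omega> (2 * x)"] ennreal_mult'[of "exp 1 * C" "exp 1"]
      by (simp add: moment_divide[OF \<nu> \<omega>] mult_ac)
    also have "\<dots> \<le> ennreal (exp 1 * C * exp 1) * ennreal K"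
      using bound x by (intro mult_left_mono) auto
    finally show "ennreal (tail \<nu> r / tail \<omega> r) * (\<integral>\<^sup>+s\<in>{r..<1}. ennreal (\<omega> s / tail \<nu> s) \<partial>lebesgue)
        \<le> ennreal (exp 1 * C * exp 1 * K)"
      using C(1) by (simp add: ennreal_mult')
  qed
qed

text \<open>Upper bounds for the moments of \<open>\<nu>\<close> and \<open>\<sigma>\<close> by
  tails are available because both weights inherit doubling. The order y is left free rather than
  fixed to 2x: the kernel estimate needs a moment of \<open>\<omega>\<close> of order 2i + 3 against
  moments of order \<open>i div 2\<close>.\<close>

lemma tail_condition_imp_rmoment_condition:
  assumes \<nu>: "radial_weight \<nu>" and \<omega>d: "doubling_weight \<omega>" and K: "0 \<le> K"
    and bound: "tail_condition \<nu> \<omega> K"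
  shows "\<exists>K'\<ge>0. \<forall>x y. 0 \<le> x \<longrightarrow> x \<le> y \<longrightarrow> y + 1 \<le> 8 * (x + 1) \<longrightarrow>
    rmoment \<nu> x / rmoment \<omega> y * rmoment (\<lambda>r. \<omega> r / tail \<nu> r) x \<le> K'"
proof -
  define \<sigma> where "\<sigma> = (\<lambda>r. \<omega> r / tail \<nu> r)"
  note \<omega> = doubling_weight_radial[OF \<omega>d]
  note q = doubling_weight_quotient[OF \<nu> \<omega>d K bound, folded \<sigma>_def]
  note \<sigma> = doubling_weight_radial[OF q(2)]
  obtain A where A: "A > 0" "\<And>x. 0 \<le> x \<Longrightarrow> rmoment \<nu> x \<le> A * tail \<nu> (x / (x + 1))"
    using rmoment_le_tail_doubling[OF q(1)] by blast
  obtain B where B: "B > 0" "\<And>x. 0 \<le> x \<Longrightarrow> rmoment \<sigma> x \<le> B * tail \<sigma> (x / (x + 1))"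
    using rmoment_le_tail_doubling[OF q(2)] by blast
  obtain C where C: "C > 0" "\<And>x y. 0 \<le> x \<Longrightarrow> x \<le> y \<Longrightarrow> y + 1 \<le> 8 * (x + 1) \<Longrightarrow> tail \<omega> (x / (x + 1)) \<le> C * rmoment \<omega> y"
    using tail_le_rmoment_doubling[OF \<omega>d] by blast
  have "rmoment \<nu> x / rmoment \<omega> y * rmoment \<sigma> x \<le> A * B * K * C"
    if xy: "0 \<le> x" "x \<le> y" "y + 1 \<le> 8 * (x + 1)" for x y
  proof -
    define r where "r = x / (x + 1)"
    have r: "0 \<le> r" "r < 1" using xy by (auto simp: r_def)
    have p: "0 < rmoment \<omega> y" "0 < rmoment \<nu> x" "0 < rmoment \<sigma> x" "0 < tail \<nu> r"
      using xy r by (auto intro!: rmoment_pos \<omega> \<nu> \<sigma> radial_weight_tail_pos)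
    have "rmoment \<nu> x * rmoment \<sigma> x \<le> (A * tail \<nu> r) * (B * tail \<sigma> r)"
      using A B xy p by (intro mult_mono) (auto simp: r_def)
    also have "\<dots> \<le> (A * tail \<nu> r) * (B * (K * (tail \<omega> r / tail \<nu> r)))"
      using q(3)[OF r] A B p by (intro mult_left_mono) auto
    also have "\<dots> = A * B * K * tail \<omega> r" using p by simp
    also have "\<dots> \<le> A * B * K * (C * rmoment \<omega> y)"
      using C(2)[OF xy] A B K by (intro mult_left_mono) (auto simp: r_def)
    finally show ?thesis using p by (simp add: field_simps)
  qed
  moreover have "0 \<le> A * B * K * C" using A B C K by simp
  ultimately show ?thesis unfolding \<sigma>_def by blast
qed

lemma tail_condition_imp_moment_condition:
  assumes \<nu>: "radial_weight \<nu>" and \<omega>d: "doubling_weight \<omega>" and K: "0 \<le> K"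
    and bound: "tail_condition \<nu> \<omega> K"
  shows "\<exists>K'\<ge>0. \<forall>x\<in>{0..}. moment \<nu> x / moment \<omega> (2 * x) * moment (\<lambda>r. \<omega> r / tail \<nu> r) x \<le> ennreal K'"
proof -
  note \<omega> = doubling_weight_radial[OF \<omega>d]
  note \<sigma> = doubling_weight_radial[OF doubling_weight_quotient(2)[OF \<nu> \<omega>d K bound]]
  obtain K' where K': "0 \<le> K'" "\<And>x y. 0 \<le> x \<Longrightarrow> x \<le> y \<Longrightarrow> y + 1 \<le> 8 * (x + 1) \<Longrightarrow>
    rmoment \<nu> x / rmoment \<omega> y * rmoment (\<lambda>r. \<omega> r / tail \<nu> r) x \<le> K'"
    using tail_condition_imp_rmoment_condition[OF \<nu> \<omega>d K bound] by blast
  have "moment \<nu> x / moment \<omega> (2 * x) * moment (\<lambda>r. \<omega> r / tail \<nu> r) x \<le> ennreal K'" if x: "0 \<le> x" for x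
  proof -
    have "0 \<le> rmoment \<nu> x / rmoment \<omega> (2 * x)" by (simp add: rmoment_def)
    then have "moment \<nu> x / moment \<omega> (2 * x) * moment (\<lambda>r. \<omega> r / tail \<nu> r) x
        = ennreal (rmoment \<nu> x / rmoment \<omega> (2 * x) * rmoment (\<lambda>r. \<omega> r / tail \<nu> r) x)"
      using x by (subst ennreal_mult') (simp_all add: moment_divide[OF \<nu> \<omega>] ennreal_rmoment[OF \<sigma>])
    also have "\<dots> \<le> ennreal K'" using x by (intro ennreal_leI K') auto
    finally show ?thesis .
  qed
  with K'(1) show ?thesis by auto
qed

text \<open>Test functions yield information only at integers n, with three slightly different
  radii: n/(n+1) for \<open>\<nu>\<close>, (n+1)/(n+2) for the quotient, (2n+1)/(2n+2) for
  \<open>\<omega>\<close>. Each r near 1 is placed so that monotonicity of all three tails points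
  the right way; the remaining compact range is handled by crude bounds.\<close>

lemma sequence_condition_imp_tail_condition:
  assumes \<nu>: "radial_weight \<nu>" and \<omega>d: "doubling_weight \<omega>" and K: "0 \<le> K"
    and bound: "\<And>n::nat. 1 \<le> n \<Longrightarrow> ennreal (tail \<nu> (real n / (real n + 1)) / rmoment \<omega> (2 * real n + 1)) *
      moment (\<lambda>r. \<omega> r / tail \<nu> r) (real n + 1) \<le> ennreal K"
  shows "\<exists>K'\<ge>0. tail_condition \<nu> \<omega> K'"
proof -
  note \<omega> = doubling_weight_radial[OF \<omega>d]
  define h where "h = (\<lambda>r. \<integral>\<^sup>+s\<in>{r..<1}. ennreal (\<omega> s / tail \<nu> s) \<partial>lebesgue)"
  have h_mono: "h s \<le> h r" if "r \<le> s" for r s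
    unfolding h_def using that by (intro nn_integral_mono) (auto split: split_indicator)
  obtain C where C: "C > 0" "\<And>x. 0 \<le> x \<Longrightarrow> rmoment \<omega> x \<le> C * tail \<omega> (x / (x + 1))"
    using rmoment_le_tail_doubling[OF \<omega>d] by blast
  have large: "ennreal (tail \<nu> r / tail \<omega> r) * h r \<le> ennreal (C * exp 1 * K)" if r: "2 / 3 \<le> r" "r < 1" for r
  proof -
    \<comment> \<open>With n one less than the integer part of \<open>r / (1 - r)\<close>, r lies
      between (n+1)/(n+2) and (n+2)/(n+3), and the latter is at most (2n+1)/(2n+2) as soon as n is
      at least 1. The threshold 2/3 makes \<open>r / (1 - r)\<close> at least 2, which ensures
      this.\<close>
    define k where "k = nat \<lfloor>r / (1 - r)\<rfloor>"
    define n where "n = k - 1"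
    have q: "2 \<le> r / (1 - r)" using r by (simp add: field_simps)
    then have "2 \<le> k" unfolding k_def by linarith
    then have k: "k = n + 1" and n: "1 \<le> n" by (auto simp: n_def)
    have kr: "real k \<le> r / (1 - r)" "r / (1 - r) \<le> real k + 1" using q unfolding k_def by linarith+
    have r1: "real (n + 1) / (real (n + 1) + 1) \<le> r"
    proof -
      have "real k * (1 - r) \<le> r" using kr(1) r by (simp add: field_simps)
      then show ?thesis by (simp add: k field_simps)
    qed
    have r2: "r \<le> (2 * n + 1) / (2 * n + 1 + 1)"
    proof -
      have "r \<le> (real k + 1) * (1 - r)" using kr(2) r by (simp add: field_simps)
      then have "r * (n + 3) \<le> n + 2" by (simp add: k algebra_simps)
      then have "r \<le> (real n + 2) / (real n + 3)" by (simp add: field_simps)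
      also have "\<dots> \<le> (2 * n + 1) / (2 * n + 1 + 1)" using n by (simp add: field_simps)
      finally show ?thesis .
    qed
    have p: "0 < rmoment \<omega> (2 * n + 1)" "0 < tail \<omega> r" "0 < tail \<nu> (n / (n + 1))"
      using r by (auto intro!: rmoment_pos[OF \<omega>] radial_weight_tail_pos \<omega> \<nu>)
    have "rmoment \<omega> (2 * n + 1) \<le> C * tail \<omega> ((2 * n + 1) / (2 * n + 1 + 1))" using C(2)[of "2 * n + 1"] by simp
    also have "\<dots> \<le> C * tail \<omega> r" using r2 r C(1) by (intro mult_left_mono tail_antimono[OF \<omega>]) auto
    finally have w: "rmoment \<omega> (2 * n + 1) / C \<le> tail \<omega> r" using C(1) by (simp add: field_simps)
    have "real n / (n + 1) \<le> r"
      using r1 by (rule order_trans[rotated]) (simp add: field_simps)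
    then have v: "tail \<nu> r \<le> tail \<nu> (n / (n + 1))" by (intro tail_antimono[OF \<nu>]) auto
    have "tail \<nu> r / tail \<omega> r \<le> tail \<nu> (n / (n + 1)) / (rmoment \<omega> (2 * n + 1) / C)"
      using v w p C(1) by (intro frac_le) auto
    then have q: "tail \<nu> r / tail \<omega> r \<le> C * (tail \<nu> (n / (n + 1)) / rmoment \<omega> (2 * n + 1))"
      by (simp add: field_simps)
    have "h r \<le> h (real (n + 1) / (real (n + 1) + 1))" by (rule h_mono[OF r1])
    also have "\<dots> \<le> ennreal (exp 1) * moment (\<lambda>r. \<omega> r / tail \<nu> r) (n + 1)"
      unfolding h_def by (intro moment_ge[OF quotient_measurable[OF \<omega> \<nu>] quotient_nonneg[OF \<omega> \<nu>]]) auto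
    finally have s: "h r \<le> ennreal (exp 1) * moment (\<lambda>r. \<omega> r / tail \<nu> r) (n + 1)" .
    have "ennreal (tail \<nu> r / tail \<omega> r) * h r \<le>
        ennreal (C * (tail \<nu> (n / (n + 1)) / rmoment \<omega> (2 * n + 1))) * (ennreal (exp 1) * moment (\<lambda>r. \<omega> r / tail \<nu> r) (n + 1))"
      by (intro mult_mono s ennreal_leI q) auto
    also have "\<dots> = ennreal (C * exp 1) * (ennreal (tail \<nu> (n / (n + 1)) / rmoment \<omega> (2 * n + 1)) * moment (\<lambda>r. \<omega> r / tail \<nu> r) (n + 1))"
      using C(1) ennreal_mult'[of C "tail \<nu> (n / (n + 1)) / rmoment \<omega> (2 * n + 1)"] ennreal_mult'[of C "exp 1"]
      by (simp add: mult_ac)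
    also have "\<dots> \<le> ennreal (C * exp 1) * ennreal K"
      using bound[OF n] by (intro mult_left_mono) (simp_all add: algebra_simps)
    finally show ?thesis using C(1) by (simp add: ennreal_mult')
  qed
  \<comment> \<open>Finiteness near 1 is read off the bound at r = 2/3, whose factor is positive; on
    \<open>[0, 2/3)\<close> the denominator \<open>tail \<nu>\<close> stays above its value at
    2/3.\<close>
  have h0: "h 0 < \<infinity>"
  proof -
    have "0 < tail \<nu> (2/3) / tail \<omega> (2/3)" using \<nu> \<omega> by (auto intro!: divide_pos_pos radial_weight_tail_pos)
    moreover have "ennreal (tail \<nu> (2/3) / tail \<omega> (2/3)) * h (2/3) < \<infinity>"
      using large[of "2/3"] by (simp add: le_less_trans)
    ultimately have h1: "h (2/3) < \<infinity>" by (auto simp: ennreal_mult_less_top)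
    have m: "(\<lambda>s. ennreal (\<omega> s) * indicator {0..<1} s) \<in> borel_measurable lebesgue"
      "(\<lambda>s. ennreal (\<omega> s / tail \<nu> s) * indicator {2/3..<1} s) \<in> borel_measurable lebesgue"
      by (intro measurable_radial_indicator radial_weight_measurable[OF \<omega>] quotient_measurable[OF \<omega> \<nu>]; auto)+
    have "h 0 \<le> (\<integral>\<^sup>+s. ennreal (1 / tail \<nu> (2/3)) * (ennreal (\<omega> s) * indicator {0..<1} s)
        + ennreal (\<omega> s / tail \<nu> s) * indicator {2/3..<1} s \<partial>lebesgue)"
      unfolding h_def
    proof (rule nn_integral_mono)
      fix s :: real
      show "ennreal (\<omega> s / tail \<nu> s) * indicator {0..<1} s \<le> ennreal (1 / tail \<nu> (2/3)) * (ennreal (\<omega> s) * indicator {0..<1} s)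
        + ennreal (\<omega> s / tail \<nu> s) * indicator {2/3..<1} s"
      proof (cases "s \<in> {0..<2/3}")
        case True
        have "\<omega> s / tail \<nu> s \<le> \<omega> s / tail \<nu> (2/3)"
          using True radial_weight_tail_pos[OF \<nu>, of s] radial_weight_tail_pos[OF \<nu>, of "2/3"] radial_weight_nonneg[OF \<omega>, of s]
          by (intro divide_left_mono tail_antimono[OF \<nu>]) auto
        with True show ?thesis
          using tail_nonneg[OF \<nu>, of "2/3"] by (simp add: ennreal_mult'[symmetric] ennreal_leI)
      qed (auto split: split_indicator)
    qed
    also have "\<dots> = ennreal (1 / tail \<nu> (2/3)) * ennreal (tail \<omega> 0) + h (2/3)"
      using m by (simp add: nn_integral_add nn_integral_cmult ennreal_tail[OF \<omega>] h_def)
    also have "\<dots> < \<infinity>" using h1 by (simp add: ennreal_mult_less_top)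
    finally show ?thesis .
  qed
  define K0 where "K0 = tail \<nu> 0 / tail \<omega> (2/3) * enn2real (h 0)"
  have small: "ennreal (tail \<nu> r / tail \<omega> r) * h r \<le> ennreal K0" if r: "0 \<le> r" "r < 2 / 3" for r
  proof -
    have "tail \<nu> r / tail \<omega> r \<le> tail \<nu> 0 / tail \<omega> (2/3)"
      using r by (intro frac_le tail_antimono \<nu> \<omega> tail_nonneg radial_weight_tail_pos) auto
    then have "ennreal (tail \<nu> r / tail \<omega> r) * h r \<le> ennreal (tail \<nu> 0 / tail \<omega> (2/3)) * h 0"
      using r by (intro mult_mono h_mono ennreal_leI) auto
    also have "\<dots> = ennreal K0"
      using h0 tail_nonneg[OF \<nu>, of 0] tail_nonneg[OF \<omega>, of "2/3"] ennreal_mult'[of "tail \<nu> 0 / tail \<omega> (2/3)" "enn2real (h 0)"]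
      by (simp add: K0_def)
    finally show ?thesis .
  qed
  have "0 \<le> max (C * exp 1 * K) K0" using C K by (simp add: le_max_iff_disj)
  moreover have "ennreal (tail \<nu> r / tail \<omega> r) * h r \<le> ennreal (max (C * exp 1 * K) K0)" if "r \<in> {0..<1}" for r
  proof -
    have "ennreal (C * exp 1 * K) \<le> ennreal (max (C * exp 1 * K) K0)" "ennreal K0 \<le> ennreal (max (C * exp 1 * K) K0)"
      by (intro ennreal_leI; simp)+
    then show ?thesis
      using large[of r] small[of r] that by (cases "r < 2/3") (auto intro: order_trans)
  qed
  ultimately show ?thesis unfolding h_def by blast
qed

section \<open>Orthogonality in the angle and the power series of the projection\<close>

lemma disc_area_measurable:
  assumes "f \<in> borel_measurable borel"
  shows "f \<in> borel_measurable disc_area"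
proof -
  have "f \<in> borel_measurable lebesgue" using assms by (intro measurable_completion) simp
  then have "f \<in> borel_measurable (lebesgue_on (ball 0 1))" by (rule measurable_restrict_space1)
  then show ?thesis by (simp cong: measurable_cong_sets add: sets_disc_area)
qed

lemma cnj_measurable [measurable]: "cnj \<in> borel_measurable borel"
  by (intro borel_measurable_continuous_onI continuous_intros)

lemma sgn_complex_measurable [measurable]: "(sgn :: complex \<Rightarrow> complex) \<in> borel_measurable borel"
proof -
  have "(\<lambda>z::complex. z /\<^sub>R cmod z) \<in> borel_measurable borel" by measurable
  then show ?thesis by (simp add: sgn_div_norm[abs_def])
qed

text \<open>Rotation by \<open>\<phi>\<close> with \<open>(a - b) * \<phi> = pi / 2\<close>
  multiplies the integrand by \<open>\<i>\<close> and preserves the measure, so the integral equals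
  \<open>\<i>\<close> times itself. A right angle is chosen as the target, since aiming at a sign
  change would give the excluded rotation -1 when a and b differ by one.\<close>

lemma integral_disc_area_orthogonal:
  fixes g :: "real \<Rightarrow> real"
  assumes g: "(\<lambda>r. g r * indicator {0..<1} r) \<in> borel_measurable lebesgue" and ab: "a \<noteq> b"
  shows "(LINT z|disc_area. of_real (g (cmod z)) * (sgn z ^ a * cnj (sgn z) ^ b)) = 0"
proof -
  define F where "F = (\<lambda>z. of_real (g (cmod z)) * (sgn z ^ a * cnj (sgn z) ^ b))"
  have F: "F \<in> borel_measurable disc_area"
    unfolding F_def
    by (rule borel_measurable_times[OF measurable_compose[OF measurable_cmod_disc_area[OF g] borel_measurable_of_real] disc_area_measurable])
      measurable
  define \<phi> where "\<phi> = pi / (2 * (real a - real b))"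
  define c where "c = cis \<phi>"
  have "1 \<le> \<bar>real a - real b\<bar>" using ab by linarith
  then have "\<bar>\<phi>\<bar> \<le> pi / 2" by (simp add: \<phi>_def abs_mult field_simps)
  then have "0 \<le> Re c" by (auto simp: c_def intro!: cos_ge_zero)
  then have "c \<noteq> -1" by auto
  then have c: "cmod c = 1" "c \<noteq> -1" by (simp_all add: c_def)
  have "c ^ a * cnj c ^ b = cis (real a * \<phi> - real b * \<phi>)"
    unfolding c_def cis_cnj Complex.DeMoivre cis_mult by simp
  also have "real a * \<phi> - real b * \<phi> = pi / 2"
  proof -
    have *: "d * (pi / (2 * d)) = pi / 2" if "d \<noteq> 0" for d :: real using that by simp
    have "(real a - real b) * \<phi> = pi / 2" unfolding \<phi>_def by (rule *) (use ab in simp)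
    then show ?thesis by (simp add: left_diff_distrib)
  qed
  finally have ci: "c ^ a * cnj c ^ b = \<i>" by (simp add: complex_eq_iff)
  have Fc: "F (c * z) = \<i> * F z" for z
  proof -
    have "F (c * z) = (c ^ a * cnj c ^ b) * F z"
      using c by (simp add: F_def norm_mult sgn_mult sgn_div_norm[of c] power_mult_distrib mult_ac)
    then show ?thesis by (simp add: ci)
  qed
  have "integral\<^sup>L disc_area F = integral\<^sup>L (distr disc_area disc_area (\<lambda>z. c * z)) F"
    using distr_rotate_disc_area(2)[OF c] by simp
  also have "\<dots> = (LINT z|disc_area. F (c * z))"
    by (intro integral_distr distr_rotate_disc_area(1)[OF c] F)
  also have "\<dots> = \<i> * integral\<^sup>L disc_area F" by (simp add: Fc)
  finally have "(1 - \<i>) * integral\<^sup>L disc_area F = 0" by (simp add: algebra_simps)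
  then have "integral\<^sup>L disc_area F = 0" by (simp add: complex_eq_iff)
  then show ?thesis by (simp add: F_def)
qed

text \<open>In the disc the n-th term is dominated by
  \<open>\<bar>c n\<bar> * cmod z ^ n * norm (F w)\<close>, summable and integrable, so sum and
  integral may be exchanged. The coefficients are arbitrary in order to serve both the kernel and
  its derivative.\<close>

lemma sums_integral_power_series:
  fixes F :: "complex \<Rightarrow> complex" and c :: "nat \<Rightarrow> real"
  assumes F: "integrable disc_area F" and c: "summable (\<lambda>n. \<bar>c n\<bar> * cmod z ^ n)" and z: "cmod z < 1"
  shows "integrable disc_area (\<lambda>w. F w * (\<Sum>n. of_real (c n) * (z * cnj w) ^ n))"
    and "(\<lambda>n. of_real (c n) * z ^ n * (LINT w|disc_area. F w * cnj w ^ n)) sums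
      (LINT w|disc_area. F w * (\<Sum>n. of_real (c n) * (z * cnj w) ^ n))"
proof -
  define f where "f = (\<lambda>n w. F w * (of_real (c n) * (z * cnj w) ^ n))"
  have [measurable]: "F \<in> borel_measurable disc_area" using F by simp
  have le: "norm (f n w) \<le> \<bar>c n\<bar> * cmod z ^ n * norm (F w)" if "w \<in> space disc_area" for n w
  proof -
    have "cmod w ^ n \<le> 1" using that by (intro power_le_one) auto
    then have "(\<bar>c n\<bar> * cmod z ^ n * norm (F w)) * cmod w ^ n \<le> (\<bar>c n\<bar> * cmod z ^ n * norm (F w)) * 1"
      by (intro mult_left_mono) auto
    then show ?thesis by (simp add: f_def norm_mult norm_power power_mult_distrib mult_ac)
  qed
  have meas: "f n \<in> borel_measurable disc_area" for n
    unfolding f_def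
    by (rule borel_measurable_times[OF borel_measurable_integrable[OF F] disc_area_measurable]) measurable
  have dom: "integrable disc_area (\<lambda>w. \<bar>c n\<bar> * cmod z ^ n * norm (F w))" for n
    using F by simp
  have int: "integrable disc_area (f n)" for n
  proof (rule Bochner_Integration.integrable_bound[OF dom[of n] meas], rule AE_I2)
    fix w assume "w \<in> space disc_area"
    from order_trans[OF le[OF this] abs_ge_self]
    show "norm (f n w) \<le> norm (\<bar>c n\<bar> * cmod z ^ n * norm (F w))" unfolding real_norm_def .
  qed
  have AE: "AE w in disc_area. summable (\<lambda>n. norm (f n w))"
  proof (rule AE_I2)
    fix w assume "w \<in> space disc_area"
    then show "summable (\<lambda>n. norm (f n w))"
      using le by (intro summable_comparison_test'[OF summable_mult2[OF c, of "norm (F w)"], where N = 0]) auto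
  qed
  have sm: "summable (\<lambda>n. LINT w|disc_area. norm (f n w))"
  proof (rule summable_comparison_test'[where N = 0])
    show "summable (\<lambda>n. \<bar>c n\<bar> * cmod z ^ n * (LINT w|disc_area. norm (F w)))"
      by (rule summable_mult2[OF c])
    fix n :: nat
    have "(LINT w|disc_area. norm (f n w)) \<le> (LINT w|disc_area. \<bar>c n\<bar> * cmod z ^ n * norm (F w))"
      using int[of n] dom[of n] le by (intro integral_mono) auto
    then show "norm (LINT w|disc_area. norm (f n w)) \<le> \<bar>c n\<bar> * cmod z ^ n * (LINT w|disc_area. norm (F w))"
      by simp
  qed
  have eq: "(\<Sum>n. f n w) = F w * (\<Sum>n. of_real (c n) * (z * cnj w) ^ n)" if "w \<in> space disc_area" for w
  proof -
    have "summable (\<lambda>n. of_real (c n) * (z * cnj w) ^ n)"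
    proof (rule summable_comparison_test'[OF c, where N = 0])
      fix n :: nat
      have "cmod w ^ n \<le> 1" using that by (intro power_le_one) auto
      then have "(\<bar>c n\<bar> * cmod z ^ n) * cmod w ^ n \<le> (\<bar>c n\<bar> * cmod z ^ n) * 1"
        by (intro mult_left_mono) auto
      then show "norm (of_real (c n) * (z * cnj w) ^ n) \<le> \<bar>c n\<bar> * cmod z ^ n"
        by (simp add: norm_mult norm_power power_mult_distrib mult_ac)
    qed
    then show ?thesis unfolding f_def by (rule suminf_mult)
  qed
  have "integrable disc_area (\<lambda>w. \<Sum>n. f n w)"
    using int AE sm by (rule integrable_suminf)
  then show "integrable disc_area (\<lambda>w. F w * (\<Sum>n. of_real (c n) * (z * cnj w) ^ n))"
    by (rule Bochner_Integration.integrable_cong[THEN iffD1, rotated -1]) (auto simp: eq)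
  have "(\<lambda>n. integral\<^sup>L disc_area (f n)) sums (LINT w|disc_area. (\<Sum>n. f n w))"
    using int AE sm by (rule sums_integral)
  also have "(LINT w|disc_area. (\<Sum>n. f n w)) = (LINT w|disc_area. F w * (\<Sum>n. of_real (c n) * (z * cnj w) ^ n))"
    by (intro Bochner_Integration.integral_cong) (auto simp: eq)
  also have "(\<lambda>n. integral\<^sup>L disc_area (f n)) = (\<lambda>n. of_real (c n) * z ^ n * (LINT w|disc_area. F w * cnj w ^ n))"
  proof
    fix n
    have "integral\<^sup>L disc_area (f n) = (LINT w|disc_area. (of_real (c n) * z ^ n) * (F w * cnj w ^ n))"
      by (intro Bochner_Integration.integral_cong) (auto simp: f_def power_mult_distrib)
    then show "integral\<^sup>L disc_area (f n) = of_real (c n) * z ^ n * (LINT w|disc_area. F w * cnj w ^ n)" by simp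
  qed
  finally show "(\<lambda>n. of_real (c n) * z ^ n * (LINT w|disc_area. F w * cnj w ^ n)) sums
      (LINT w|disc_area. F w * (\<Sum>n. of_real (c n) * (z * cnj w) ^ n))" .
qed

definition kernel_coeff :: "(real \<Rightarrow> real) \<Rightarrow> nat \<Rightarrow> real"
  where "kernel_coeff \<omega> n = 1 / (2 * rmoment \<omega> (2 * real n + 1))"

lemma kernel_coeff_pos: "radial_weight \<omega> \<Longrightarrow> 0 < kernel_coeff \<omega> n"
  by (simp add: kernel_coeff_def rmoment_pos)

lemma summable_poly_geometric:
  fixes t :: real
  assumes t: "0 \<le> t" "t < 1"
  shows "summable (\<lambda>n. (real n + 1) ^ p * t ^ n)"
proof -
  have "(\<lambda>n. 1 + 1 / (real n + 1)) \<longlonglongrightarrow> 1 + 0"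
    by (intro tendsto_add tendsto_const) (use LIMSEQ_inverse_real_of_nat in \<open>simp add: inverse_eq_divide add.commute\<close>)
  then have "(\<lambda>n. (1 + 1 / (real n + 1)) ^ p * t) \<longlonglongrightarrow> (1 + 0) ^ p * t"
    by (intro tendsto_mult tendsto_power tendsto_const)
  then have "eventually (\<lambda>n. (1 + 1 / (real n + 1)) ^ p * t < (1 + t) / 2) sequentially"
    by (rule order_tendstoD) (use t in simp)
  then obtain N where N: "\<And>n. n \<ge> N \<Longrightarrow> (1 + 1 / (real n + 1)) ^ p * t < (1 + t) / 2"
    by (auto simp: eventually_sequentially)
  show ?thesis
  proof (rule summable_ratio_test[of "(1 + t) / 2" N])
    fix n assume "N \<le> n"
    have "(real (Suc n) + 1) ^ p * t ^ Suc n = ((1 + 1 / (real n + 1)) ^ p * t) * ((real n + 1) ^ p * t ^ n)"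
    proof -
      have "real (Suc n) + 1 = (1 + 1 / (real n + 1)) * (real n + 1)" by (simp add: field_simps)
      then show ?thesis by (simp add: power_mult_distrib)
    qed
    also have "\<dots> \<le> (1 + t) / 2 * ((real n + 1) ^ p * t ^ n)"
      using N[OF \<open>N \<le> n\<close>] t by (intro mult_right_mono) auto
    finally show "norm ((real (Suc n) + 1) ^ p * t ^ Suc n) \<le> (1 + t) / 2 * norm ((real n + 1) ^ p * t ^ n)"
      using t by simp
  qed (use t in simp)
qed

text \<open>The moment of order 2n + 1 controls the tail at distance 1/(2n+2) from 1, and by
  doubling that tail is at most polynomially smaller than \<open>tail \<omega> 0\<close>. Hence the
  kernel and its derivative converge in the whole disc.\<close>

lemma kernel_coeff_growth:
  assumes \<omega>d: "doubling_weight \<omega>"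
  shows "\<exists>A p. 0 < A \<and> (\<forall>n. kernel_coeff \<omega> n \<le> A * (real n + 1) ^ p)"
proof -
  note \<omega> = doubling_weight_radial[OF \<omega>d]
  obtain m where m: "\<And>r s. 0 \<le> r \<Longrightarrow> r \<le> s \<Longrightarrow> s < 1 \<Longrightarrow> tail \<omega> r \<le> (2 * (1 - r) / (1 - s)) ^ m * tail \<omega> s"
    using doubling_weight_growth[OF \<omega>d] by blast
  have t0: "0 < tail \<omega> 0" by (intro radial_weight_tail_pos[OF \<omega>]) auto
  have "kernel_coeff \<omega> n \<le> 4 ^ m * exp 1 / (2 * tail \<omega> 0) * (real n + 1) ^ m" for n
  proof -
    define x where "x = 2 * real n + 1"
    have x: "0 \<le> x" by (simp add: x_def)
    have "tail \<omega> 0 \<le> (2 * (1 - 0) / (1 - x / (x + 1))) ^ m * tail \<omega> (x / (x + 1))"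
      using x by (intro m) auto
    also have "2 * (1 - 0) / (1 - x / (x + 1)) = 4 * (real n + 1)"
      by (simp add: x_def field_simps)
    also have "(4 * (real n + 1)) ^ m * tail \<omega> (x / (x + 1)) \<le> (4 * (real n + 1)) ^ m * (exp 1 * rmoment \<omega> x)"
      by (intro mult_left_mono rmoment_ge[OF \<omega> x]) auto
    finally have "tail \<omega> 0 \<le> 4 ^ m * exp 1 * (real n + 1) ^ m * rmoment \<omega> x"
      unfolding power_mult_distrib by (simp only: mult_ac)
    then have "tail \<omega> 0 / (2 * tail \<omega> 0 * rmoment \<omega> x)
        \<le> 4 ^ m * exp 1 * (real n + 1) ^ m * rmoment \<omega> x / (2 * tail \<omega> 0 * rmoment \<omega> x)"
      using t0 rmoment_pos[OF \<omega> x] by (intro divide_right_mono) auto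
    then show ?thesis
      using t0 rmoment_pos[OF \<omega> x] by (simp add: kernel_coeff_def x_def)
  qed
  moreover have "0 < 4 ^ m * exp 1 / (2 * tail \<omega> 0)" using t0 by simp
  ultimately show ?thesis by blast
qed

lemma summable_kernel_coeff:
  assumes \<omega>d: "doubling_weight \<omega>" and t: "0 \<le> t" "t < 1"
  shows "summable (\<lambda>n. \<bar>kernel_coeff \<omega> n\<bar> * t ^ n)"
    and "summable (\<lambda>n. \<bar>real (Suc n) * kernel_coeff \<omega> (Suc n)\<bar> * t ^ n)"
proof -
  note \<omega> = doubling_weight_radial[OF \<omega>d]
  obtain A p where A: "0 < A" "\<And>n. kernel_coeff \<omega> n \<le> A * (real n + 1) ^ p"
    using kernel_coeff_growth[OF \<omega>d] by blast
  show "summable (\<lambda>n. \<bar>kernel_coeff \<omega> n\<bar> * t ^ n)"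
  proof (rule summable_comparison_test'[where N = 0])
    show "summable (\<lambda>n. A * ((real n + 1) ^ p * t ^ n))"
      by (intro summable_mult summable_poly_geometric t)
    show "norm (\<bar>kernel_coeff \<omega> n\<bar> * t ^ n) \<le> A * ((real n + 1) ^ p * t ^ n)" for n
      using A(2)[of n] kernel_coeff_pos[OF \<omega>, of n] t
      by (simp add: abs_mult mult.assoc[symmetric] mult_right_mono)
  qed
  show "summable (\<lambda>n. \<bar>real (Suc n) * kernel_coeff \<omega> (Suc n)\<bar> * t ^ n)"
  proof (rule summable_comparison_test'[where N = 0])
    show "summable (\<lambda>n. A * 2 ^ p * ((real n + 1) ^ (p + 1) * t ^ n))"
      by (intro summable_mult summable_poly_geometric t)
    fix n
    have "kernel_coeff \<omega> (Suc n) \<le> A * (real (Suc n) + 1) ^ p" by (rule A(2))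
    also have "\<dots> \<le> A * (2 * (real n + 1)) ^ p" using A(1) by (intro mult_left_mono power_mono) auto
    finally have "(real n + 1) * kernel_coeff \<omega> (Suc n) * t ^ n \<le> (real n + 1) * (A * (2 * (real n + 1)) ^ p) * t ^ n"
      using t by (intro mult_right_mono mult_left_mono) auto
    also have "\<dots> = A * 2 ^ p * ((real n + 1) ^ (p + 1) * t ^ n)"
      unfolding power_mult_distrib by simp
    finally show "norm (\<bar>real (Suc n) * kernel_coeff \<omega> (Suc n)\<bar> * t ^ n) \<le> A * 2 ^ p * ((real n + 1) ^ (p + 1) * t ^ n)"
      using t kernel_coeff_pos[OF \<omega>, of "Suc n"] by (simp add: abs_mult add.commute)
  qed
qed

lemma bergman_integrand_eq:
  assumes \<omega>d: "doubling_weight \<omega>" and z: "cmod z < 1" and w: "cmod w < 1"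
  shows "bergman_integrand \<omega> f z w
    = f w * of_real (\<omega> (cmod w)) * (\<Sum>n. of_real (kernel_coeff \<omega> n) * (z * cnj w) ^ n)"
proof -
  have "cmod (z * cnj w) < 1"
    using mult_strict_mono'[of "cmod z" 1 "cmod w" 1] z w by (simp add: norm_mult)
  then have "summable (\<lambda>n. \<bar>kernel_coeff \<omega> n\<bar> * cmod (z * cnj w) ^ n)"
    by (intro summable_kernel_coeff[OF \<omega>d]) auto
  then have s: "summable (\<lambda>n. of_real (kernel_coeff \<omega> n) * (z * cnj w) ^ n)"
    by (rule summable_comparison_test'[where N = 0]) (simp add: norm_mult norm_power power_mult_distrib)
  have "bergman_kernel \<omega> z w = (\<Sum>n. cnj (of_real (kernel_coeff \<omega> n) * (z * cnj w) ^ n))"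
    unfolding bergman_kernel_def
    by (intro suminf_cong) (simp add: kernel_coeff_def rmoment_def)
  also have "\<dots> = cnj (\<Sum>n. of_real (kernel_coeff \<omega> n) * (z * cnj w) ^ n)"
    by (rule bounded_linear.suminf[OF bounded_linear_cnj s, symmetric])
  finally show ?thesis by (simp add: bergman_integrand_def mult_ac)
qed

lemma bergman_projection_sums:
  assumes \<omega>d: "doubling_weight \<omega>" and F: "integrable disc_area (\<lambda>w. f w * of_real (\<omega> (cmod w)))" and z: "cmod z < 1"
  shows "integrable disc_area (bergman_integrand \<omega> f z)"
    and "(\<lambda>n. of_real (kernel_coeff \<omega> n) * z ^ n * (LINT w|disc_area. f w * of_real (\<omega> (cmod w)) * cnj w ^ n))
      sums bergman_projection \<omega> f z"
proof -
  have c: "summable (\<lambda>n. \<bar>kernel_coeff \<omega> n\<bar> * cmod z ^ n)"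
    using z by (intro summable_kernel_coeff[OF \<omega>d]) auto
  note * = sums_integral_power_series[OF F c z]
  show "integrable disc_area (bergman_integrand \<omega> f z)"
    using *(1) by (rule Bochner_Integration.integrable_cong[THEN iffD1, rotated -1])
      (auto simp: bergman_integrand_eq[OF \<omega>d z])
  have "bergman_projection \<omega> f z = (LINT w|disc_area. f w * of_real (\<omega> (cmod w)) * (\<Sum>n. of_real (kernel_coeff \<omega> n) * (z * cnj w) ^ n))"
    unfolding bergman_projection_def
    by (intro Bochner_Integration.integral_cong) (auto simp: bergman_integrand_eq[OF \<omega>d z])
  with *(2) show "(\<lambda>n. of_real (kernel_coeff \<omega> n) * z ^ n * (LINT w|disc_area. f w * of_real (\<omega> (cmod w)) * cnj w ^ n))
      sums bergman_projection \<omega> f z" by simp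
qed

section \<open>Necessity of the tail condition\<close>

lemma tail_cmod_measurable:
  assumes "radial_weight \<nu>"
  shows "(\<lambda>z. tail \<nu> (cmod z)) \<in> borel_measurable disc_area"
  by (rule measurable_cmod_disc_area, rule measurable_completion) (simp add: tail_measurable[OF assms])

text \<open>The test function has the largest modulus that norm 1 allows, and a phase of a single
  frequency. Multiplied by \<open>\<omega>\<close> it becomes \<open>\<sigma>\<close> times
  \<open>sgn w ^ n\<close>, so orthogonality isolates the n-th Taylor coefficient, a kernel
  coefficient times a moment of \<open>\<sigma>\<close>.\<close>

lemma projection_bounded_imp_tail_condition:
  assumes \<nu>: "radial_weight \<nu>" and \<omega>d: "doubling_weight \<omega>"
    and bounded: "bergman_projection_bounded \<omega> \<nu>"
  shows "\<exists>K'\<ge>0. tail_condition \<nu> \<omega> K'"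
proof -
  note \<omega> = doubling_weight_radial[OF \<omega>d]
  define \<sigma> where "\<sigma> = (\<lambda>r. \<omega> r / tail \<nu> r)"
  define f where "f = (\<lambda>n z. of_real (1 / tail \<nu> (cmod z)) * sgn z ^ n :: complex)"
  have \<sigma>m: "(\<lambda>r. \<sigma> r * indicator {0..<1} r) \<in> borel_measurable lebesgue"
    unfolding \<sigma>_def by (rule quotient_measurable[OF \<omega> \<nu>])
  have \<sigma>0: "0 \<le> \<sigma> (cmod z)" if "z \<in> space disc_area" for z
    using that quotient_nonneg[OF \<omega> \<nu>, of "cmod z"] by (simp add: \<sigma>_def)
  have fm: "f n \<in> borel_measurable disc_area" for n
  proof -
    have "(\<lambda>z. of_real (1 / tail \<nu> (cmod z)) :: complex) \<in> borel_measurable disc_area"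
      using tail_cmod_measurable[OF \<nu>] by (intro borel_measurable_of_real[THEN measurable_compose[rotated]] borel_measurable_divide) auto
    then show ?thesis
      unfolding f_def by (rule borel_measurable_times[OF _ disc_area_measurable]) measurable
  qed
  have fnorm: "Linf_norm \<nu> (f n) \<le> 1" for n
    unfolding Linf_norm_def
  proof (rule esssup_I)
    show "(\<lambda>z. ennreal (cmod (f n z) * tail \<nu> (cmod z))) \<in> borel_measurable disc_area"
      using fm[of n] tail_cmod_measurable[OF \<nu>] by measurable
    show "AE z in disc_area. ennreal (cmod (f n z) * tail \<nu> (cmod z)) \<le> 1"
    proof (rule AE_I2)
      fix z assume "z \<in> space disc_area"
      then have "0 < tail \<nu> (cmod z)" by (intro radial_weight_tail_pos[OF \<nu>]) auto
      then have "cmod (f n z) * tail \<nu> (cmod z) = cmod (sgn z) ^ n"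
        by (simp add: f_def norm_mult norm_power norm_divide)
      also have "\<dots> \<le> 1" by (intro power_le_one) (auto simp: norm_sgn)
      finally show "ennreal (cmod (f n z) * tail \<nu> (cmod z)) \<le> 1" by (simp add: ennreal_le_1)
    qed
  qed
  have fL: "f n \<in> Linf \<nu>" for n
    using fm fnorm[of n] by (auto simp: Linf_def intro: le_less_trans)
  have feq: "f n w * of_real (\<omega> (cmod w)) = of_real (\<sigma> (cmod w)) * sgn w ^ n" for n w
    by (simp add: f_def \<sigma>_def)
  \<comment> \<open>At z = 0 the kernel is a constant, so the integrability demanded by boundedness,
    taken at the origin, gives integrability of \<open>\<sigma>\<close>.\<close>
  have fint: "integrable disc_area (\<lambda>w. f n w * of_real (\<omega> (cmod w)))" for n
  proof -
    have "integrable disc_area (bergman_integrand \<omega> (f n) 0)"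
      using bounded fL[of n] by (auto simp: bergman_projection_bounded_def)
    then have "integrable disc_area (\<lambda>w. of_real (kernel_coeff \<omega> 0) * (f n w * of_real (\<omega> (cmod w))))"
    proof (rule Bochner_Integration.integrable_cong[THEN iffD1, rotated -1, OF _ refl])
      fix w assume "w \<in> space disc_area"
      then show "bergman_integrand \<omega> (f n) 0 w = of_real (kernel_coeff \<omega> 0) * (f n w * of_real (\<omega> (cmod w)))"
        by (simp add: bergman_integrand_eq[OF \<omega>d])
    qed
    from integrable_mult_right[OF this, of "of_real (1 / kernel_coeff \<omega> 0)"] show ?thesis
      using kernel_coeff_pos[OF \<omega>, of 0] by simp
  qed
  have \<sigma>int: "integrable disc_area (\<lambda>w. \<sigma> (cmod w))"
  proof -
    have "integrable disc_area (\<lambda>w. Re (f 0 w * of_real (\<omega> (cmod w))))" by (intro integrable_Re fint)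
    then show ?thesis by (simp only: feq) simp
  qed
  have pint: "integrable disc_area (\<lambda>w. \<sigma> (cmod w) * cmod w ^ n)" for n
  proof (rule Bochner_Integration.integrable_bound[OF \<sigma>int])
    show "(\<lambda>w. \<sigma> (cmod w) * cmod w ^ n) \<in> borel_measurable disc_area"
      using \<sigma>int by (intro borel_measurable_times disc_area_measurable[of "\<lambda>w. cmod w ^ n"]) auto
    show "AE w in disc_area. norm (\<sigma> (cmod w) * cmod w ^ n) \<le> norm (\<sigma> (cmod w))"
      by (intro AE_I2) (auto simp: abs_mult intro!: mult_left_le power_le_one)
  qed
  define A where "A = (\<lambda>n. LINT w|disc_area. \<sigma> (cmod w) * cmod w ^ n)"
  have coeff: "(LINT w|disc_area. f n w * of_real (\<omega> (cmod w)) * cnj w ^ k) = (if k = n then of_real (A n) else 0)" for n k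
  proof -
    have polar: "cnj w ^ k = of_real (cmod w ^ k) * cnj (sgn w) ^ k" for w
    proof -
      have "w = of_real (cmod w) * sgn w" by (simp add: sgn_eq)
      then have "cnj w = of_real (cmod w) * cnj (sgn w)" by (metis complex_cnj_complex_of_real complex_cnj_mult)
      then show ?thesis by (simp add: power_mult_distrib)
    qed
    have e: "f n w * of_real (\<omega> (cmod w)) * cnj w ^ k
        = of_real (\<sigma> (cmod w) * cmod w ^ k) * (sgn w ^ n * cnj (sgn w) ^ k)" for w
      unfolding feq by (subst polar[of w]) simp
    show ?thesis
    proof (cases "k = n")
      case True
      have "of_real (\<sigma> (cmod w) * cmod w ^ k) * (sgn w ^ n * cnj (sgn w) ^ k)
          = (of_real (\<sigma> (cmod w) * cmod w ^ n) :: complex)" for w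
      \<comment> \<open>Since \<open>sgn 0 = 0\<close>, the origin is separate: for n = 0 all powers
        are 1, for larger n both sides vanish through \<open>cmod w ^ n\<close>.\<close>
      proof (cases "w = 0")
        case True
        then show ?thesis using \<open>k = n\<close> by (cases n) auto
      next
        case False
        then have "sgn w * cnj (sgn w) = 1"
          by (simp only: complex_norm_square[symmetric] norm_sgn) simp
        then show ?thesis using \<open>k = n\<close> by (simp add: power_mult_distrib[symmetric])
      qed
      then have "(LINT w|disc_area. of_real (\<sigma> (cmod w) * cmod w ^ k) * (sgn w ^ n * cnj (sgn w) ^ k))
          = (LINT w|disc_area. (of_real (\<sigma> (cmod w) * cmod w ^ n) :: complex))"
        by (rule Bochner_Integration.integral_cong[OF refl])
      also have "\<dots> = of_real (A n)" unfolding A_def by (rule integral_complex_of_real)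
      finally show ?thesis unfolding e using True by simp
    next
      case False
      then show ?thesis unfolding e
        using integral_disc_area_orthogonal[OF measurable_radial_power[OF \<sigma>m, of k], of n k] by simp
    qed
  qed
  \<comment> \<open>The factor 2 and the extra 1 in the order come from the density
    \<open>2 * r\<close> of the radial measure.\<close>
  have A: "ennreal (A n) = 2 * moment \<sigma> (real n + 1)" for n
  proof -
    note m = measurable_radial_power[OF \<sigma>m, of n] and m' = measurable_radial_powr[OF \<sigma>m, of "real n + 1"]
    have "ennreal (A n) = (\<integral>\<^sup>+w. ennreal (\<sigma> (cmod w) * cmod w ^ n) \<partial>disc_area)"
      unfolding A_def using \<sigma>0 by (intro nn_integral_eq_integral[symmetric] pint AE_I2) auto
    also have "\<dots> = (\<integral>\<^sup>+r\<in>{0..<1}. ennreal (2 * r * (\<sigma> r * r ^ n)) \<partial>lebesgue)"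
      using nn_integral_radial_disc_area[OF m] by simp
    also have "\<dots> = (\<integral>\<^sup>+r. 2 * (ennreal (r powr (real n + 1) * \<sigma> r) * indicator {0..<1} r) \<partial>lebesgue)"
    proof (rule nn_integral_cong)
      fix r :: real
      show "ennreal (2 * r * (\<sigma> r * r ^ n)) * indicator {0..<1} r = 2 * (ennreal (r powr (real n + 1) * \<sigma> r) * indicator {0..<1} r)"
      proof (cases "r \<in> {0..<1}")
        case True
        then have "r powr (real n + 1) = r * r ^ n"
          by (cases "r = 0") (auto simp: powr_add powr_realpow)
        then show ?thesis using True ennreal_mult'[of 2 "r * r ^ n * \<sigma> r"] by (simp add: mult_ac)
      qed simp
    qed
    also have "\<dots> = 2 * moment \<sigma> (real n + 1)"
      unfolding moment_def by (rule nn_integral_cmult[OF m'])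
    finally show ?thesis .
  qed
  have A0: "0 \<le> A n" for n
    unfolding A_def using \<sigma>0 by (intro integral_nonneg_AE AE_I2) auto
  have P: "bergman_projection \<omega> (f n) z = of_real (kernel_coeff \<omega> n * A n) * z ^ n" if z: "cmod z < 1" for n z
  proof -
    have "(\<lambda>k. of_real (kernel_coeff \<omega> k) * z ^ k * (if k = n then of_real (A n) else 0)) sums bergman_projection \<omega> (f n) z"
      using bergman_projection_sums(2)[OF \<omega>d fint[of n] z] by (simp add: coeff)
    moreover have "(\<lambda>k. if k = n then of_real (kernel_coeff \<omega> k) * z ^ k * of_real (A n) else 0) sums
        (of_real (kernel_coeff \<omega> n) * z ^ n * of_real (A n))"
      by (rule sums_single)
    moreover have "(\<lambda>k. of_real (kernel_coeff \<omega> k) * z ^ k * (if k = n then of_real (A n) else 0))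
        = (\<lambda>k. if k = n then of_real (kernel_coeff \<omega> k) * z ^ k * of_real (A n) else (0::complex))"
      by auto
    ultimately show ?thesis using sums_unique2 by (fastforce simp: mult_ac)
  qed
  have dP: "deriv (bergman_projection \<omega> (f n)) z = of_real (kernel_coeff \<omega> n * A n) * (of_nat n * z ^ (n - 1))"
    if z: "cmod z < 1" for n z
  proof -
    have "eventually (\<lambda>y. y \<in> ball 0 1) (nhds z)"
      using z by (intro eventually_nhds_in_open) auto
    then have "eventually (\<lambda>y. bergman_projection \<omega> (f n) y = of_real (kernel_coeff \<omega> n * A n) * y ^ n) (nhds z)"
      by eventually_elim (simp add: P)
    then have "deriv (bergman_projection \<omega> (f n)) z = deriv (\<lambda>y. of_real (kernel_coeff \<omega> n * A n) * y ^ n) z"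
      by (intro deriv_cong_ev) auto
    also have "\<dots> = of_real (kernel_coeff \<omega> n * A n) * (of_nat n * z ^ (n - 1))"
      by (intro DERIV_imp_deriv) (auto intro!: derivative_eq_intros)
    finally show ?thesis .
  qed
  obtain C where C: "\<And>g. g \<in> Linf \<nu> \<Longrightarrow> bloch_norm \<nu> (bergman_projection \<omega> g) \<le> ennreal C * Linf_norm \<nu> g"
    using bounded by (auto simp: bergman_projection_bounded_def)
  define C' where "C' = max C 0"
  have bl: "(1 - cmod z) * tail \<nu> (cmod z) * cmod (deriv (bergman_projection \<omega> (f n)) z) \<le> C'" if z: "cmod z < 1" for n z
  proof -
    have "ennreal ((1 - cmod z) * tail \<nu> (cmod z) * cmod (deriv (bergman_projection \<omega> (f n)) z))
        \<le> bloch_norm \<nu> (bergman_projection \<omega> (f n))"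
      unfolding bloch_norm_def using z by (intro SUP_upper) auto
    also have "\<dots> \<le> ennreal C * Linf_norm \<nu> (f n)" by (rule C[OF fL])
    also have "\<dots> \<le> ennreal C' * 1" by (intro mult_mono fnorm ennreal_leI) (auto simp: C'_def)
    finally show ?thesis by (simp add: C'_def)
  qed
  have "ennreal (tail \<nu> (real n / (real n + 1)) / rmoment \<omega> (2 * real n + 1)) * moment \<sigma> (real n + 1) \<le> ennreal (2 * exp 1 * C')"
    if n: "1 \<le> n" for n
  proof -
    \<comment> \<open>The choice that balances the weight 1 - t against the derivative of
      \<open>t ^ n\<close>: here \<open>(1 - t) * n = t \<ge> 1 / 2\<close> and
      \<open>t ^ (n - 1) \<ge> exp (-1)\<close>, so their product stays above a positive
      constant.\<close>
    define t where "t = real n / (real n + 1)"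
    have t: "1 / 2 \<le> t" "t < 1" "0 \<le> t" using n by (auto simp: t_def field_simps)
    have m: "0 < rmoment \<omega> (2 * real n + 1)" by (intro rmoment_pos[OF \<omega>]) simp
    have v: "0 < tail \<nu> t" using t by (intro radial_weight_tail_pos[OF \<nu>]) auto
    have tn: "exp (-1) \<le> t ^ (n - 1)"
    proof -
      have "(1 + 1 / real n) ^ n \<le> exp 1"
        using n by (intro exp_ge_one_plus_x_over_n_power_n) auto
      moreover have "1 + 1 / real n = inverse t" using n by (simp add: t_def field_simps)
      moreover have "0 < t" using t by simp
      ultimately have "inverse (exp 1) \<le> t ^ n"
        by (metis inverse_inverse_eq le_imp_inverse_le power_inverse zero_less_power inverse_positive_iff_positive)
      also have "t ^ n \<le> t ^ (n - 1)" using t by (intro power_decreasing) auto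
      finally show ?thesis by (simp add: exp_minus)
    qed
    have "(1 - t) * real n = t" by (simp add: t_def field_simps)
    have "1 / 2 * (tail \<nu> t * (kernel_coeff \<omega> n * A n)) * exp (-1)
        \<le> t * (tail \<nu> t * (kernel_coeff \<omega> n * A n)) * t ^ (n - 1)"
      using t tn v A0[of n] kernel_coeff_pos[OF \<omega>, of n]
      by (intro mult_mono mult_nonneg_nonneg) (auto simp: less_imp_le)
    also have "\<dots> = ((1 - t) * real n) * (tail \<nu> t * (kernel_coeff \<omega> n * A n)) * t ^ (n - 1)"
      unfolding \<open>(1 - t) * real n = t\<close> ..
    also have "\<dots> = (1 - t) * tail \<nu> t * cmod (deriv (bergman_projection \<omega> (f n)) (of_real t))"
      using t A0[of n] kernel_coeff_pos[OF \<omega>, of n]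
      by (simp add: dP norm_mult norm_power abs_mult mult_ac)
    also have "\<dots> \<le> C'" using bl[of "of_real t" n] t by simp
    finally have "tail \<nu> t * (kernel_coeff \<omega> n * A n) \<le> 2 * exp 1 * C'"
      by (simp add: exp_minus field_simps)
    then have le: "tail \<nu> t / rmoment \<omega> (2 * real n + 1) * (A n / 2) \<le> 2 * exp 1 * C'"
      by (simp add: kernel_coeff_def field_simps)
    have "moment \<sigma> (real n + 1) = ennreal (A n / 2)"
    proof -
      have "2 * moment \<sigma> (real n + 1) = 2 * ennreal (A n / 2)"
        using A[of n] ennreal_mult'[of 2 "A n / 2"] by simp
      then show ?thesis by (simp add: ennreal_mult_cancel_left)
    qed
    then have "ennreal (tail \<nu> t / rmoment \<omega> (2 * real n + 1)) * moment \<sigma> (real n + 1)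
        = ennreal (tail \<nu> t / rmoment \<omega> (2 * real n + 1) * (A n / 2))"
      using v m ennreal_mult'[of "tail \<nu> t / rmoment \<omega> (2 * real n + 1)" "A n / 2"] by simp
    also have "\<dots> \<le> ennreal (2 * exp 1 * C')" by (intro ennreal_leI le)
    finally show ?thesis by (simp add: t_def)
  qed
  moreover have "0 \<le> 2 * exp 1 * C'" by (simp add: C'_def)
  ultimately show ?thesis
    unfolding \<sigma>_def by (intro sequence_condition_imp_tail_condition[OF \<nu> \<omega>d])
qed

subsection \<open>Second differences of the kernel coefficients\<close>

lemma double_summation_by_parts:
  fixes b E :: "nat \<Rightarrow> complex"
  assumes "E 0 = 0"
  shows "(\<Sum>i<N. (b i - 2 * b (Suc i) + b (Suc (Suc i))) * E (Suc i)) + b N * E (Suc N) - b (Suc N) * E N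
    = b 0 * E 1 + (\<Sum>i<N. b (Suc i) * (E (Suc (Suc i)) - 2 * E (Suc i) + E i))"
  using assms by (induction N) (simp_all add: algebra_simps)

definition geom_poly :: "complex \<Rightarrow> nat \<Rightarrow> complex"
  where "geom_poly v j = (\<Sum>a<j. v ^ a)"

text \<open>This is the coefficient of \<open>x ^ k\<close> in
  \<open>v * x\<^sup>2 / ((1 - x)\<^sup>2 * (1 - v * x)\<^sup>2)\<close>. The factor
  \<open>1 / (1 - x)\<^sup>2\<close> stands for the two summations, and
  \<open>v / (1 - v * x)\<^sup>2\<close> generates the monomials \<open>n * v ^ n\<close>. Since
  \<open>x / ((1 - x) * (1 - v * x))\<close> generates \<open>geom_poly v\<close>, the result is a
  self-convolution, which is what makes an L1 bound through squares possible.\<close>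

definition product_poly :: "complex \<Rightarrow> nat \<Rightarrow> complex"
  where "product_poly v k = (\<Sum>j\<le>k. v * geom_poly v j * geom_poly v (k - j))"

lemma geom_poly_0 [simp]: "geom_poly v 0 = 0"
  and geom_poly_Suc: "geom_poly v (Suc j) = geom_poly v j + v ^ j"
  by (simp_all add: geom_poly_def)

text \<open>The coefficient of \<open>v ^ n\<close> in \<open>product_poly v k\<close> is \<open>n * (k - n)\<close>, so that its second difference
  in \<open>k\<close> is the single monomial \<open>n v ^ n\<close>.\<close>
lemma product_poly_second_difference:
  "product_poly v (Suc (Suc k)) - 2 * product_poly v (Suc k) + product_poly v k = of_nat (Suc k) * v ^ Suc k"
proof -
  define T where "T = (\<lambda>k. \<Sum>j\<le>k. geom_poly v j * v ^ (k - j))"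
  have A: "product_poly v (Suc k) - product_poly v k = v * T k" for k
  proof -
    have "product_poly v (Suc k) = (\<Sum>j\<le>k. v * geom_poly v j * geom_poly v (Suc k - j))"
      by (simp add: product_poly_def)
    also have "\<dots> = (\<Sum>j\<le>k. v * geom_poly v j * geom_poly v (k - j) + v * (geom_poly v j * v ^ (k - j)))"
      by (intro sum.cong refl) (auto simp: Suc_diff_le geom_poly_Suc algebra_simps)
    also have "\<dots> = product_poly v k + v * T k"
      by (simp add: sum.distrib product_poly_def T_def sum_distrib_left)
    finally show ?thesis by simp
  qed
  have T: "T (Suc k) - T k = of_nat (Suc k) * v ^ k"
  proof -
    have "T (Suc k) = (\<Sum>j\<le>k. geom_poly v (Suc j) * v ^ (k - j))"
      unfolding T_def by (subst sum.atMost_Suc_shift) simp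
    also have "\<dots> = (\<Sum>j\<le>k. geom_poly v j * v ^ (k - j) + v ^ k)"
      by (intro sum.cong refl) (auto simp: geom_poly_Suc distrib_right simp flip: power_add)
    also have "\<dots> = T k + of_nat (Suc k) * v ^ k" by (simp add: sum.distrib T_def)
    finally show ?thesis by simp
  qed
  have "product_poly v (Suc (Suc k)) - 2 * product_poly v (Suc k) + product_poly v k
      = (product_poly v (Suc (Suc k)) - product_poly v (Suc k)) - (product_poly v (Suc k) - product_poly v k)"
    by simp
  also have "\<dots> = v * (T (Suc k) - T k)" by (simp add: A right_diff_distrib)
  finally show ?thesis by (simp add: T)
qed

text \<open>Each product is split by the inequality of arithmetic and geometric means, and the
  reflection j to k - j identifies the two sums of squares. Squares can be integrated exactly by
  orthogonality.\<close>

lemma norm_product_poly_le: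
  assumes v: "cmod v = 1"
  shows "cmod (product_poly v k) \<le> (\<Sum>j\<le>k. (cmod (geom_poly v j))\<^sup>2)"
proof -
  have "cmod (product_poly v k) \<le> (\<Sum>j\<le>k. cmod (geom_poly v j) * cmod (geom_poly v (k - j)))"
    unfolding product_poly_def by (rule order_trans[OF norm_sum]) (simp add: norm_mult v)
  also have "\<dots> \<le> (\<Sum>j\<le>k. ((cmod (geom_poly v j))\<^sup>2 + (cmod (geom_poly v (k - j)))\<^sup>2) / 2)"
  proof (rule sum_mono)
    fix j
    show "cmod (geom_poly v j) * cmod (geom_poly v (k - j)) \<le> ((cmod (geom_poly v j))\<^sup>2 + (cmod (geom_poly v (k - j)))\<^sup>2) / 2"
      using sum_squares_bound[of "cmod (geom_poly v j)" "cmod (geom_poly v (k - j))"] by simp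
  qed
  also have "\<dots> = ((\<Sum>j\<le>k. (cmod (geom_poly v j))\<^sup>2) + (\<Sum>j\<le>k. (cmod (geom_poly v (k - j)))\<^sup>2)) / 2"
    by (simp add: sum.distrib sum_divide_distrib[symmetric])
  also have "(\<Sum>j\<le>k. (cmod (geom_poly v (k - j)))\<^sup>2) = (\<Sum>j\<le>k. (cmod (geom_poly v j))\<^sup>2)"
    by (rule sum.reindex_bij_witness[of _ "\<lambda>j. k - j" "\<lambda>j. k - j"]) auto
  finally show ?thesis by simp
qed

text \<open>Crude, but it serves only the boundary terms, where the coefficients decay
  geometrically.\<close>

lemma norm_product_poly_le_cube:
  assumes v: "cmod v = 1"
  shows "cmod (product_poly v k) \<le> (real k + 1) ^ 3"
proof -
  have g: "cmod (geom_poly v j) \<le> real j" for j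
    unfolding geom_poly_def by (rule order_trans[OF norm_sum]) (simp add: norm_power v)
  have "cmod (product_poly v k) \<le> (\<Sum>j\<le>k. (cmod (geom_poly v j))\<^sup>2)" by (rule norm_product_poly_le[OF v])
  also have "\<dots> \<le> (\<Sum>j\<le>k. (real k + 1)\<^sup>2)"
    by (intro sum_mono power_mono) (auto intro: order_trans[OF g])
  also have "\<dots> = (real k + 1) ^ 3" by (simp add: power3_eq_cube power2_eq_square)
  finally show ?thesis .
qed

text \<open>Multiplying S by v changes no modulus and turns the terms into second differences of
  \<open>product_poly\<close>, ready for summation by parts. The bound is an extended sum, so that
  it can be integrated term by term with no convergence to check.\<close>

lemma norm_power_series_le_second_differences:
  fixes b :: "nat \<Rightarrow> real"
  assumes v: "cmod v = 1" and S: "(\<lambda>i. of_real (real (Suc i) * b i) * v ^ i) sums S"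
    and b: "(\<lambda>i. b i * (real i + 2) ^ 3) \<longlonglongrightarrow> 0"
  shows "ennreal (cmod S) \<le> (\<Sum>i. ennreal (\<bar>b i - 2 * b (Suc i) + b (Suc (Suc i))\<bar> * (\<Sum>j\<le>i + 2. (cmod (geom_poly v j))\<^sup>2)))"
proof -
  \<comment> \<open>Shifted by one index so that \<open>E 0 = 0\<close> and \<open>E 1 = v\<close>,
    the boundary values that summation by parts asks for.\<close>
  define E where "E = (\<lambda>i. product_poly v (Suc i))"
  define X where "X = (\<lambda>i. \<bar>b i - 2 * b (Suc i) + b (Suc (Suc i))\<bar> * (\<Sum>j\<le>i + 2. (cmod (geom_poly v j))\<^sup>2))"
  have X0: "0 \<le> X i" for i unfolding X_def by (intro mult_nonneg_nonneg sum_nonneg) auto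
  have E0: "E 0 = 0" "E 1 = v" by (simp_all add: E_def product_poly_def geom_poly_def numeral_2_eq_2)
  \<comment> \<open>A majorant of the two upper boundary terms, from the cubic bound; it tends to 0
    by the assumption on b.\<close>
  define R where "R = (\<lambda>N. \<bar>b N\<bar> * (real N + 3) ^ 3 + \<bar>b (Suc N)\<bar> * (real (Suc N) + 2) ^ 3)"
  have R: "R \<longlonglongrightarrow> 0"
  proof -
    have bb: "(\<lambda>i. \<bar>b i\<bar> * (real i + 2) ^ 3) \<longlonglongrightarrow> 0"
      using tendsto_rabs[OF b] by (simp add: abs_mult)
    have "(\<lambda>i. 8 * (\<bar>b i\<bar> * (real i + 2) ^ 3)) \<longlonglongrightarrow> 8 * 0" by (intro tendsto_mult tendsto_const bb)
    then have g: "(\<lambda>i. 8 * (\<bar>b i\<bar> * (real i + 2) ^ 3)) \<longlonglongrightarrow> 0" by simp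
    have "(\<lambda>i. \<bar>b i\<bar> * (real i + 3) ^ 3) \<longlonglongrightarrow> 0"
    proof (rule Lim_null_comparison[OF always_eventually g], intro allI)
      fix i
      have "(real i + 3) ^ 3 \<le> (2 * (real i + 2)) ^ 3" by (intro power_mono) auto
      also have "\<dots> = 8 * (real i + 2) ^ 3" unfolding power_mult_distrib by simp
      finally have "\<bar>b i\<bar> * (real i + 3) ^ 3 \<le> \<bar>b i\<bar> * (8 * (real i + 2) ^ 3)"
        by (intro mult_left_mono) auto
      then show "norm (\<bar>b i\<bar> * (real i + 3) ^ 3) \<le> 8 * (\<bar>b i\<bar> * (real i + 2) ^ 3)"
        by (simp add: abs_mult)
    qed
    moreover have "(\<lambda>i. \<bar>b (Suc i)\<bar> * (real (Suc i) + 2) ^ 3) \<longlonglongrightarrow> 0"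
      using LIMSEQ_Suc[OF bb] by simp
    ultimately have "R \<longlonglongrightarrow> 0 + 0" unfolding R_def by (rule tendsto_add)
    then show ?thesis by simp
  qed
  have part: "cmod (\<Sum>i<Suc N. of_real (real (Suc i) * b i) * v ^ i) - R N \<le> (\<Sum>i<N. X i)" for N
  proof -
    define c where "c = (\<lambda>i. of_real (b i) :: complex)"
    have "v * (\<Sum>i<Suc N. of_real (real (Suc i) * b i) * v ^ i) = (\<Sum>i<Suc N. c i * (of_nat (Suc i) * v ^ Suc i))"
      unfolding sum_distrib_left c_def by (intro sum.cong refl) (simp add: mult_ac)
    also have "\<dots> = c 0 * v + (\<Sum>i<N. c (Suc i) * (of_nat (Suc (Suc i)) * v ^ Suc (Suc i)))"
      unfolding sum.lessThan_Suc_shift by simp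
    also have "\<dots> = c 0 * E 1 + (\<Sum>i<N. c (Suc i) * (E (Suc (Suc i)) - 2 * E (Suc i) + E i))"
      unfolding E0(2) by (simp only: E_def product_poly_second_difference)
    also have "\<dots> = (\<Sum>i<N. (c i - 2 * c (Suc i) + c (Suc (Suc i))) * E (Suc i)) + c N * E (Suc N) - c (Suc N) * E N"
      by (rule double_summation_by_parts[where E = E, OF E0(1), symmetric])
    finally have eq: "v * (\<Sum>i<Suc N. of_real (real (Suc i) * b i) * v ^ i)
      = (\<Sum>i<N. (c i - 2 * c (Suc i) + c (Suc (Suc i))) * E (Suc i)) + c N * E (Suc N) - c (Suc N) * E N" .
    have "cmod (\<Sum>i<Suc N. of_real (real (Suc i) * b i) * v ^ i) = cmod (v * (\<Sum>i<Suc N. of_real (real (Suc i) * b i) * v ^ i))"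
      by (simp add: norm_mult v)
    also have "\<dots> \<le> cmod (\<Sum>i<N. (c i - 2 * c (Suc i) + c (Suc (Suc i))) * E (Suc i)) + cmod (c N * E (Suc N)) + cmod (c (Suc N) * E N)"
      unfolding eq by (intro order_trans[OF norm_triangle_ineq4] add_right_mono norm_triangle_ineq)
    also have "\<dots> \<le> (\<Sum>i<N. X i) + \<bar>b N\<bar> * (real N + 3) ^ 3 + \<bar>b (Suc N)\<bar> * (real (Suc N) + 2) ^ 3"
    proof (intro add_mono)
      have "cmod ((c i - 2 * c (Suc i) + c (Suc (Suc i))) * E (Suc i)) \<le> X i" for i
      proof -
        have "c i - 2 * c (Suc i) + c (Suc (Suc i)) = of_real (b i - 2 * b (Suc i) + b (Suc (Suc i)))"
          by (simp add: c_def)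
        then have "cmod (c i - 2 * c (Suc i) + c (Suc (Suc i))) = \<bar>b i - 2 * b (Suc i) + b (Suc (Suc i))\<bar>"
          by (simp only: norm_of_real)
        moreover have "cmod (E (Suc i)) \<le> (\<Sum>j\<le>i + 2. (cmod (geom_poly v j))\<^sup>2)"
          using norm_product_poly_le[OF v, of "Suc (Suc i)"] by (simp add: E_def)
        ultimately show ?thesis unfolding norm_mult X_def by (simp add: mult_left_mono)
      qed
      then show "cmod (\<Sum>i<N. (c i - 2 * c (Suc i) + c (Suc (Suc i))) * E (Suc i)) \<le> (\<Sum>i<N. X i)"
        by (intro order_trans[OF norm_sum] sum_mono)
      show "cmod (c N * E (Suc N)) \<le> \<bar>b N\<bar> * (real N + 3) ^ 3"
        using norm_product_poly_le_cube[OF v, of "Suc (Suc N)"]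
        by (simp add: c_def norm_mult E_def add.commute mult_left_mono)
      have "cmod (E N) \<le> (real N + 2) ^ 3"
        using norm_product_poly_le_cube[OF v, of "Suc N"] by (simp add: E_def add.commute)
      also have "\<dots> \<le> (real (Suc N) + 2) ^ 3" by (intro power_mono) auto
      finally show "cmod (c (Suc N) * E N) \<le> \<bar>b (Suc N)\<bar> * (real (Suc N) + 2) ^ 3"
        by (simp add: c_def norm_mult mult_left_mono)
    qed
    finally show ?thesis by (simp add: R_def)
  qed
  have lim: "(\<lambda>N. ennreal (cmod (\<Sum>i<Suc N. of_real (real (Suc i) * b i) * v ^ i) - R N)) \<longlonglongrightarrow> ennreal (cmod S - 0)"
    using S R unfolding sums_def by (intro tendsto_ennrealI tendsto_diff tendsto_norm LIMSEQ_Suc)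
  have "ennreal (cmod S - 0) \<le> (\<Sum>i. ennreal (X i))"
  proof (rule LIMSEQ_le_const2[OF lim], intro exI allI impI)
    fix N
    have "ennreal (cmod (\<Sum>i<Suc N. of_real (real (Suc i) * b i) * v ^ i) - R N) \<le> ennreal (\<Sum>i<N. X i)"
      by (intro ennreal_leI part)
    also have "\<dots> = (\<Sum>i<N. ennreal (X i))" using X0 by (simp add: sum_ennreal)
    also have "\<dots> \<le> (\<Sum>i. ennreal (X i))" by (intro sum_le_suminf) auto
    finally show "ennreal (cmod (\<Sum>i<Suc N. of_real (real (Suc i) * b i) * v ^ i) - R N) \<le> (\<Sum>i. ennreal (X i))" .
  qed
  then show ?thesis by (simp add: X_def)
qed

section \<open>Differences of moments and of reciprocal moments\<close>

lemma power_times_one_minus_le: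
  fixes r :: real
  assumes "0 \<le> r" "r \<le> 1"
  shows "(1 - r) * r ^ n \<le> 1 / real (Suc n)"
proof -
  \<comment> \<open>Comparing n + 1 copies of the smallest term with the geometric sum: this is the
    exchange rate at which a factor 1 - r buys 1/(n+1) for n powers of r.\<close>
  have "real (Suc n) * r ^ n = (\<Sum>k<Suc n. r ^ n)" by simp
  also have "\<dots> \<le> (\<Sum>k<Suc n. r ^ k)" using assms by (intro sum_mono power_decreasing) auto
  finally have "(1 - r) * (real (Suc n) * r ^ n) \<le> (1 - r) * (\<Sum>k<Suc n. r ^ k)"
    using assms by (intro mult_left_mono) auto
  also have "\<dots> = 1 - r ^ Suc n" by (rule one_diff_power_eq[symmetric])
  also have "\<dots> \<le> 1" using assms by simp
  finally show ?thesis by (simp add: field_simps)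
qed

text \<open>Order 0 is excluded so that the integrands agree at r = 0 too, where \<open>powr\<close>
  gives 0 and \<open>^\<close> gives 1.\<close>

lemma rmoment_nat:
  assumes \<omega>: "radial_weight \<omega>" and n: "1 \<le> n"
  shows "integrable lebesgue (\<lambda>r. r ^ n * (\<omega> r * indicator {0..<1} r))"
    and "rmoment \<omega> (real n) = (LINT r|lebesgue. r ^ n * (\<omega> r * indicator {0..<1} r))"
proof -
  have wi: "integrable lebesgue (\<lambda>r. \<omega> r * indicator {0..<1} r)"
    using \<omega> by (simp add: radial_weight_def set_integrable_def mult.commute)
  show int: "integrable lebesgue (\<lambda>r. r ^ n * (\<omega> r * indicator {0..<1} r))"
  proof (rule Bochner_Integration.integrable_bound[OF wi])
    have "(\<lambda>r::real. r ^ n) \<in> borel_measurable lebesgue" by (rule measurable_completion) measurable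
    then show "(\<lambda>r. r ^ n * (\<omega> r * indicator {0..<1} r)) \<in> borel_measurable lebesgue"
      by (intro borel_measurable_times radial_weight_measurable[OF \<omega>])
    show "AE r in lebesgue. norm (r ^ n * (\<omega> r * indicator {0..<1} r)) \<le> norm (\<omega> r * indicator {0..<1} r)"
      by (intro AE_I2) (auto simp: abs_mult power_le_one mult_left_le_one_le split: split_indicator)
  qed
  have nonneg: "0 \<le> r ^ n * (\<omega> r * indicator {0..<1} r)" for r
    using radial_weight_nonneg[OF \<omega>, of r] by (auto split: split_indicator)
  have "moment \<omega> (real n) = (\<integral>\<^sup>+r. ennreal (r ^ n * (\<omega> r * indicator {0..<1} r)) \<partial>lebesgue)"
    unfolding moment_def
  proof (rule nn_integral_cong)
    fix r :: real
    show "ennreal (r powr real n * \<omega> r) * indicator {0..<1} r = ennreal (r ^ n * (\<omega> r * indicator {0..<1} r))"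
      using n by (cases "r = 0") (auto simp: powr_realpow power_0_left split: split_indicator)
  qed
  also have "\<dots> = ennreal (LINT r|lebesgue. r ^ n * (\<omega> r * indicator {0..<1} r))"
    using int nonneg by (intro nn_integral_eq_integral AE_I2) auto
  finally show "rmoment \<omega> (real n) = (LINT r|lebesgue. r ^ n * (\<omega> r * indicator {0..<1} r))"
    using nonneg by (simp add: rmoment_def integral_nonneg_AE)
qed

lemma rmoment_doubling:
  assumes \<omega>d: "doubling_weight \<omega>"
  shows "\<exists>C\<ge>1. \<forall>x y. 0 \<le> x \<longrightarrow> x \<le> y \<longrightarrow> y + 1 \<le> 8 * (x + 1) \<longrightarrow> rmoment \<omega> x \<le> C * rmoment \<omega> y"
proof -
  note \<omega> = doubling_weight_radial[OF \<omega>d]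
  obtain A where A: "A > 0" "\<And>x. 0 \<le> x \<Longrightarrow> rmoment \<omega> x \<le> A * tail \<omega> (x / (x + 1))"
    using rmoment_le_tail_doubling[OF \<omega>d] by blast
  obtain B where B: "B > 0" "\<And>x y. 0 \<le> x \<Longrightarrow> x \<le> y \<Longrightarrow> y + 1 \<le> 8 * (x + 1) \<Longrightarrow> tail \<omega> (x / (x + 1)) \<le> B * rmoment \<omega> y"
    using tail_le_rmoment_doubling[OF \<omega>d] by blast
  have "rmoment \<omega> x \<le> max 1 (A * B) * rmoment \<omega> y" if xy: "0 \<le> x" "x \<le> y" "y + 1 \<le> 8 * (x + 1)" for x y
  proof -
    have "rmoment \<omega> x \<le> A * (B * rmoment \<omega> y)"
      using A(2)[of x] B(2)[OF xy] A(1) xy by (meson mult_left_mono less_imp_le order_trans)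
    also have "\<dots> \<le> max 1 (A * B) * rmoment \<omega> y"
      unfolding mult.assoc[symmetric] by (intro mult_right_mono) (auto simp: rmoment_def)
    finally show ?thesis .
  qed
  then show ?thesis by (intro exI[of _ "max 1 (A * B)"]) auto
qed

text \<open>Differences of odd moments are integrals of \<open>r ^ (2 * n + 1)\<close> times
  \<open>1 - r\<^sup>2\<close> or its square. About half of the power of r is spent on turning each
  factor 1 - r into 1/(n+1); what is left is a moment of order n + 1, comparable with the original
  one under doubling.\<close>

lemma odd_moment_differences:
  fixes \<omega> :: "real \<Rightarrow> real"
  defines "M \<equiv> \<lambda>n::nat. rmoment \<omega> (2 * real n + 1)"
  assumes \<omega>: "radial_weight \<omega>"
  shows "0 \<le> M n - M (Suc n)"
    and "M n - M (Suc n) \<le> 2 / (real n + 1) * rmoment \<omega> (real n + 1)"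
    and "0 \<le> M n - 2 * M (Suc n) + M (Suc (Suc n))"
    and "M n - 2 * M (Suc n) + M (Suc (Suc n)) \<le> 16 / (real n + 1)\<^sup>2 * rmoment \<omega> (real n + 1)"
proof -
  define u where "u = (\<lambda>r. \<omega> r * indicator {0..<1::real} r)"
  have u0: "0 \<le> u r" for r using radial_weight_nonneg[OF \<omega>, of r] by (auto simp: u_def split: split_indicator)
  have uz: "u r = 0" if "\<not> (0 \<le> r \<and> r < 1)" for r using that by (auto simp: u_def)
  have int: "integrable lebesgue (\<lambda>r. r ^ n * u r)" if "1 \<le> n" for n
    unfolding u_def by (rule rmoment_nat(1)[OF \<omega> that])
  have M: "M n = (LINT r|lebesgue. r ^ (2 * n + 1) * u r)" for n
    using rmoment_nat(2)[OF \<omega>, of "2 * n + 1"] by (simp add: M_def u_def add.commute)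
  have d: "M n - M (Suc n) = (LINT r|lebesgue. r ^ (2 * n + 1) * u r - r ^ (2 * n + 3) * u r)"
    using int[of "2 * n + 1"] int[of "2 * n + 3"] by (subst Bochner_Integration.integral_diff) (auto simp: M numeral_eq_Suc)
  have e: "M n - 2 * M (Suc n) + M (Suc (Suc n))
      = (LINT r|lebesgue. r ^ (2 * n + 1) * u r - 2 * (r ^ (2 * n + 3) * u r) + r ^ (2 * n + 5) * u r)"
    using int[of "2 * n + 1"] int[of "2 * n + 3"] int[of "2 * n + 5"]
    by (subst Bochner_Integration.integral_add) (auto simp: M numeral_eq_Suc)
  have R: "c * rmoment \<omega> (real n + 1) = (LINT r|lebesgue. c * (r ^ (n + 1) * u r))" for c
    using rmoment_nat(2)[OF \<omega>, of "n + 1"] by (simp add: u_def add.commute)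
  have deq: "r ^ (2 * n + 1) * u r - r ^ (2 * n + 3) * u r = r ^ (2 * n + 1) * (1 - r\<^sup>2) * u r" for r
    by (simp add: algebra_simps power_add numeral_eq_Suc)
  have eeq: "r ^ (2 * n + 1) * u r - 2 * (r ^ (2 * n + 3) * u r) + r ^ (2 * n + 5) * u r = r ^ (2 * n + 1) * (1 - r\<^sup>2)\<^sup>2 * u r" for r
    by (simp add: algebra_simps power_add numeral_eq_Suc)
  have s: "0 \<le> 1 - r\<^sup>2" "1 - r\<^sup>2 \<le> 2 * (1 - r)" if "0 \<le> r \<and> r < 1" for r :: real
  proof -
    have "1 - r\<^sup>2 = (1 + r) * (1 - r)" by (simp add: power2_eq_square algebra_simps)
    moreover have "(1 + r) * (1 - r) \<le> 2 * (1 - r)" using that by (intro mult_right_mono) auto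
    ultimately show "0 \<le> 1 - r\<^sup>2" "1 - r\<^sup>2 \<le> 2 * (1 - r)" using that by auto
  qed
  show "0 \<le> M n - M (Suc n)"
    unfolding d deq using s u0 uz
    by (intro integral_nonneg_AE AE_I2) (metis mult_nonneg_nonneg mult_zero_right order_refl zero_le_power)
  show "0 \<le> M n - 2 * M (Suc n) + M (Suc (Suc n))"
    unfolding e eeq using u0 uz
    by (intro integral_nonneg_AE AE_I2) (metis mult_nonneg_nonneg mult_zero_right order_refl zero_le_power zero_le_power2)
  show "M n - M (Suc n) \<le> 2 / (real n + 1) * rmoment \<omega> (real n + 1)"
    unfolding d R
  proof (rule integral_mono)
    show "integrable lebesgue (\<lambda>r. r ^ (2 * n + 1) * u r - r ^ (2 * n + 3) * u r)"
      by (intro Bochner_Integration.integrable_diff int) auto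
    show "integrable lebesgue (\<lambda>r. 2 / (real n + 1) * (r ^ (n + 1) * u r))"
      by (intro integrable_mult_right int) auto
    fix r :: real
    show "r ^ (2 * n + 1) * u r - r ^ (2 * n + 3) * u r \<le> 2 / (real n + 1) * (r ^ (n + 1) * u r)"
    proof (cases "0 \<le> r \<and> r < 1")
      case True
      have "r ^ (2 * n + 1) * (1 - r\<^sup>2) \<le> r ^ (2 * n + 1) * (2 * (1 - r))"
        using s(2)[OF True] True by (intro mult_left_mono) auto
      also have "\<dots> = 2 * ((1 - r) * r ^ n) * r ^ (n + 1)"
      proof -
        have "r ^ (2 * n + 1) = r ^ n * r ^ (n + 1)" by (simp add: mult_2 flip: power_add)
        then show ?thesis by (simp only: mult_ac)
      qed
      also have "\<dots> \<le> 2 * (1 / real (Suc n)) * r ^ (n + 1)"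
        using power_times_one_minus_le[of r n] True by (intro mult_right_mono mult_left_mono) auto
      finally have "r ^ (2 * n + 1) * (1 - r\<^sup>2) * u r \<le> 2 * (1 / real (Suc n)) * r ^ (n + 1) * u r"
        using u0 by (rule mult_right_mono)
      then show ?thesis unfolding deq by (simp add: add.commute mult.assoc)
    qed (simp add: uz)
  qed
  show "M n - 2 * M (Suc n) + M (Suc (Suc n)) \<le> 16 / (real n + 1)\<^sup>2 * rmoment \<omega> (real n + 1)"
    unfolding e R
  proof (rule integral_mono)
    show "integrable lebesgue (\<lambda>r. r ^ (2 * n + 1) * u r - 2 * (r ^ (2 * n + 3) * u r) + r ^ (2 * n + 5) * u r)"
      by (intro Bochner_Integration.integrable_diff Bochner_Integration.integrable_add integrable_mult_right int) auto
    show "integrable lebesgue (\<lambda>r. 16 / (real n + 1)\<^sup>2 * (r ^ (n + 1) * u r))"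
      by (intro integrable_mult_right int) auto
    fix r :: real
    show "r ^ (2 * n + 1) * u r - 2 * (r ^ (2 * n + 3) * u r) + r ^ (2 * n + 5) * u r \<le> 16 / (real n + 1)\<^sup>2 * (r ^ (n + 1) * u r)"
    proof (cases "0 \<le> r \<and> r < 1")
      case True
      \<comment> \<open>Two factors 1 - r have to be absorbed, so each receives \<open>r ^ p\<close>
        with p about n/2. The constant 16 is 4 from \<open>1 - r\<^sup>2 \<le> 2 * (1 - r)\<close>
        squared, times 4 from the halving of n.\<close>
      define p where "p = n div 2"
      have p: "2 * p \<le> n" "n + 1 \<le> 2 * (p + 1)" unfolding p_def by presburger+
      have "real (n + 1) \<le> real (2 * (p + 1))" using p(2) by (simp only: of_nat_le_iff)
      then have p': "real n + 1 \<le> 2 * (real p + 1)" by simp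
      have "r ^ (2 * n + 1) * (1 - r\<^sup>2)\<^sup>2 \<le> r ^ (2 * n + 1) * (2 * (1 - r))\<^sup>2"
        using s[OF True] True by (intro mult_left_mono power_mono) auto
      also have "\<dots> \<le> r ^ (n + 1 + 2 * p) * (2 * (1 - r))\<^sup>2"
        using True p by (intro mult_right_mono power_decreasing) auto
      also have "r ^ (n + 1 + 2 * p) = (r ^ p)\<^sup>2 * r ^ (n + 1)" by (simp add: mult.commute flip: power_add power_mult)
      also have "(r ^ p)\<^sup>2 * r ^ (n + 1) * (2 * (1 - r))\<^sup>2 = 4 * ((1 - r) * r ^ p)\<^sup>2 * r ^ (n + 1)"
        unfolding power_mult_distrib by simp
      also have "\<dots> \<le> 4 * (1 / real (Suc p))\<^sup>2 * r ^ (n + 1)"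
        using power_times_one_minus_le[of r p] True by (intro mult_right_mono mult_left_mono power_mono) auto
      also have "\<dots> \<le> 4 * (2 / (real n + 1))\<^sup>2 * r ^ (n + 1)"
        using p' True by (intro mult_right_mono mult_left_mono power_mono) (auto simp: field_simps)
      also have "4 * (2 / (real n + 1))\<^sup>2 = 16 / (real n + 1)\<^sup>2" by (simp add: power_divide)
      finally have "r ^ (2 * n + 1) * (1 - r\<^sup>2)\<^sup>2 * u r \<le> 16 / (real n + 1)\<^sup>2 * r ^ (n + 1) * u r"
        using u0 by (rule mult_right_mono)
      then show ?thesis unfolding eeq by (simp add: mult.assoc)
    qed (simp add: uz)
  qed
qed

text \<open>Second difference of \<open>\<rho> ^ i\<close> times reciprocal moments, with the common
  power divided out. M1, M2, M3 stand for consecutive odd moments, x for the size of their order, C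
  for the doubling constant. The term in \<open>1 - \<rho>\<close> is not yet small; the power
  divided out will absorb it.\<close>

lemma weighted_second_difference_bound:
  fixes M1 M2 M3 \<rho> C x :: real
  assumes M: "0 < M3" "M3 \<le> M2" "M2 \<le> M1" "M1 \<le> C * M3" and C: "1 \<le> C" and x: "1 \<le> x"
    and \<rho>: "0 \<le> \<rho>" "\<rho> \<le> 1"
    and d: "M1 - M2 \<le> 2 * C / x * M3" and e: "0 \<le> M1 - 2 * M2 + M3" "M1 - 2 * M2 + M3 \<le> 16 * C / x\<^sup>2 * M3"
  shows "\<bar>1 / M1 - 2 * \<rho> * (1 / M2) + \<rho>\<^sup>2 * (1 / M3)\<bar> \<le> 48 * C\<^sup>2 / M1 * (1 / x\<^sup>2 + (1 - \<rho>)\<^sup>2)"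
proof -
  define d1 d2 ee where "d1 = M1 - M2" and "d2 = M2 - M3" and "ee = M1 - 2 * M2 + M3"
  have p: "0 < M1" "0 < M2" using M by auto
  have C2: "C \<le> C\<^sup>2" using C by (simp add: power2_eq_square)
  have d12: "0 \<le> d2" "d2 \<le> d1" "d1 \<le> 2 * C / x * M3" "0 \<le> ee" "ee \<le> 16 * C / x\<^sup>2 * M3"
    using M d e by (auto simp: d1_def d2_def ee_def)
  have m3: "1 / M3 \<le> C / M1" using M p by (simp add: field_simps)
  have m2: "1 / M2 \<le> C / M1"
    using M p C by (intro order_trans[OF _ m3]) (auto simp: field_simps)
  \<comment> \<open>A discrete Leibniz rule: both differences on the reciprocals, one on each
    factor, both on the power of \<open>\<rho>\<close>.\<close>
  have split: "1 / M1 - 2 * \<rho> * (1 / M2) + \<rho>\<^sup>2 * (1 / M3)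
      = (1 / M1 - 2 * (1 / M2) + 1 / M3) + 2 * (1 - \<rho>) * (1 / M2 - 1 / M3) + (1 - \<rho>)\<^sup>2 * (1 / M3)"
    by (simp add: power2_eq_square algebra_simps)
  have t1: "\<bar>1 / M1 - 2 * (1 / M2) + 1 / M3\<bar> \<le> 24 * C\<^sup>2 / x\<^sup>2 / M1"
  proof -
    have "1 / M1 - 2 * (1 / M2) + 1 / M3 = (d2 * (d1 + d2) - ee * M3) / (M1 * M2 * M3)"
      using p M(1) by (simp add: d1_def d2_def ee_def field_simps)
    also have "\<bar>\<dots>\<bar> = \<bar>d2 * (d1 + d2) - ee * M3\<bar> / (M1 * M2 * M3)" using p M(1) by (simp add: abs_mult)
    also have "\<dots> \<le> (24 * C\<^sup>2 / x\<^sup>2 * M3 * M3) / (M1 * M2 * M3)"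
    proof (rule divide_right_mono)
      have "d2 * (d1 + d2) \<le> d1 * (d1 + d1)" using d12 by (intro mult_mono) auto
      also have "\<dots> = 2 * d1\<^sup>2" by (simp add: power2_eq_square)
      also have "\<dots> \<le> 2 * (2 * C / x * M3)\<^sup>2" using d12 by (intro mult_left_mono power_mono) auto
      also have "\<dots> = 8 * C\<^sup>2 / x\<^sup>2 * M3 * M3" by (simp add: power2_eq_square)
      finally have a: "d2 * (d1 + d2) \<le> 8 * C\<^sup>2 / x\<^sup>2 * M3 * M3" .
      have "ee * M3 \<le> 16 * C / x\<^sup>2 * M3 * M3" using d12 M(1) by (intro mult_right_mono) auto
      also have "\<dots> \<le> 16 * C\<^sup>2 / x\<^sup>2 * M3 * M3"
        using C2 M(1) x by (intro mult_right_mono divide_right_mono) auto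
      finally have b: "ee * M3 \<le> 16 * C\<^sup>2 / x\<^sup>2 * M3 * M3" .
      have "0 \<le> d2 * (d1 + d2)" "0 \<le> ee * M3" using d12 M(1) by auto
      moreover have "\<bar>p - q\<bar> \<le> p' + q'" if "0 \<le> p" "0 \<le> q" "p \<le> p'" "q \<le> q'" for p q p' q' :: real
        using that by linarith
      ultimately have "\<bar>d2 * (d1 + d2) - ee * M3\<bar> \<le> 8 * C\<^sup>2 / x\<^sup>2 * M3 * M3 + 16 * C\<^sup>2 / x\<^sup>2 * M3 * M3"
        using a b by blast
      then show "\<bar>d2 * (d1 + d2) - ee * M3\<bar> \<le> 24 * C\<^sup>2 / x\<^sup>2 * M3 * M3" by (simp add: field_simps)
    qed (use p M(1) in auto)
    also have "\<dots> = 24 * C\<^sup>2 / x\<^sup>2 / M1 * (M3 / M2)" using p M(1) by (simp add: field_simps)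
    also have "\<dots> \<le> 24 * C\<^sup>2 / x\<^sup>2 / M1 * 1"
      using p M x by (intro mult_left_mono) auto
    finally show ?thesis by simp
  qed
  have t2: "\<bar>2 * (1 - \<rho>) * (1 / M2 - 1 / M3)\<bar> \<le> 4 * C\<^sup>2 / M1 * ((1 - \<rho>) / x)"
  proof -
    have "\<bar>1 / M2 - 1 / M3\<bar> = d2 / M3 * (1 / M2)"
      using p M(1,2) by (simp add: d2_def field_simps abs_if)
    also have "\<dots> \<le> (2 * C / x) * (C / M1)"
    proof (intro mult_mono m2)
      show "d2 / M3 \<le> 2 * C / x"
        unfolding pos_divide_le_eq[OF M(1)] using d12(2,3) by (rule order_trans)
    qed (use p C x in auto)
    finally have "2 * (1 - \<rho>) * \<bar>1 / M2 - 1 / M3\<bar> \<le> 2 * (1 - \<rho>) * ((2 * C / x) * (C / M1))"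
      using \<rho> by (intro mult_left_mono) auto
    then show ?thesis using \<rho> by (simp add: abs_mult power2_eq_square mult_ac)
  qed
  have t3: "\<bar>(1 - \<rho>)\<^sup>2 * (1 / M3)\<bar> \<le> C\<^sup>2 / M1 * (1 - \<rho>)\<^sup>2"
  proof -
    have "1 / M3 \<le> C\<^sup>2 / M1" using m3 C2 p by (meson divide_right_mono less_imp_le order_trans)
    then have "(1 - \<rho>)\<^sup>2 * (1 / M3) \<le> (1 - \<rho>)\<^sup>2 * (C\<^sup>2 / M1)" by (intro mult_left_mono) auto
    then show ?thesis using M(1) by (simp add: abs_mult mult.commute)
  qed
  \<comment> \<open>The mixed term is dominated by the mean of the two pure ones.\<close>
  have am: "(1 - \<rho>) / x \<le> (1 / x\<^sup>2 + (1 - \<rho>)\<^sup>2) / 2"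
  proof -
    have "2 * (1 / x) * (1 - \<rho>) \<le> 1 / x\<^sup>2 + (1 - \<rho>)\<^sup>2"
      using sum_squares_bound[of "1 / x" "1 - \<rho>"] by (simp only: power_one_over)
    moreover have "2 * (1 / x) * (1 - \<rho>) = 2 * ((1 - \<rho>) / x)" by simp
    ultimately have "2 * ((1 - \<rho>) / x) \<le> 1 / x\<^sup>2 + (1 - \<rho>)\<^sup>2" by (simp only:)
    then show ?thesis by (simp only: pos_le_divide_eq mult.commute zero_less_numeral)
  qed
  have "\<bar>1 / M1 - 2 * \<rho> * (1 / M2) + \<rho>\<^sup>2 * (1 / M3)\<bar>
      \<le> 24 * C\<^sup>2 / x\<^sup>2 / M1 + 4 * C\<^sup>2 / M1 * ((1 - \<rho>) / x) + C\<^sup>2 / M1 * (1 - \<rho>)\<^sup>2"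
    unfolding split using t1 t2 t3 by linarith
  also have "\<dots> = C\<^sup>2 / M1 * (24 * (1 / x\<^sup>2) + 4 * ((1 - \<rho>) / x) + (1 - \<rho>)\<^sup>2)"
  proof -
    have "24 * C\<^sup>2 / x\<^sup>2 / M1 = C\<^sup>2 / M1 * (24 * (1 / x\<^sup>2))"
      "4 * C\<^sup>2 / M1 * ((1 - \<rho>) / x) = C\<^sup>2 / M1 * (4 * ((1 - \<rho>) / x))" by (simp_all add: mult.commute)
    then show ?thesis by (simp only: distrib_left)
  qed
  also have "\<dots> \<le> C\<^sup>2 / M1 * (48 * (1 / x\<^sup>2 + (1 - \<rho>)\<^sup>2))"
  proof (rule mult_left_mono)
    have "24 * p + 4 * q + s \<le> 48 * (p + s)" if "0 \<le> p" "0 \<le> s" "q \<le> (p + s) / 2" for p q s :: real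
      using that by (simp add: field_simps)
    from this[OF _ _ am] show "24 * (1 / x\<^sup>2) + 4 * ((1 - \<rho>) / x) + (1 - \<rho>)\<^sup>2 \<le> 48 * (1 / x\<^sup>2 + (1 - \<rho>)\<^sup>2)"
      by simp
  qed (use p in auto)
  finally show ?thesis by (simp add: mult_ac)
qed

text \<open>The two factors \<open>1 - \<rho>\<close> are paid with
  \<open>\<rho> ^ (i div 4)\<close> each, and \<open>\<rho> ^ (i div 2)\<close> survives for the
  radial integration. The constant 65 is 1 for the first summand plus the square of 8, from
  \<open>real i + 2 \<le> 8 * (real p + 1)\<close>.\<close>

lemma power_times_square_le:
  fixes \<rho> :: real
  assumes \<rho>: "0 \<le> \<rho>" "\<rho> \<le> 1"
  shows "\<rho> ^ i * (1 / (real i + 2)\<^sup>2 + (1 - \<rho>)\<^sup>2) \<le> 65 / (real i + 2)\<^sup>2 * \<rho> ^ (i div 2)"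
proof -
  define p where "p = i div 4"
  have p: "2 * p + i div 2 \<le> i" unfolding p_def by linarith
  have p2: "real i + 2 \<le> 8 * (real p + 1)"
  proof -
    have "i + 2 \<le> 8 * (p + 1)" unfolding p_def by presburger
    then have "real (i + 2) \<le> real (8 * (p + 1))" by (simp only: of_nat_le_iff)
    then show ?thesis by simp
  qed
  have "\<rho> ^ i * (1 - \<rho>)\<^sup>2 \<le> \<rho> ^ (2 * p + i div 2) * (1 - \<rho>)\<^sup>2"
    using \<rho> p by (intro mult_right_mono power_decreasing) auto
  also have "\<rho> ^ (2 * p + i div 2) = (\<rho> ^ p)\<^sup>2 * \<rho> ^ (i div 2)" by (simp add: mult.commute flip: power_add power_mult)
  also have "(\<rho> ^ p)\<^sup>2 * \<rho> ^ (i div 2) * (1 - \<rho>)\<^sup>2 = ((1 - \<rho>) * \<rho> ^ p)\<^sup>2 * \<rho> ^ (i div 2)"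
    unfolding power_mult_distrib by simp
  also have "\<dots> \<le> (1 / real (Suc p))\<^sup>2 * \<rho> ^ (i div 2)"
    using power_times_one_minus_le[of \<rho> p] \<rho> by (intro mult_right_mono power_mono) auto
  also have "\<dots> \<le> (8 / (real i + 2))\<^sup>2 * \<rho> ^ (i div 2)"
    using p2 \<rho> by (intro mult_right_mono power_mono) (auto simp: field_simps)
  finally have a: "\<rho> ^ i * (1 - \<rho>)\<^sup>2 \<le> 64 / (real i + 2)\<^sup>2 * \<rho> ^ (i div 2)" by (simp add: power_divide)
  have "\<rho> ^ i * (1 / (real i + 2)\<^sup>2) \<le> \<rho> ^ (i div 2) * (1 / (real i + 2)\<^sup>2)"
    using \<rho> by (intro mult_right_mono power_decreasing) auto
  then have "\<rho> ^ i * (1 / (real i + 2)\<^sup>2 + (1 - \<rho>)\<^sup>2)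
      \<le> \<rho> ^ (i div 2) * (1 / (real i + 2)\<^sup>2) + 64 / (real i + 2)\<^sup>2 * \<rho> ^ (i div 2)"
    unfolding distrib_left using a by (rule add_mono)
  also have "q * (1 / y) + 64 / y * q = 65 / y * q" for q y :: real
    by (cases "y = 0") (simp_all add: field_simps)
  finally show ?thesis .
qed

lemma kernel_second_difference_bound:
  assumes \<omega>d: "doubling_weight \<omega>"
  shows "\<exists>C>0. \<forall>i \<rho>. 0 \<le> \<rho> \<longrightarrow> \<rho> \<le> 1 \<longrightarrow>
    \<bar>\<rho> ^ i * kernel_coeff \<omega> (Suc i) - 2 * (\<rho> ^ Suc i * kernel_coeff \<omega> (Suc (Suc i))) + \<rho> ^ Suc (Suc i) * kernel_coeff \<omega> (Suc (Suc (Suc i)))\<bar>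
      \<le> C / (rmoment \<omega> (2 * real i + 3) * (real i + 2)\<^sup>2) * \<rho> ^ (i div 2)"
proof -
  note \<omega> = doubling_weight_radial[OF \<omega>d]
  obtain C where C: "1 \<le> C" "\<And>x y. 0 \<le> x \<Longrightarrow> x \<le> y \<Longrightarrow> y + 1 \<le> 8 * (x + 1) \<Longrightarrow> rmoment \<omega> x \<le> C * rmoment \<omega> y"
    using rmoment_doubling[OF \<omega>d] by blast
  define M where "M = (\<lambda>n::nat. rmoment \<omega> (2 * real n + 1))"
  have M_eq: "rmoment \<omega> (2 * real n + 1) = M n" for n by (simp add: M_def)
  note diff = odd_moment_differences[OF \<omega>, unfolded M_eq]
  have Mpos: "0 < M n" for n unfolding M_def by (rule rmoment_pos[OF \<omega>]) simp
  show ?thesis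
  proof (intro exI conjI allI impI)
    \<comment> \<open>24 is half of 48, because of the 2 in the denominator of
      \<open>kernel_coeff\<close>; 65 comes from absorbing \<open>1 - \<rho>\<close>.\<close>
    show "0 < 24 * 65 * C\<^sup>2" using C(1) by simp
    fix i :: nat and \<rho> :: real assume \<rho>: "0 \<le> \<rho>" "\<rho> \<le> 1"
    define M1 M2 M3 where "M1 = M (Suc i)" and "M2 = M (Suc (Suc i))" and "M3 = M (Suc (Suc (Suc i)))"
    define x where "x = real i + 2"
    have R: "rmoment \<omega> (real (Suc i) + 1) \<le> C * M3"
      unfolding M3_def M_def by (rule C(2)) auto
    have b: "\<bar>1 / M1 - 2 * \<rho> * (1 / M2) + \<rho>\<^sup>2 * (1 / M3)\<bar> \<le> 48 * C\<^sup>2 / M1 * (1 / x\<^sup>2 + (1 - \<rho>)\<^sup>2)"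
    proof (rule weighted_second_difference_bound[OF _ _ _ _ C(1) _ \<rho>])
      show "0 < M3" by (simp add: M3_def Mpos)
      show "M3 \<le> M2" "M2 \<le> M1" using diff(1)[of "Suc i"] diff(1)[of "Suc (Suc i)"] by (auto simp: M1_def M2_def M3_def)
      show "M1 \<le> C * M3" unfolding M1_def M3_def M_def by (rule C(2)) auto
      show "1 \<le> x" by (simp add: x_def)
      have "M1 - M2 \<le> 2 / (real (Suc i) + 1) * rmoment \<omega> (real (Suc i) + 1)"
        using diff(2)[of "Suc i"] by (simp add: M1_def M2_def)
      also have "\<dots> \<le> 2 / (real (Suc i) + 1) * (C * M3)" by (intro mult_left_mono R) auto
      finally show "M1 - M2 \<le> 2 * C / x * M3" by (simp add: x_def add.commute)
      show "0 \<le> M1 - 2 * M2 + M3" using diff(3)[of "Suc i"] by (simp add: M1_def M2_def M3_def)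
      have "M1 - 2 * M2 + M3 \<le> 16 / (real (Suc i) + 1)\<^sup>2 * rmoment \<omega> (real (Suc i) + 1)"
        using diff(4)[of "Suc i"] by (simp add: M1_def M2_def M3_def)
      also have "\<dots> \<le> 16 / (real (Suc i) + 1)\<^sup>2 * (C * M3)" by (intro mult_left_mono R) auto
      finally show "M1 - 2 * M2 + M3 \<le> 16 * C / x\<^sup>2 * M3" by (simp add: x_def add.commute)
    qed
    have k: "kernel_coeff \<omega> n = 1 / 2 * (1 / M n)" for n by (simp add: kernel_coeff_def M_def)
    have "\<rho> ^ i * kernel_coeff \<omega> (Suc i) - 2 * (\<rho> ^ Suc i * kernel_coeff \<omega> (Suc (Suc i))) + \<rho> ^ Suc (Suc i) * kernel_coeff \<omega> (Suc (Suc (Suc i)))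
        = 1 / 2 * \<rho> ^ i * (1 / M1 - 2 * \<rho> * (1 / M2) + \<rho>\<^sup>2 * (1 / M3))"
      unfolding k M1_def M2_def M3_def by (simp add: algebra_simps power2_eq_square)
    also have "\<bar>\<dots>\<bar> = 1 / 2 * \<rho> ^ i * \<bar>1 / M1 - 2 * \<rho> * (1 / M2) + \<rho>\<^sup>2 * (1 / M3)\<bar>"
      using \<rho> by (simp add: abs_mult)
    also have "\<dots> \<le> 1 / 2 * \<rho> ^ i * (48 * C\<^sup>2 / M1 * (1 / x\<^sup>2 + (1 - \<rho>)\<^sup>2))"
      using b \<rho> by (intro mult_left_mono) auto
    also have "\<dots> = 24 * C\<^sup>2 / M1 * (\<rho> ^ i * (1 / x\<^sup>2 + (1 - \<rho>)\<^sup>2))" by simp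
    also have "\<dots> \<le> 24 * C\<^sup>2 / M1 * (65 / x\<^sup>2 * \<rho> ^ (i div 2))"
      unfolding x_def M1_def using Mpos[of "Suc i"] by (intro mult_left_mono power_times_square_le \<rho>) auto
    also have "\<dots> = 24 * 65 * C\<^sup>2 / (rmoment \<omega> (2 * real i + 3) * (real i + 2)\<^sup>2) * \<rho> ^ (i div 2)"
      by (simp add: M1_def M_def x_def add.commute)
    finally show "\<bar>\<rho> ^ i * kernel_coeff \<omega> (Suc i) - 2 * (\<rho> ^ Suc i * kernel_coeff \<omega> (Suc (Suc i))) + \<rho> ^ Suc (Suc i) * kernel_coeff \<omega> (Suc (Suc (Suc i)))\<bar>
      \<le> 24 * 65 * C\<^sup>2 / (rmoment \<omega> (2 * real i + 3) * (real i + 2)\<^sup>2) * \<rho> ^ (i div 2)" .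
  qed
qed

subsection \<open>The derivative of the projection\<close>

text \<open>By orthogonality only the \<open>j\<close> diagonal terms of the expanded square survive.\<close>
lemma nn_integral_geom_poly_le:
  fixes g :: "real \<Rightarrow> real"
  assumes g: "(\<lambda>r. g r * indicator {0..<1} r) \<in> borel_measurable lebesgue"
    and g0: "\<And>r. 0 \<le> r \<Longrightarrow> r < 1 \<Longrightarrow> 0 \<le> g r"
    and int: "integrable disc_area (\<lambda>w. g (cmod w))" and e: "cmod e = 1"
  shows "(\<lambda>w. g (cmod w) * (cmod (geom_poly (e * cnj (sgn w)) j))\<^sup>2) \<in> borel_measurable disc_area" (is ?m)
    and "(\<integral>\<^sup>+w. ennreal (g (cmod w) * (cmod (geom_poly (e * cnj (sgn w)) j))\<^sup>2) \<partial>disc_area)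
      \<le> ennreal (real j * (LINT w|disc_area. g (cmod w)))" (is ?le)
proof -
  define h where "h = (\<lambda>w. g (cmod w) * (cmod (geom_poly (e * cnj (sgn w)) j))\<^sup>2)"
  define G where "G = (\<lambda>a b w. of_real (g (cmod w)) * (sgn w ^ b * cnj (sgn w) ^ a) :: complex)"
  have gn: "0 \<le> g (cmod w)" if "w \<in> space disc_area" for w using g0[of "cmod w"] that by simp
  have Gm: "G a b \<in> borel_measurable disc_area" for a b
    unfolding G_def
    by (rule borel_measurable_times[OF measurable_compose[OF measurable_cmod_disc_area[OF g] borel_measurable_of_real] disc_area_measurable])
      measurable
  have Gn: "norm (G a b w) \<le> norm (g (cmod w))" for a b w
  proof -
    have "cmod (sgn w) ^ b * cmod (sgn w) ^ a \<le> 1"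
      by (intro mult_le_one power_le_one) (auto simp: norm_sgn)
    then have "\<bar>g (cmod w)\<bar> * (cmod (sgn w) ^ b * cmod (sgn w) ^ a) \<le> \<bar>g (cmod w)\<bar>"
      by (intro mult_left_le) auto
    then show ?thesis by (simp add: G_def norm_mult norm_power)
  qed
  have Gi: "integrable disc_area (G a b)" for a b
    by (rule Bochner_Integration.integrable_bound[OF int Gm], rule AE_I2, rule Gn)
  have exp: "of_real (h w) = (\<Sum>a<j. \<Sum>b<j. e ^ a * cnj e ^ b * G a b w)" for w
  proof -
    have "of_real ((cmod (geom_poly (e * cnj (sgn w)) j))\<^sup>2)
        = (\<Sum>a<j. (e * cnj (sgn w)) ^ a) * (\<Sum>b<j. (cnj e * sgn w) ^ b)"
      by (simp only: complex_norm_square geom_poly_def cnj_sum complex_cnj_power complex_cnj_mult complex_cnj_cnj)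
    also have "\<dots> = (\<Sum>a<j. \<Sum>b<j. (e * cnj (sgn w)) ^ a * (cnj e * sgn w) ^ b)" by (rule sum_product)
    finally have "of_real (h w) = of_real (g (cmod w)) * (\<Sum>a<j. \<Sum>b<j. (e * cnj (sgn w)) ^ a * (cnj e * sgn w) ^ b)"
      by (simp only: h_def of_real_mult)
    also have "\<dots> = (\<Sum>a<j. \<Sum>b<j. e ^ a * cnj e ^ b * G a b w)"
      unfolding sum_distrib_left G_def power_mult_distrib by (intro sum.cong refl) (simp only: mult_ac)
    finally show ?thesis .
  qed
  have ci: "integrable disc_area (\<lambda>w. of_real (h w) :: complex)"
    unfolding exp by (intro Bochner_Integration.integrable_sum integrable_mult_right Gi)
  then have hi: "integrable disc_area h" using integrable_Re[OF ci] by simp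
  show ?m using hi by (simp add: h_def)
  have "of_real (integral\<^sup>L disc_area h) = (LINT w|disc_area. (of_real (h w) :: complex))"
    by (rule integral_complex_of_real[symmetric])
  also have "\<dots> = (\<Sum>a<j. \<Sum>b<j. e ^ a * cnj e ^ b * integral\<^sup>L disc_area (G a b))"
    unfolding exp by (simp add: Gi Bochner_Integration.integral_sum)
  also have "\<dots> = (\<Sum>a<j. \<Sum>b<j. if b = a then e ^ a * cnj e ^ a * integral\<^sup>L disc_area (G a a) else 0)"
    using integral_disc_area_orthogonal[OF g] by (intro sum.cong refl) (auto simp: G_def)
  also have "\<dots> = (\<Sum>a<j. e ^ a * cnj e ^ a * integral\<^sup>L disc_area (G a a))"
    by (intro sum.cong refl) (simp add: sum.delta)
  finally have "cmod (of_real (integral\<^sup>L disc_area h)) \<le> (\<Sum>a<j. cmod (e ^ a * cnj e ^ a * integral\<^sup>L disc_area (G a a)))"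
    by (simp only: norm_sum)
  also have "\<dots> \<le> (\<Sum>a<j. (LINT w|disc_area. g (cmod w)))"
  proof (rule sum_mono)
    fix a
    have "cmod (integral\<^sup>L disc_area (G a a)) \<le> (LINT w|disc_area. cmod (G a a w))"
      by (rule integral_norm_bound)
    also have "\<dots> \<le> (LINT w|disc_area. g (cmod w))"
    proof (rule integral_mono[OF integrable_norm[OF Gi] int])
      fix w assume "w \<in> space disc_area"
      then show "norm (G a a w) \<le> g (cmod w)" using Gn[of a a w] gn[of w] by simp
    qed
    finally show "cmod (e ^ a * cnj e ^ a * integral\<^sup>L disc_area (G a a)) \<le> (LINT w|disc_area. g (cmod w))"
      by (simp add: norm_mult norm_power e)
  qed
  finally have "integral\<^sup>L disc_area h \<le> real j * (LINT w|disc_area. g (cmod w))" by simp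
  then have "ennreal (integral\<^sup>L disc_area h) \<le> ennreal (real j * (LINT w|disc_area. g (cmod w)))"
    by (rule ennreal_leI)
  moreover have "(\<integral>\<^sup>+w. ennreal (h w) \<partial>disc_area) = ennreal (integral\<^sup>L disc_area h)"
    by (rule nn_integral_eq_integral[OF hi], rule AE_I2) (use gn in \<open>auto simp: h_def\<close>)
  ultimately show ?le by (simp add: h_def)
qed

text \<open>The radial density contributes a factor r, which is simply bounded by 1 so that the
  order of the moment stays q. At r = 0 it makes the left integrand vanish, so the convention for
  \<open>0 powr 0\<close> does no harm when q = 0.\<close>

lemma disc_moment_le:
  assumes \<sigma>: "radial_weight \<sigma>"
  shows "integrable disc_area (\<lambda>w. \<sigma> (cmod w) * cmod w ^ q)"
    and "(LINT w|disc_area. \<sigma> (cmod w) * cmod w ^ q) \<le> 2 * rmoment \<sigma> (real q)"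
    and "(\<lambda>r. \<sigma> r * r ^ q * indicator {0..<1} r) \<in> borel_measurable lebesgue"
proof -
  note m' = measurable_radial_powr[OF radial_weight_measurable[OF \<sigma>], of "real q"]
  show m: "(\<lambda>r. \<sigma> r * r ^ q * indicator {0..<1} r) \<in> borel_measurable lebesgue"
    by (rule measurable_radial_power[OF radial_weight_measurable[OF \<sigma>]])
  have nonneg: "0 \<le> \<sigma> (cmod w) * cmod w ^ q" if "w \<in> space disc_area" for w
    using that radial_weight_nonneg[OF \<sigma>, of "cmod w"] by simp
  have "(\<integral>\<^sup>+w. ennreal (\<sigma> (cmod w) * cmod w ^ q) \<partial>disc_area) = (\<integral>\<^sup>+r\<in>{0..<1}. ennreal (2 * r * (\<sigma> r * r ^ q)) \<partial>lebesgue)"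
    using nn_integral_radial_disc_area[OF m] .
  also have "\<dots> \<le> (\<integral>\<^sup>+r. 2 * (ennreal (r powr real q * \<sigma> r) * indicator {0..<1} r) \<partial>lebesgue)"
  proof (rule nn_integral_mono)
    fix r :: real
    show "ennreal (2 * r * (\<sigma> r * r ^ q)) * indicator {0..<1} r \<le> 2 * (ennreal (r powr real q * \<sigma> r) * indicator {0..<1} r)"
    proof (cases "r \<in> {0..<1} \<and> r \<noteq> 0")
      case True
      then have p: "r powr real q = r ^ q" by (simp add: powr_realpow)
      have "r * (\<sigma> r * r ^ q) \<le> 1 * (\<sigma> r * r ^ q)"
        using True radial_weight_nonneg[OF \<sigma>, of r] by (intro mult_right_mono) auto
      then have "ennreal (2 * r * (\<sigma> r * r ^ q)) \<le> ennreal (2 * (r powr real q * \<sigma> r))"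
        unfolding p by (intro ennreal_leI) (simp add: mult_ac)
      then show ?thesis using True ennreal_mult'[of 2 "r powr real q * \<sigma> r"] by simp
    qed auto
  qed
  also have "\<dots> = 2 * moment \<sigma> (real q)" unfolding moment_def by (rule nn_integral_cmult[OF m'])
  also have "\<dots> = ennreal (2 * rmoment \<sigma> (real q))"
    using ennreal_mult'[of 2 "rmoment \<sigma> (real q)"] by (simp add: ennreal_rmoment[OF \<sigma>])
  finally have le: "(\<integral>\<^sup>+w. ennreal (\<sigma> (cmod w) * cmod w ^ q) \<partial>disc_area) \<le> ennreal (2 * rmoment \<sigma> (real q))" .
  show i: "integrable disc_area (\<lambda>w. \<sigma> (cmod w) * cmod w ^ q)"
  proof (rule integrableI_nonneg)
    show "(\<lambda>w. \<sigma> (cmod w) * cmod w ^ q) \<in> borel_measurable disc_area" by (rule measurable_cmod_disc_area[OF m])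
    show "AE w in disc_area. 0 \<le> \<sigma> (cmod w) * cmod w ^ q" by (rule AE_I2[OF nonneg])
    show "(\<integral>\<^sup>+w. ennreal (\<sigma> (cmod w) * cmod w ^ q) \<partial>disc_area) < \<infinity>" using le by (simp add: le_less_trans)
  qed
  have "ennreal (LINT w|disc_area. \<sigma> (cmod w) * cmod w ^ q) \<le> ennreal (2 * rmoment \<sigma> (real q))"
    using le nn_integral_eq_integral[OF i AE_I2[OF nonneg]] by simp
  then show "(LINT w|disc_area. \<sigma> (cmod w) * cmod w ^ q) \<le> 2 * rmoment \<sigma> (real q)"
    by (subst (asm) ennreal_le_iff) (auto simp: rmoment_def)
qed

lemma suminf_power_div_4_le:
  fixes t :: real
  assumes t: "0 \<le> t" "t < 1"
  shows "(\<Sum>i. ennreal (t ^ (i div 4))) \<le> ennreal (4 / (1 - t))"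
proof (rule suminf_le_const)
  fix n :: nat
  have block: "(\<Sum>i<4 * n. t ^ (i div 4)) = 4 * (\<Sum>k<n. t ^ k)" for n
  proof (induction n)
    case (Suc n)
    have e: "4 * Suc n = Suc (Suc (Suc (Suc (4 * n))))" by simp
    have "4 * n div 4 = n" "Suc (4 * n) div 4 = n" "Suc (Suc (4 * n)) div 4 = n" "Suc (Suc (Suc (4 * n))) div 4 = n"
      by presburger+
    then show ?case unfolding e sum.lessThan_Suc Suc.IH by simp
  qed simp
  have "(\<Sum>i<n. t ^ (i div 4)) \<le> (\<Sum>i<4 * n. t ^ (i div 4))"
    using t by (intro sum_mono2) auto
  also have "\<dots> = 4 * (\<Sum>k<n. t ^ k)" by (rule block)
  also have "\<dots> \<le> 4 * (1 / (1 - t))"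
  proof (rule mult_left_mono)
    have "(1 - t) * (\<Sum>k<n. t ^ k) = 1 - t ^ n" by (rule one_diff_power_eq[symmetric])
    also have "\<dots> \<le> 1" using t by simp
    finally show "(\<Sum>k<n. t ^ k) \<le> 1 / (1 - t)" using t by (simp add: field_simps)
  qed simp
  finally have "ennreal (\<Sum>i<n. t ^ (i div 4)) \<le> ennreal (4 / (1 - t))" by (intro ennreal_leI) simp
  then show "(\<Sum>i<n. ennreal (t ^ (i div 4))) \<le> ennreal (4 / (1 - t))" using t by (simp add: sum_ennreal)
qed simp

text \<open>Let s = q/(q+1). For t beyond s monotonicity suffices. For smaller t the tail at t may
  exceed the one at s, but only by the m-th power of a multiple of (1 - t)(q + 1), and part of
  \<open>t ^ q\<close> absorbs it. Half of the power is kept, to be summed later.\<close>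

lemma power_div_tail_le:
  assumes \<nu>d: "doubling_weight \<nu>"
  shows "\<exists>C>0. \<forall>t q. 0 \<le> t \<longrightarrow> t < 1 \<longrightarrow> t ^ q * tail \<nu> t \<le> C * tail \<nu> (real q / (real q + 1)) * t ^ (q div 2)"
proof -
  note \<nu> = doubling_weight_radial[OF \<nu>d]
  obtain m where m: "\<And>r s. 0 \<le> r \<Longrightarrow> r \<le> s \<Longrightarrow> s < 1 \<Longrightarrow> tail \<nu> r \<le> (2 * (1 - r) / (1 - s)) ^ m * tail \<nu> s"
    using doubling_weight_growth[OF \<nu>d] by blast
  define C where "C = (4 * (real m + 1)) ^ m"
  have C1: "1 \<le> C" unfolding C_def by (intro one_le_power) simp
  show ?thesis
  proof (intro exI conjI allI impI)
    show "0 < C" using C1 by simp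
    fix t :: real and q :: nat assume t: "0 \<le> t" "t < 1"
    define s where "s = real q / (real q + 1)"
    have s: "0 \<le> s" "s < 1" by (auto simp: s_def)
    have ts: "0 \<le> tail \<nu> s" "0 \<le> tail \<nu> t" using s t by (auto intro!: tail_nonneg[OF \<nu>])
    show "t ^ q * tail \<nu> t \<le> C * tail \<nu> (real q / (real q + 1)) * t ^ (q div 2)"
    proof (cases "s \<le> t")
      case True
      have "t ^ q * tail \<nu> t \<le> t ^ (q div 2) * tail \<nu> s"
        using True t s ts by (intro mult_mono power_decreasing tail_antimono[OF \<nu>]) auto
      also have "\<dots> \<le> C * (t ^ (q div 2) * tail \<nu> s)"
        using C1 t ts by (intro mult_right_mono[of 1 C, simplified]) auto
      finally show ?thesis by (simp add: s_def mult_ac)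
    next
      case False
      \<comment> \<open>Each of the m factors 1 - t receives \<open>t ^ p\<close>; the choice makes
        \<open>p * m\<close> at most q/2 while p + 1 is still at least (q + 1)/(2(m + 1)).\<close>
      define p where "p = q div (2 * (m + 1))"
      have "p * (2 * (m + 1)) \<le> q" unfolding p_def by (rule div_times_less_eq_dividend)
      then have "2 * (p * m) \<le> q" by simp
      then have pq: "p * m + q div 2 \<le> q" by linarith
      have "q < 2 * (m + 1) * (p + 1)"
        unfolding p_def using dividend_less_times_div[of "2 * (m + 1)" q] by simp
      then have "q + 1 \<le> 2 * (m + 1) * (p + 1)" by simp
      then have "real (q + 1) \<le> real (2 * (m + 1) * (p + 1))" by (simp only: of_nat_le_iff)
      then have qp: "real q + 1 \<le> 2 * (real m + 1) * (real p + 1)" by (simp add: algebra_simps)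
      have "1 - s = 1 / (real q + 1)" by (simp add: s_def field_simps)
      then have "tail \<nu> t \<le> (2 * (1 - t) * (real q + 1)) ^ m * tail \<nu> s"
        using m[of t s] False t s by simp
      then have "t ^ q * tail \<nu> t \<le> t ^ (p * m + q div 2) * ((2 * (1 - t) * (real q + 1)) ^ m * tail \<nu> s)"
        using t ts pq by (intro mult_mono power_decreasing) auto
      also have "\<dots> = (((1 - t) * t ^ p) * (2 * (real q + 1))) ^ m * tail \<nu> s * t ^ (q div 2)"
        unfolding power_add power_mult power_mult_distrib by simp
      also have "\<dots> \<le> (1 / real (Suc p) * (2 * (2 * (real m + 1) * (real p + 1)))) ^ m * tail \<nu> s * t ^ (q div 2)"
        using power_times_one_minus_le[of t p] t ts qp
        by (intro mult_right_mono power_mono mult_mono) auto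
      also have "1 / real (Suc p) * (2 * (2 * (real m + 1) * (real p + 1))) = 4 * (real m + 1)"
        by (simp add: field_simps)
      finally show ?thesis by (simp add: C_def s_def)
    qed
  qed
qed

text \<open>Polynomial growth against geometric decay; the cube matches the bound on
  \<open>product_poly\<close> and lets the boundary terms vanish.\<close>

lemma kernel_coeff_power_tendsto_0:
  assumes \<omega>d: "doubling_weight \<omega>" and \<rho>: "0 \<le> \<rho>" "\<rho> < 1"
  shows "(\<lambda>i. \<rho> ^ i * kernel_coeff \<omega> (Suc i) * (real i + 2) ^ 3) \<longlonglongrightarrow> 0"
proof -
  note \<omega> = doubling_weight_radial[OF \<omega>d]
  obtain A p where A: "0 < A" "\<And>n. kernel_coeff \<omega> n \<le> A * (real n + 1) ^ p"
    using kernel_coeff_growth[OF \<omega>d] by blast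
  have "(\<lambda>i. A * 2 ^ (p + 3) * ((real i + 1) ^ (p + 3) * \<rho> ^ i)) \<longlonglongrightarrow> A * 2 ^ (p + 3) * 0"
    by (intro tendsto_mult tendsto_const summable_LIMSEQ_zero summable_poly_geometric \<rho>)
  then have g: "(\<lambda>i. A * 2 ^ (p + 3) * ((real i + 1) ^ (p + 3) * \<rho> ^ i)) \<longlonglongrightarrow> 0" by simp
  show ?thesis
  proof (rule Lim_null_comparison[OF always_eventually g], intro allI)
    fix i
    have k: "0 \<le> kernel_coeff \<omega> (Suc i)" using kernel_coeff_pos[OF \<omega>, of "Suc i"] by simp
    have "kernel_coeff \<omega> (Suc i) * (real i + 2) ^ 3 \<le> A * (real i + 2) ^ p * (real i + 2) ^ 3"
      using A(2)[of "Suc i"] by (intro mult_right_mono) (auto simp: add.commute)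
    also have "\<dots> = A * (real i + 2) ^ (p + 3)" by (simp add: power_add)
    also have "\<dots> \<le> A * (2 * (real i + 1)) ^ (p + 3)" using A(1) by (intro mult_left_mono power_mono) auto
    also have "\<dots> = A * 2 ^ (p + 3) * (real i + 1) ^ (p + 3)" unfolding power_mult_distrib by simp
    finally have "\<rho> ^ i * (kernel_coeff \<omega> (Suc i) * (real i + 2) ^ 3) \<le> \<rho> ^ i * (A * 2 ^ (p + 3) * (real i + 1) ^ (p + 3))"
      using \<rho> by (intro mult_left_mono) auto
    then show "norm (\<rho> ^ i * kernel_coeff \<omega> (Suc i) * (real i + 2) ^ 3) \<le> A * 2 ^ (p + 3) * ((real i + 1) ^ (p + 3) * \<rho> ^ i)"
      using k \<rho> by (simp add: abs_mult mult_ac)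
  qed
qed

text \<open>The derivative of the kernel as a power series in the single variable
  \<open>u = z * cnj w\<close>; the chain-rule factor \<open>cnj w\<close> is kept outside.\<close>

definition kernel_deriv :: "(real \<Rightarrow> real) \<Rightarrow> complex \<Rightarrow> complex"
  where "kernel_deriv \<omega> u = (\<Sum>n. of_real (real (Suc n) * kernel_coeff \<omega> (Suc n)) * u ^ n)"

text \<open>No differentiation under the integral: the projection is a power series, which is
  differentiated termwise, and the result is folded back into an integral by the exchange lemma
  applied to \<open>F w * cnj w\<close>.\<close>

lemma bergman_projection_has_derivative:
  assumes \<omega>d: "doubling_weight \<omega>" and F: "integrable disc_area (\<lambda>w. f w * of_real (\<omega> (cmod w)))" and z: "cmod z < 1"
  shows "(bergman_projection \<omega> f has_field_derivative
    (LINT w|disc_area. f w * of_real (\<omega> (cmod w)) * cnj w *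
      kernel_deriv \<omega> (z * cnj w))) (at z)"
    and "integrable disc_area (\<lambda>w. f w * of_real (\<omega> (cmod w)) * cnj w *
      kernel_deriv \<omega> (z * cnj w))"
proof -
  define F where "F = (\<lambda>w. f w * of_real (\<omega> (cmod w)))"
  define c where "c = (\<lambda>n. of_real (kernel_coeff \<omega> n) * (LINT w|disc_area. F w * cnj w ^ n))"
  have Fi: "integrable disc_area F" using F by (simp add: F_def)
  have F'i: "integrable disc_area (\<lambda>w. F w * cnj w)"
  proof (rule Bochner_Integration.integrable_bound[OF Fi])
    show "(\<lambda>w. F w * cnj w) \<in> borel_measurable disc_area"
      by (rule borel_measurable_times[OF borel_measurable_integrable[OF Fi] disc_area_measurable]) measurable
    show "AE w in disc_area. norm (F w * cnj w) \<le> norm (F w)"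
      by (intro AE_I2) (auto simp: norm_mult intro!: mult_left_le)
  qed
  have sums: "(\<lambda>n. c n * y ^ n) sums bergman_projection \<omega> f y" if "cmod y < 1" for y
    using bergman_projection_sums(2)[OF \<omega>d F that] by (simp add: c_def F_def mult_ac)
  \<comment> \<open>Any point of the disc of larger modulus than z would do; convergence there
    justifies termwise differentiation at z.\<close>
  define K where "K = complex_of_real ((1 + cmod z) / 2)"
  have cK: "cmod K = (1 + cmod z) / 2" unfolding K_def norm_of_real by simp
  have "DERIV (\<lambda>y. \<Sum>n. c n * y ^ n) z :> (\<Sum>n. diffs c n * z ^ n)"
  proof (rule termdiffs_strong)
    show "summable (\<lambda>n. c n * K ^ n)" using sums[of K] z cK by (auto simp: sums_iff)
    show "norm z < norm K" using z cK by simp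
  qed
  note D0 = this
  have ev: "eventually (\<lambda>y. (\<Sum>n. c n * y ^ n) = bergman_projection \<omega> f y) (nhds z)"
  proof -
    have "eventually (\<lambda>y. y \<in> ball 0 1) (nhds z)" using z by (intro eventually_nhds_in_open) auto
    then show ?thesis by eventually_elim (use sums in \<open>auto simp: sums_iff\<close>)
  qed
  have D: "DERIV (bergman_projection \<omega> f) z :> (\<Sum>n. diffs c n * z ^ n)"
    using D0 DERIV_cong_ev[OF refl ev refl] by blast
  have s: "summable (\<lambda>n. \<bar>real (Suc n) * kernel_coeff \<omega> (Suc n)\<bar> * cmod z ^ n)"
    using z by (intro summable_kernel_coeff(2)[OF \<omega>d]) auto
  note ps = sums_integral_power_series[OF F'i s z, folded kernel_deriv_def]
  have "(\<lambda>n. of_real (real (Suc n) * kernel_coeff \<omega> (Suc n)) * z ^ n * (LINT w|disc_area. F w * cnj w * cnj w ^ n))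
      = (\<lambda>n. diffs c n * z ^ n)"
    by (rule ext) (simp add: diffs_def c_def mult_ac)
  with ps(2) have "(\<Sum>n. diffs c n * z ^ n) = (LINT w|disc_area. F w * cnj w *
      kernel_deriv \<omega> (z * cnj w))"
    by (simp add: sums_iff)
  with D show "(bergman_projection \<omega> f has_field_derivative
    (LINT w|disc_area. f w * of_real (\<omega> (cmod w)) * cnj w *
      kernel_deriv \<omega> (z * cnj w))) (at z)"
    by (simp add: F_def)
  show "integrable disc_area (\<lambda>w. f w * of_real (\<omega> (cmod w)) * cnj w *
      kernel_deriv \<omega> (z * cnj w))"
    using ps(1) by (simp add: F_def)
qed

text \<open>Sums the Parseval bounds of the first i + 2 polynomials; the square cancels the one in
  the denominator of the second difference bound.\<close>

lemma sum_atMost_le_square: "(\<Sum>j\<le>i + 2. real j) \<le> (real i + 2)\<^sup>2"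
proof -
  have "2 * (\<Sum>j\<le>n. real j) = real n * (real n + 1)" for n
    by (induction n) (simp_all add: algebra_simps)
  from this[of "i + 2"] have "2 * (\<Sum>j\<le>i + 2. real j) = (real i + 2) * (real i + 3)" by (simp add: algebra_simps)
  also have "\<dots> \<le> (real i + 2) * (2 * (real i + 2))" by (intro mult_left_mono) auto
  also have "\<dots> = 2 * (real i + 2)\<^sup>2" by (simp add: power2_eq_square)
  finally show ?thesis by (simp only: mult_le_cancel_left_pos zero_less_numeral)
qed

text \<open>After angular integration the i-th term carries a moment of \<open>\<sigma>\<close> of
  order \<open>i div 2\<close> over the moment of \<open>\<omega>\<close> of order 2i + 3, the
  factors \<open>(real i + 2)\<^sup>2\<close> having cancelled. The moment form of (iii) replaces
  this quotient by the reciprocal of a moment of \<open>\<nu>\<close>, and a power of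
  \<open>cmod z\<close> turns that into \<open>1 / tail \<nu> (cmod z)\<close>.\<close>

lemma kernel_derivative_integral_bound:
  fixes K :: real
  assumes \<nu>: "radial_weight \<nu>" and \<omega>d: "doubling_weight \<omega>" and K: "0 \<le> K"
    and bound: "tail_condition \<nu> \<omega> K"
  shows "\<exists>B\<ge>0. \<forall>z. cmod z < 1 \<longrightarrow>
    (\<integral>\<^sup>+w. ennreal (\<omega> (cmod w) / tail \<nu> (cmod w) *
      cmod (kernel_deriv \<omega> (z * cnj w))) \<partial>disc_area)
    \<le> ennreal (B / ((1 - cmod z) * tail \<nu> (cmod z)))"
proof -
  note \<omega> = doubling_weight_radial[OF \<omega>d]
  define \<sigma> where "\<sigma> = (\<lambda>r. \<omega> r / tail \<nu> r)"
  note q = doubling_weight_quotient[OF \<nu> \<omega>d K bound, folded \<sigma>_def]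
  note \<sigma> = doubling_weight_radial[OF q(2)]
  obtain K' where K': "0 \<le> K'" "\<And>x y. 0 \<le> x \<Longrightarrow> x \<le> y \<Longrightarrow> y + 1 \<le> 8 * (x + 1) \<Longrightarrow>
    rmoment \<nu> x / rmoment \<omega> y * rmoment \<sigma> x \<le> K'"
    using tail_condition_imp_rmoment_condition[OF \<nu> \<omega>d K bound] unfolding \<sigma>_def by blast
  obtain C where C: "0 < C" "\<And>i \<rho>. 0 \<le> \<rho> \<Longrightarrow> \<rho> \<le> 1 \<Longrightarrow>
    \<bar>\<rho> ^ i * kernel_coeff \<omega> (Suc i) - 2 * (\<rho> ^ Suc i * kernel_coeff \<omega> (Suc (Suc i))) + \<rho> ^ Suc (Suc i) * kernel_coeff \<omega> (Suc (Suc (Suc i)))\<bar>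
      \<le> C / (rmoment \<omega> (2 * real i + 3) * (real i + 2)\<^sup>2) * \<rho> ^ (i div 2)"
    using kernel_second_difference_bound[OF \<omega>d] by blast
  obtain L where L: "0 < L" "\<And>t q. 0 \<le> t \<Longrightarrow> t < 1 \<Longrightarrow> t ^ q * tail \<nu> t \<le> L * tail \<nu> (real q / (real q + 1)) * t ^ (q div 2)"
    using power_div_tail_le[OF q(1)] by blast
  define D where "D = C * 2 * K' * (exp 1 * L)"
  have D: "0 \<le> D" using C(1) K'(1) L(1) by (simp add: D_def)
  have main: "(\<integral>\<^sup>+w. ennreal (\<sigma> (cmod w) *
      cmod (kernel_deriv \<omega> (z * cnj w))) \<partial>disc_area)
    \<le> ennreal (D * 4 / ((1 - cmod z) * tail \<nu> (cmod z)))" if z: "cmod z < 1" for z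
  proof -
    define t where "t = cmod z"
    \<comment> \<open>At z = 0 the direction is set to 1, because \<open>sgn 0 = 0\<close> is not
      unimodular.\<close>
    define e where "e = (if z = 0 then 1 else sgn z)"
    have e: "cmod e = 1" "z = of_real t * e"
      by (simp add: e_def norm_sgn, simp add: e_def t_def sgn_eq)
    have t: "0 \<le> t" "t < 1" using z by (auto simp: t_def)
    define S where "S = (\<lambda>w. kernel_deriv \<omega> (z * cnj w))"
    define v where "v = (\<lambda>w. e * cnj (sgn w))"
    \<comment> \<open>Only the part of the bound that depends on i and t; the matching power of
      \<open>cmod w\<close> goes into Y, to become a moment of \<open>\<sigma>\<close>.\<close>
    define c where "c = (\<lambda>i. C / (rmoment \<omega> (2 * real i + 3) * (real i + 2)\<^sup>2) * t ^ (i div 2))"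
    have m0: "0 < rmoment \<omega> (2 * real i + 3)" for i by (intro rmoment_pos[OF \<omega>]) simp
    have c0: "0 \<le> c i" for i using C(1) m0[of i] t by (simp add: c_def)
    define Y where "Y = (\<lambda>i j w. \<sigma> (cmod w) * cmod w ^ (i div 2) * (cmod (geom_poly (v w) j))\<^sup>2)"
    have s0: "0 \<le> \<sigma> r * r ^ k" if "0 \<le> r" "r < 1" for r k
      using radial_weight_nonneg[OF \<sigma>, of r] that by simp
    have Y0: "0 \<le> Y i j w" if "w \<in> space disc_area" for i j w
      using s0[of "cmod w" "i div 2"] that by (simp add: Y_def)
    note Yall = nn_integral_geom_poly_le[OF disc_moment_le(3)[OF \<sigma>] s0 disc_moment_le(1)[OF \<sigma>] e(1)]
    have Ym: "(\<lambda>w. ennreal (Y i j w)) \<in> borel_measurable disc_area" for i j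
      using Yall(1)[of "i div 2" j] unfolding Y_def v_def by (rule measurable_compose[OF _ measurable_ennreal])
    have Yle: "(\<integral>\<^sup>+w. ennreal (Y i j w) \<partial>disc_area) \<le> ennreal (real j * (2 * rmoment \<sigma> (real (i div 2))))" for i j
    proof -
      have "(\<integral>\<^sup>+w. ennreal (Y i j w) \<partial>disc_area) \<le> ennreal (real j * (LINT w|disc_area. \<sigma> (cmod w) * cmod w ^ (i div 2)))"
        using Yall(2)[of "i div 2" j] unfolding Y_def v_def .
      also have "\<dots> \<le> ennreal (real j * (2 * rmoment \<sigma> (real (i div 2))))"
        by (intro ennreal_leI mult_left_mono disc_moment_le(2)[OF \<sigma>]) auto
      finally show ?thesis .
    qed
    \<comment> \<open>The origin is left out because \<open>v w\<close> has modulus 1 only for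
      nonzero w; it is a null set.\<close>
    have pointwise: "ennreal (\<sigma> (cmod w) * cmod (S w)) \<le> (\<Sum>i. ennreal (c i) * (\<Sum>j\<le>i + 2. ennreal (Y i j w)))"
      if w: "w \<in> space disc_area" "w \<noteq> 0" for w
    proof -
      define \<rho> where "\<rho> = t * cmod w"
      have z1: "cmod w < 1" using w by simp
      have \<rho>: "0 \<le> \<rho>" "\<rho> < 1" "\<rho> \<le> 1"
        using t z1 mult_strict_mono'[of t 1 "cmod w" 1] by (auto simp: \<rho>_def)
      have v1: "cmod (v w) = 1" using w e(1) by (simp add: v_def norm_mult norm_sgn)
      have u: "z * cnj w = of_real \<rho> * v w"
      proof -
        have "w = of_real (cmod w) * sgn w" by (simp add: sgn_eq)
        then have "cnj w = of_real (cmod w) * cnj (sgn w)" by (metis complex_cnj_complex_of_real complex_cnj_mult)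
        then show ?thesis by (subst e(2)) (simp add: \<rho>_def v_def mult_ac)
      qed
      define b where "b = (\<lambda>i. \<rho> ^ i * kernel_coeff \<omega> (Suc i))"
      have term_eq: "of_real (real (Suc n) * kernel_coeff \<omega> (Suc n)) * (z * cnj w) ^ n = of_real (real (Suc n) * b n) * v w ^ n" for n
        unfolding u b_def power_mult_distrib by simp
      have "(\<lambda>n. of_real (real (Suc n) * kernel_coeff \<omega> (Suc n)) * (z * cnj w) ^ n) sums S w"
        unfolding S_def kernel_deriv_def
      proof (rule summable_sums, rule summable_comparison_test'[where N = 0])
        show "summable (\<lambda>n. \<bar>real (Suc n) * kernel_coeff \<omega> (Suc n)\<bar> * \<rho> ^ n)"
          by (rule summable_kernel_coeff(2)[OF \<omega>d \<rho>(1,2)])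
        show "norm (of_real (real (Suc n) * kernel_coeff \<omega> (Suc n)) * (z * cnj w) ^ n) \<le> \<bar>real (Suc n) * kernel_coeff \<omega> (Suc n)\<bar> * \<rho> ^ n" for n
          unfolding u norm_mult norm_power norm_of_real v1 using \<rho> by simp
      qed
      then have "(\<lambda>n. of_real (real (Suc n) * b n) * v w ^ n) sums S w" unfolding term_eq .
      then have "ennreal (cmod (S w)) \<le> (\<Sum>i. ennreal (\<bar>b i - 2 * b (Suc i) + b (Suc (Suc i))\<bar> * (\<Sum>j\<le>i + 2. (cmod (geom_poly (v w) j))\<^sup>2)))"
        using kernel_coeff_power_tendsto_0[OF \<omega>d \<rho>(1,2)]
        by (intro norm_power_series_le_second_differences[OF v1]) (auto simp: b_def)
      then have "ennreal (\<sigma> (cmod w)) * ennreal (cmod (S w))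
        \<le> ennreal (\<sigma> (cmod w)) * (\<Sum>i. ennreal (\<bar>b i - 2 * b (Suc i) + b (Suc (Suc i))\<bar> * (\<Sum>j\<le>i + 2. (cmod (geom_poly (v w) j))\<^sup>2)))"
        by (rule mult_left_mono) simp
      also have "\<dots> = (\<Sum>i. ennreal (\<sigma> (cmod w)) * ennreal (\<bar>b i - 2 * b (Suc i) + b (Suc (Suc i))\<bar> * (\<Sum>j\<le>i + 2. (cmod (geom_poly (v w) j))\<^sup>2)))"
        by (rule ennreal_suminf_cmult[symmetric])
      also have "\<dots> \<le> (\<Sum>i. ennreal (c i) * (\<Sum>j\<le>i + 2. ennreal (Y i j w)))"
      proof (rule suminf_le)
        fix i
        have \<sigma>0: "0 \<le> \<sigma> (cmod w)" using s0[of "cmod w" 0] z1 by simp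
        define Q where "Q = (\<Sum>j\<le>i + 2. (cmod (geom_poly (v w) j))\<^sup>2)"
        have Q: "0 \<le> Q" unfolding Q_def by (intro sum_nonneg) auto
        have "\<bar>b i - 2 * b (Suc i) + b (Suc (Suc i))\<bar> \<le> C / (rmoment \<omega> (2 * real i + 3) * (real i + 2)\<^sup>2) * \<rho> ^ (i div 2)"
          unfolding b_def by (rule C(2)[OF \<rho>(1,3)])
        also have "\<dots> = c i * cmod w ^ (i div 2)"
          unfolding \<rho>_def c_def power_mult_distrib by simp
        finally have "\<sigma> (cmod w) * (\<bar>b i - 2 * b (Suc i) + b (Suc (Suc i))\<bar> * Q) \<le> \<sigma> (cmod w) * (c i * cmod w ^ (i div 2) * Q)"
          using \<sigma>0 Q by (intro mult_left_mono mult_right_mono)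
        also have "\<dots> = c i * (\<Sum>j\<le>i + 2. Y i j w)"
          unfolding Q_def Y_def sum_distrib_left by (intro sum.cong refl) (simp only: mult_ac)
        finally have "ennreal (\<sigma> (cmod w) * (\<bar>b i - 2 * b (Suc i) + b (Suc (Suc i))\<bar> * Q)) \<le> ennreal (c i * (\<Sum>j\<le>i + 2. Y i j w))"
          by (rule ennreal_leI)
        also have "\<dots> = ennreal (c i) * (\<Sum>j\<le>i + 2. ennreal (Y i j w))"
          using c0[of i] Y0[OF w(1)] by (simp only: ennreal_mult' sum_ennreal)
        finally show "ennreal (\<sigma> (cmod w)) * ennreal (\<bar>b i - 2 * b (Suc i) + b (Suc (Suc i))\<bar> * (\<Sum>j\<le>i + 2. (cmod (geom_poly (v w) j))\<^sup>2))
          \<le> ennreal (c i) * (\<Sum>j\<le>i + 2. ennreal (Y i j w))"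
          using \<sigma>0 by (simp add: Q_def ennreal_mult')
      qed auto
      finally show ?thesis using s0[of "cmod w" 0] z1 by (simp add: ennreal_mult')
    qed
    have "AE w in disc_area. w \<noteq> 0"
    proof (rule AE_I')
      have "emeasure lebesgue {0::complex} = 0" by simp
      then show "{0} \<in> null_sets disc_area"
        by (auto simp: null_sets_def disc_area_def emeasure_restrict_space sets_restrict_space_iff)
    qed auto
    then have "AE w in disc_area. ennreal (\<sigma> (cmod w) * cmod (S w)) \<le> (\<Sum>i. ennreal (c i) * (\<Sum>j\<le>i + 2. ennreal (Y i j w)))"
      by (rule AE_mp) (intro AE_I2 impI pointwise)
    then have "(\<integral>\<^sup>+w. ennreal (\<sigma> (cmod w) * cmod (S w)) \<partial>disc_area)
      \<le> (\<integral>\<^sup>+w. (\<Sum>i. ennreal (c i) * (\<Sum>j\<le>i + 2. ennreal (Y i j w))) \<partial>disc_area)"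
      by (rule nn_integral_mono_AE)
    also have "\<dots> = (\<Sum>i. ennreal (c i) * (\<Sum>j\<le>i + 2. (\<integral>\<^sup>+w. ennreal (Y i j w) \<partial>disc_area)))"
    proof -
      have Zm: "(\<lambda>w. \<Sum>j\<le>n. ennreal (Y i j w)) \<in> borel_measurable disc_area" for i n
        by (intro borel_measurable_sum Ym)
      have "(\<integral>\<^sup>+w. (\<Sum>i. ennreal (c i) * (\<Sum>j\<le>i + 2. ennreal (Y i j w))) \<partial>disc_area)
          = (\<Sum>i. \<integral>\<^sup>+w. ennreal (c i) * (\<Sum>j\<le>i + 2. ennreal (Y i j w)) \<partial>disc_area)"
        by (intro nn_integral_suminf borel_measurable_times_ennreal borel_measurable_const Zm)
      also have "\<dots> = (\<Sum>i. ennreal (c i) * (\<integral>\<^sup>+w. (\<Sum>j\<le>i + 2. ennreal (Y i j w)) \<partial>disc_area))"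
        by (intro suminf_cong nn_integral_cmult Zm)
      also have "\<dots> = (\<Sum>i. ennreal (c i) * (\<Sum>j\<le>i + 2. (\<integral>\<^sup>+w. ennreal (Y i j w) \<partial>disc_area)))"
        by (intro suminf_cong arg_cong2[where f = "(*)"] refl nn_integral_sum Ym)
      finally show ?thesis .
    qed
    also have "\<dots> \<le> (\<Sum>i. ennreal (D / tail \<nu> t) * ennreal (t ^ (i div 4)))"
    proof (rule suminf_le)
      fix i :: nat
      \<comment> \<open>The common order for the moments of \<open>\<sigma>\<close> and
        \<open>\<nu>\<close>; 2i + 4 is at most 8(k + 1), as the moment comparison requires.\<close>
      define k where "k = i div 2"
      have k: "k div 2 = i div 4" unfolding k_def by presburger
      have n: "0 < rmoment \<nu> (real k)" "0 < rmoment \<sigma> (real k)" by (auto intro!: rmoment_pos \<nu> \<sigma>)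
      have tp: "0 < tail \<nu> t" using t by (intro radial_weight_tail_pos[OF \<nu>])
      have "i \<le> 2 * k + 1" unfolding k_def by presburger
      then have "real i \<le> real (2 * k + 1)" by (simp only: of_nat_le_iff)
      moreover have "k \<le> i" by (simp add: k_def)
      moreover have "2 * i + 4 \<le> 8 * (k + 1)" unfolding k_def by presburger
      then have "real (2 * i + 4) \<le> real (8 * (k + 1))" by (simp only: of_nat_le_iff)
      ultimately have "rmoment \<nu> (real k) / rmoment \<omega> (2 * real i + 3) * rmoment \<sigma> (real k) \<le> K'"
        by (intro K'(2)) auto
      then have r: "rmoment \<sigma> (real k) / rmoment \<omega> (2 * real i + 3) \<le> K' / rmoment \<nu> (real k)"
        using n by (simp add: field_simps)
      \<comment> \<open>Half of \<open>t ^ k\<close> buys the passage from the moment of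
        \<open>\<nu>\<close> to its tail at t; the other half is the summable
        \<open>t ^ (i div 4)\<close>.\<close>
      have "t ^ k * tail \<nu> t \<le> L * tail \<nu> (real k / (real k + 1)) * t ^ (k div 2)" by (rule L(2)[OF t])
      also have "\<dots> \<le> L * (exp 1 * rmoment \<nu> (real k)) * t ^ (k div 2)"
        using L(1) t by (intro mult_right_mono mult_left_mono rmoment_ge[OF \<nu>]) auto
      finally have tk: "t ^ k / rmoment \<nu> (real k) \<le> exp 1 * L * t ^ (i div 4) / tail \<nu> t"
        unfolding k using n tp by (simp add: field_simps)
      have "(\<Sum>j\<le>i + 2. (\<integral>\<^sup>+w. ennreal (Y i j w) \<partial>disc_area)) \<le> (\<Sum>j\<le>i + 2. ennreal (real j * (2 * rmoment \<sigma> (real k))))"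
        unfolding k_def by (intro sum_mono Yle)
      also have "\<dots> = ennreal ((\<Sum>j\<le>i + 2. real j) * (2 * rmoment \<sigma> (real k)))"
        unfolding sum_distrib_right using n by (intro sum_ennreal) auto
      also have "\<dots> \<le> ennreal ((real i + 2)\<^sup>2 * (2 * rmoment \<sigma> (real k)))"
        using n by (intro ennreal_leI mult_right_mono sum_atMost_le_square) auto
      finally have "ennreal (c i) * (\<Sum>j\<le>i + 2. (\<integral>\<^sup>+w. ennreal (Y i j w) \<partial>disc_area))
        \<le> ennreal (c i) * ennreal ((real i + 2)\<^sup>2 * (2 * rmoment \<sigma> (real k)))"
        by (rule mult_left_mono) simp
      also have "\<dots> = ennreal (c i * ((real i + 2)\<^sup>2 * (2 * rmoment \<sigma> (real k))))"
        by (rule ennreal_mult'[OF c0, symmetric])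
      also have "c i * ((real i + 2)\<^sup>2 * (2 * rmoment \<sigma> (real k))) = C * 2 * t ^ k * (rmoment \<sigma> (real k) / rmoment \<omega> (2 * real i + 3))"
        by (simp add: c_def k_def[symmetric])
      also have "ennreal \<dots> \<le> ennreal (C * 2 * t ^ k * (K' / rmoment \<nu> (real k)))"
        using C(1) t r by (intro ennreal_leI mult_left_mono) auto
      also have "C * 2 * t ^ k * (K' / rmoment \<nu> (real k)) = C * 2 * K' * (t ^ k / rmoment \<nu> (real k))" by simp
      also have "ennreal \<dots> \<le> ennreal (C * 2 * K' * (exp 1 * L * t ^ (i div 4) / tail \<nu> t))"
        using C(1) K'(1) by (intro ennreal_leI mult_left_mono tk) auto
      also have "C * 2 * K' * (exp 1 * L * t ^ (i div 4) / tail \<nu> t) = D / tail \<nu> t * t ^ (i div 4)"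
        by (simp add: D_def)
      also have "ennreal (D / tail \<nu> t * t ^ (i div 4)) = ennreal (D / tail \<nu> t) * ennreal (t ^ (i div 4))"
        using D tp by (intro ennreal_mult') simp
      finally show "ennreal (c i) * (\<Sum>j\<le>i + 2. (\<integral>\<^sup>+w. ennreal (Y i j w) \<partial>disc_area)) \<le> ennreal (D / tail \<nu> t) * ennreal (t ^ (i div 4))" .
    qed auto
    also have "\<dots> = ennreal (D / tail \<nu> t) * (\<Sum>i. ennreal (t ^ (i div 4)))" by (rule ennreal_suminf_cmult)
    also have "\<dots> \<le> ennreal (D / tail \<nu> t) * ennreal (4 / (1 - t))"
      by (intro mult_left_mono suminf_power_div_4_le t) auto
    also have "\<dots> = ennreal (D * 4 / ((1 - t) * tail \<nu> t))"
      using D t tail_nonneg[OF \<nu> t(1)] by (simp add: ennreal_mult'[symmetric] mult.commute)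
    finally show ?thesis by (simp add: S_def t_def)
  qed
  then show ?thesis using D unfolding \<sigma>_def by (intro exI[of _ "D * 4"]) auto
qed

text \<open>Almost everywhere \<open>cmod (f w) * \<omega> (cmod w)\<close> is at most the norm of f
  times \<open>\<sigma> (cmod w)\<close>. Integrability of \<open>\<sigma>\<close> therefore makes
  the projection defined and holomorphic, and the kernel estimate, taken against
  \<open>\<sigma>\<close>, bounds its derivative uniformly in f.\<close>

lemma tail_condition_imp_projection_bounded:
  fixes K :: real
  assumes \<nu>: "radial_weight \<nu>" and \<omega>d: "doubling_weight \<omega>" and K: "0 \<le> K"
    and bound: "tail_condition \<nu> \<omega> K"
  shows "bergman_projection_bounded \<omega> \<nu>"
proof -
  note \<omega> = doubling_weight_radial[OF \<omega>d]
  define \<sigma> where "\<sigma> = (\<lambda>r. \<omega> r / tail \<nu> r)"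
  note \<sigma> = doubling_weight_radial[OF doubling_weight_quotient(2)[OF \<nu> \<omega>d K bound], folded \<sigma>_def]
  have \<sigma>i: "integrable disc_area (\<lambda>w. \<sigma> (cmod w))"
    using disc_moment_le(1)[OF \<sigma>, of 0] by simp
  obtain B where B: "0 \<le> B" "\<And>z. cmod z < 1 \<Longrightarrow>
    (\<integral>\<^sup>+w. ennreal (\<sigma> (cmod w) *
      cmod (kernel_deriv \<omega> (z * cnj w))) \<partial>disc_area)
    \<le> ennreal (B / ((1 - cmod z) * tail \<nu> (cmod z)))"
    using kernel_derivative_integral_bound[OF \<nu> \<omega>d K bound] unfolding \<sigma>_def by blast
  have step: "(\<forall>z\<in>unit_disc. integrable disc_area (bergman_integrand \<omega> f z)) \<and>
      bergman_projection \<omega> f holomorphic_on unit_disc \<and>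
      bloch_norm \<nu> (bergman_projection \<omega> f) \<le> ennreal B * Linf_norm \<nu> f" if f: "f \<in> Linf \<nu>" for f
  proof -
    define N where "N = enn2real (Linf_norm \<nu> f)"
    have N: "Linf_norm \<nu> f = ennreal N" "0 \<le> N" using f by (auto simp: Linf_def N_def)
    have AE: "AE w in disc_area. cmod (f w) * \<omega> (cmod w) \<le> N * \<sigma> (cmod w)"
    proof -
      have "AE w in disc_area. ennreal (cmod (f w) * tail \<nu> (cmod w)) \<le> ennreal N"
        using esssup_AE[of "\<lambda>w. ennreal (cmod (f w) * tail \<nu> (cmod w))" disc_area] N(1)
        by (simp add: Linf_norm_def)
      then show ?thesis
      proof (rule AE_mp, intro AE_I2 impI)
        fix w assume z: "w \<in> space disc_area" and le: "ennreal (cmod (f w) * tail \<nu> (cmod w)) \<le> ennreal N"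
        have tp: "0 < tail \<nu> (cmod w)" using z by (intro radial_weight_tail_pos[OF \<nu>]) auto
        have "cmod (f w) * tail \<nu> (cmod w) \<le> N" using le N(2) by simp
        then have "cmod (f w) \<le> N / tail \<nu> (cmod w)" using tp by (simp add: field_simps)
        then have "cmod (f w) * \<omega> (cmod w) \<le> N / tail \<nu> (cmod w) * \<omega> (cmod w)"
          using z radial_weight_nonneg[OF \<omega>, of "cmod w"] by (intro mult_right_mono) auto
        then show "cmod (f w) * \<omega> (cmod w) \<le> N * \<sigma> (cmod w)" by (simp add: \<sigma>_def)
      qed
    qed
    have F: "integrable disc_area (\<lambda>w. f w * of_real (\<omega> (cmod w)))"
    proof (rule Bochner_Integration.integrable_bound)
      show "integrable disc_area (\<lambda>w. N * \<sigma> (cmod w))" using \<sigma>i by simp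
      show "(\<lambda>w. f w * of_real (\<omega> (cmod w))) \<in> borel_measurable disc_area"
      proof (rule borel_measurable_times)
        show "f \<in> borel_measurable disc_area" using f by (simp add: Linf_def)
        show "(\<lambda>w. of_real (\<omega> (cmod w)) :: complex) \<in> borel_measurable disc_area"
          by (rule measurable_compose[OF measurable_cmod_disc_area[OF radial_weight_measurable[OF \<omega>]] borel_measurable_of_real])
      qed
      show "AE w in disc_area. norm (f w * of_real (\<omega> (cmod w))) \<le> norm (N * \<sigma> (cmod w))"
        using AE
      proof (rule AE_mp, intro AE_I2 impI)
        fix w assume z: "w \<in> space disc_area" and le: "cmod (f w) * \<omega> (cmod w) \<le> N * \<sigma> (cmod w)"
        then show "norm (f w * of_real (\<omega> (cmod w))) \<le> norm (N * \<sigma> (cmod w))"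
          using radial_weight_nonneg[OF \<omega>, of "cmod w"] by (simp add: norm_mult)
      qed
    qed
    note der = bergman_projection_has_derivative[OF \<omega>d F]
    have hol: "bergman_projection \<omega> f holomorphic_on unit_disc"
      unfolding holomorphic_on_def
    proof
      fix z :: complex assume "z \<in> unit_disc"
      then have "cmod z < 1" by simp
      from der(1)[OF this] have "bergman_projection \<omega> f field_differentiable at z"
        unfolding field_differentiable_def by blast
      then show "bergman_projection \<omega> f field_differentiable at z within unit_disc"
        by (rule field_differentiable_at_within)
    qed
    have "bloch_norm \<nu> (bergman_projection \<omega> f) \<le> ennreal B * ennreal N"
      unfolding bloch_norm_def
    proof (rule SUP_least)
      fix z :: complex assume "z \<in> unit_disc"
      then have z: "cmod z < 1" by simp
      define S where "S = (\<lambda>w. kernel_deriv \<omega> (z * cnj w))"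
      have tp: "0 < (1 - cmod z) * tail \<nu> (cmod z)"
        using z by (intro mult_pos_pos radial_weight_tail_pos[OF \<nu>]) auto
      have d: "deriv (bergman_projection \<omega> f) z = (LINT w|disc_area. f w * of_real (\<omega> (cmod w)) * cnj w * S w)"
        unfolding S_def by (rule DERIV_imp_deriv[OF der(1)[OF z]])
      have "ennreal (cmod (deriv (bergman_projection \<omega> f) z)) \<le> (\<integral>\<^sup>+w. norm (f w * of_real (\<omega> (cmod w)) * cnj w * S w) \<partial>disc_area)"
        unfolding d S_def by (rule integral_norm_bound_ennreal[OF der(2)[OF z]])
      also have "\<dots> \<le> (\<integral>\<^sup>+w. ennreal N * ennreal (\<sigma> (cmod w) * cmod (S w)) \<partial>disc_area)"
        using AE
      proof (intro nn_integral_mono_AE, elim AE_mp, intro AE_I2 impI)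
        fix w assume zz: "w \<in> space disc_area" and le: "cmod (f w) * \<omega> (cmod w) \<le> N * \<sigma> (cmod w)"
        have w: "0 \<le> \<omega> (cmod w)" using zz by (intro radial_weight_nonneg[OF \<omega>]) auto
        have "norm (f w * of_real (\<omega> (cmod w)) * cnj w * S w) = cmod (f w) * \<omega> (cmod w) * cmod w * cmod (S w)"
          using w by (simp add: norm_mult)
        also have "\<dots> \<le> cmod (f w) * \<omega> (cmod w) * cmod (S w)"
          using w zz by (intro mult_right_mono mult_left_le) auto
        also have "\<dots> \<le> N * \<sigma> (cmod w) * cmod (S w)" using le by (intro mult_right_mono) auto
        finally show "ennreal (norm (f w * of_real (\<omega> (cmod w)) * cnj w * S w)) \<le> ennreal N * ennreal (\<sigma> (cmod w) * cmod (S w))"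
          using N(2) by (simp add: ennreal_mult'[symmetric] ennreal_leI mult.assoc)
      qed
      also have "\<dots> \<le> ennreal N * (\<integral>\<^sup>+w. ennreal (\<sigma> (cmod w) * cmod (S w)) \<partial>disc_area)"
      proof (subst nn_integral_cmult)
        have t: "summable (\<lambda>n. \<bar>real (Suc n) * kernel_coeff \<omega> (Suc n)\<bar> * cmod z ^ n)"
          using z by (intro summable_kernel_coeff(2)[OF \<omega>d]) auto
        have "integrable disc_area (\<lambda>w. of_real (\<sigma> (cmod w)) * S w)"
          unfolding S_def kernel_deriv_def using \<sigma>i by (intro sums_integral_power_series(1)[OF _ t z]) simp
        from borel_measurable_integrable[OF integrable_norm[OF this]]
        have "(\<lambda>w. ennreal (norm (of_real (\<sigma> (cmod w)) * S w))) \<in> borel_measurable disc_area"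
          by (rule measurable_compose[OF _ measurable_ennreal])
        then show "(\<lambda>w. ennreal (\<sigma> (cmod w) * cmod (S w))) \<in> borel_measurable disc_area"
        proof (rule measurable_cong[THEN iffD1, rotated])
          fix w assume "w \<in> space disc_area"
          then have "0 \<le> \<sigma> (cmod w)" by (intro radial_weight_nonneg[OF \<sigma>]) auto
          then show "ennreal (norm (of_real (\<sigma> (cmod w)) * S w)) = ennreal (\<sigma> (cmod w) * cmod (S w))"
            by (simp add: norm_mult)
        qed
      qed simp
      also have "\<dots> \<le> ennreal N * ennreal (B / ((1 - cmod z) * tail \<nu> (cmod z)))"
        unfolding S_def by (intro mult_left_mono B(2) z) auto
      also have "\<dots> = ennreal (N * (B / ((1 - cmod z) * tail \<nu> (cmod z))))" using N(2) by (rule ennreal_mult'[symmetric])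
      finally have "cmod (deriv (bergman_projection \<omega> f) z) \<le> N * (B / ((1 - cmod z) * tail \<nu> (cmod z)))"
        using N(2) B(1) tp by (subst (asm) ennreal_le_iff) auto
      then have "(1 - cmod z) * tail \<nu> (cmod z) * cmod (deriv (bergman_projection \<omega> f) z)
          \<le> (1 - cmod z) * tail \<nu> (cmod z) * (N * (B / ((1 - cmod z) * tail \<nu> (cmod z))))"
        using tp by (intro mult_left_mono) auto
      also have "\<dots> = B * N"
      proof -
        have "x * (N * (B / x)) = B * N" if "0 < x" for x using that by simp
        then show ?thesis using tp by blast
      qed
      finally have "ennreal ((1 - cmod z) * tail \<nu> (cmod z) * cmod (deriv (bergman_projection \<omega> f) z)) \<le> ennreal (B * N)"
        by (rule ennreal_leI)
      then show "ennreal ((1 - cmod z) * tail \<nu> (cmod z) * cmod (deriv (bergman_projection \<omega> f) z)) \<le> ennreal B * ennreal N"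
        using B(1) by (simp add: ennreal_mult')
    qed
    with hol bergman_projection_sums(1)[OF \<omega>d F] show ?thesis by (auto simp: N(1))
  qed
  show ?thesis
    unfolding bergman_projection_bounded_def
  proof (intro conjI ballI exI[of _ B])
    fix f assume f: "f \<in> Linf \<nu>"
    have "Linf_norm \<nu> f < \<infinity>" using f by (simp add: Linf_def)
    then have "ennreal B * Linf_norm \<nu> f < \<infinity>" by (simp add: ennreal_mult_less_top)
    then show "bergman_projection \<omega> f \<in> bloch \<nu>"
      using step[OF f] by (auto simp: bloch_def intro: le_less_trans)
  qed (use step in auto)
qed

theorem theorem6:
  fixes \<nu> \<omega> :: "real \<Rightarrow> real"
  assumes "radial_weight \<nu>" and "doubling_weight \<omega>"
  shows "(bergman_projection_bounded \<omega> \<nu> \<longleftrightarrow>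
      (SUP x\<in>{0::real..}. moment \<nu> x / moment \<omega> (2 * x) * moment (\<lambda>r. \<omega> r / tail \<nu> r) x) < \<infinity>) \<and>
    ((SUP x\<in>{0::real..}. moment \<nu> x / moment \<omega> (2 * x) * moment (\<lambda>r. \<omega> r / tail \<nu> r) x) < \<infinity> \<longleftrightarrow>
      (SUP r\<in>{0::real..<1}. ennreal (tail \<nu> r / tail \<omega> r) *
        (\<integral>\<^sup>+s\<in>{r..<1}. ennreal (\<omega> s / tail \<nu> s) \<partial>lebesgue)) < \<infinity>)"
  unfolding SUP_ennreal_less_top_iff
  using moment_condition_imp_tail_condition[OF assms] tail_condition_imp_moment_condition[OF assms]
    projection_bounded_imp_tail_condition[OF assms] tail_condition_imp_projection_bounded[OF assms]
  by blast

end
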